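(* Let $K$ be an algebraically closed field of characteristic zero and $S=K[x_1,x_2,x_3,x_4]$. Let $I=(f_1,f_2,f_3,f_4)$ be an ideal generated by a regular sequence of homogeneous polynomials $f_1,f_2,f_3,f_4\in S$ of degree $2$ such that the algebra $S/I$ has the strong Lefschetz property. Then the generic initial ideal $J=\mathrm{Gin}(I)$ of $I$ with respect to the reverse lexicographic order is \[J=(x_1^2,\ x_1x_2,\ x_2^2,\ x_1x_3,\ x_2x_3^2,\ x_3^3,\ x_2x_3x_4,\ x_3^2x_4,\ x_1x_4^3,\ x_2x_4^3,\ x_3x_4^3,\ x_4^5).\] In particular, this equality holds for a generic sequence of homogeneous polynomials $f_1,f_2,f_3,f_4\in S$ of degree $2$, and also for every regular sequence $f_1,f_2,f_3,f_4$ of homogeneous polynomials of degree $2$ with $f_i\in K[x_i,\ldots,x_4]$ for $1\le i\le 4$.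
   Context: The reverse lexicographic (revlex) order is the graded reverse lexicographic order with $x_1>x_2>x_3>x_4$. The generic initial ideal $\mathrm{Gin}(I)$ of a homogeneous ideal $I\subset S$ is the initial ideal, with respect to this order, of $g(I)$ for a generic linear change of coordinates $g$: there is a nonempty Zariski open subset of $GL_4(K)$ on which $\mathrm{in}(g(I))$ is constant, and $\mathrm{Gin}(I)$ is this common value. A homogeneous polynomial $f$ of degree $s$ is semiregular for $S/I$ if for every $t\ge 0$ the multiplication map $(S/I)_t\xrightarrow{\cdot f}(S/I)_{t+s}$ is injective or surjective. $S/I$ has the strong Lefschetz property (SLP) if there is a linear form $\ell\in S$ such that $\ell^b$ is semiregular for $S/I$ for all integers $b\ge 1$. A property holds for a generic sequence of homogeneous polynomials of degrees $d_1,\ldots,d_m$ if there is a nonempty Zariski open subset $U\subset S_{d_1}\times\cdots\times S_{d_m}$ such that the property holds for every tuple $(f_1,\ldots,f_m)\in U$. *)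

theory Defs
  imports
    "HOL-Library.Poly_Mapping"
    "HOL-Library.Numeral_Type"
    "HOL-Computational_Algebra.Polynomial"
    "HOL-Analysis.Determinants"
begin

section \<open>Polynomials in several variables\<close>

text \<open>
  \<open>('n, 'k) mpol\<close> is the polynomial ring over \<open>'k\<close> in variables indexed by \<open>'n\<close>:
  finitely supported families of coefficients, indexed by exponent vectors.
\<close>

type_synonym 'n monom = "'n \<Rightarrow>\<^sub>0 nat"
type_synonym ('n, 'k) mpol = "'n monom \<Rightarrow>\<^sub>0 'k"

definition Const :: "'k::zero \<Rightarrow> ('n, 'k) mpol" where
  "Const c = Poly_Mapping.single 0 c"

definition Var :: "'n \<Rightarrow> ('n, 'k::zero_neq_one) mpol" where
  "Var i = Poly_Mapping.single (Poly_Mapping.single i 1) 1"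

text \<open>
  The ring \<open>K[x\<^sub>1,x\<^sub>2,x\<^sub>3,x\<^sub>4]\<close> is \<open>(4, 'k) mpol\<close>. The elements of the type \<open>4\<close> are
  ordered as \<open>0 < 1 < 2 < 3\<close> (and \<open>4 = 0\<close> there), so \<open>x\<^sub>i\<close> is the variable with index \<open>i - 1\<close>.
\<close>

abbreviation x1 :: "(4, 'k::zero_neq_one) mpol" where "x1 \<equiv> Var 0"
abbreviation x2 :: "(4, 'k::zero_neq_one) mpol" where "x2 \<equiv> Var 1"
abbreviation x3 :: "(4, 'k::zero_neq_one) mpol" where "x3 \<equiv> Var 2"
abbreviation x4 :: "(4, 'k::zero_neq_one) mpol" where "x4 \<equiv> Var 3"

text \<open>Evaluation of \<open>p\<close> at \<open>a\<close>, with the coefficients mapped along \<open>h\<close>.\<close>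

definition eval_with ::
    "('k::zero \<Rightarrow> 'r::comm_ring_1) \<Rightarrow> ('i \<Rightarrow> 'r) \<Rightarrow> ('i, 'k) mpol \<Rightarrow> 'r" where
  "eval_with h a p =
     (\<Sum>m\<in>Poly_Mapping.keys p. h (Poly_Mapping.lookup p m) *
        (\<Prod>i\<in>Poly_Mapping.keys m. a i ^ Poly_Mapping.lookup m i))"

definition mdeg :: "'n monom \<Rightarrow> nat" where
  "mdeg m = (\<Sum>i\<in>Poly_Mapping.keys m. Poly_Mapping.lookup m i)"

text \<open>The zero polynomial is homogeneous of every degree.\<close>

definition homogeneous :: "nat \<Rightarrow> ('n, 'k::zero) mpol \<Rightarrow> bool" where
  "homogeneous d f \<longleftrightarrow> (\<forall>m\<in>Poly_Mapping.keys f. mdeg m = d)"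

definition polys_in :: "'n set \<Rightarrow> ('n, 'k::zero) mpol set" where
  "polys_in V = {f. \<forall>m\<in>Poly_Mapping.keys f. Poly_Mapping.keys m \<subseteq> V}"

section \<open>Ideals, regular sequences and the strong Lefschetz property\<close>

definition ideal_gen :: "'a::comm_ring_1 set \<Rightarrow> 'a set" where
  "ideal_gen B = module.span (*) B"

definition regular_sequence :: "'a::comm_ring_1 list \<Rightarrow> bool" where
  "regular_sequence fs \<longleftrightarrow>
     (\<forall>i<length fs. \<forall>h. fs ! i * h \<in> ideal_gen (set (take i fs)) \<longrightarrow>
                        h \<in> ideal_gen (set (take i fs))) \<and>
     1 \<notin> ideal_gen (set fs)"

text \<open>The residue class of \<open>p\<close> modulo \<open>I\<close>, and the graded piece \<open>(S/I)\<^sub>t\<close>.\<close>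

definition residue_class :: "'a::comm_ring_1 set \<Rightarrow> 'a \<Rightarrow> 'a set" where
  "residue_class I p = {q. q - p \<in> I}"

definition graded_piece :: "('n, 'k::comm_ring_1) mpol set \<Rightarrow> nat \<Rightarrow> ('n, 'k) mpol set set" where
  "graded_piece I t = residue_class I ` {p. homogeneous t p}"

text \<open>Multiplication by \<open>f\<close> on \<open>S/I\<close>: for an ideal \<open>I\<close> this sends \<open>p + I\<close> to \<open>f * p + I\<close>.\<close>

definition mult_class :: "'a::comm_ring_1 set \<Rightarrow> 'a \<Rightarrow> 'a set \<Rightarrow> 'a set" where
  "mult_class I f X = (\<Union>p\<in>X. residue_class I (f * p))"

text \<open>\<open>f\<close> is meant to be homogeneous of degree \<open>s\<close>.\<close>

definition semiregular :: "('n, 'k::comm_ring_1) mpol set \<Rightarrow> nat \<Rightarrow> ('n, 'k) mpol \<Rightarrow> bool" where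
  "semiregular I s f \<longleftrightarrow>
     (\<forall>t. inj_on (mult_class I f) (graded_piece I t) \<or>
          mult_class I f ` graded_piece I t = graded_piece I (t + s))"

definition strong_Lefschetz :: "('n, 'k::comm_ring_1) mpol set \<Rightarrow> bool" where
  "strong_Lefschetz I \<longleftrightarrow> (\<exists>l. homogeneous 1 l \<and> (\<forall>b\<ge>1. semiregular I b (l ^ b)))"

section \<open>Initial ideals for the graded reverse lexicographic order\<close>

text \<open>Smaller indices denote larger variables.\<close>

definition revlex_less :: "'n::linorder monom \<Rightarrow> 'n monom \<Rightarrow> bool" where
  "revlex_less a b \<longleftrightarrow>
     mdeg a < mdeg b \<or>
     mdeg a = mdeg b \<and>
     (\<exists>i. Poly_Mapping.lookup a i > Poly_Mapping.lookup b i \<and>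
          (\<forall>j>i. Poly_Mapping.lookup a j = Poly_Mapping.lookup b j))"

definition lead_monom :: "('n::linorder, 'k::zero) mpol \<Rightarrow> 'n monom" where
  "lead_monom f =
     (THE m. m \<in> Poly_Mapping.keys f \<and>
             (\<forall>m'\<in>Poly_Mapping.keys f. m' \<noteq> m \<longrightarrow> revlex_less m' m))"

definition initial_ideal :: "('n::linorder, 'k::comm_ring_1) mpol set \<Rightarrow> ('n, 'k) mpol set" where
  "initial_ideal I = ideal_gen {Poly_Mapping.single (lead_monom f) 1 | f. f \<in> I \<and> f \<noteq> 0}"

section \<open>Zariski open sets, generic sequences and generic initial ideals\<close>

text \<open>
  \<open>U\<close> is open in \<open>W\<close> for the Zariski topology induced by the coordinates \<open>c\<close>, i.e. \<open>U\<close> is the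
  complement in \<open>W\<close> of the common zeros of a set of polynomials in these coordinates.
\<close>

definition zariski_open_in :: "('w \<Rightarrow> 'i \<Rightarrow> 'k::field) \<Rightarrow> 'w set \<Rightarrow> 'w set \<Rightarrow> bool" where
  "zariski_open_in c W U \<longleftrightarrow>
     (\<exists>P :: ('i, 'k) mpol set. U = {w \<in> W. \<exists>p\<in>P. eval_with (\<lambda>a. a) (c w) p \<noteq> 0})"

definition forms :: "nat list \<Rightarrow> ('n, 'k::zero) mpol list set" where
  "forms ds = {fs. length fs = length ds \<and> (\<forall>i<length ds. homogeneous (ds ! i) (fs ! i))}"

text \<open>
  The coordinates of a tuple of forms are the coefficients of its entries. Entries beyond the end
  of the list, and monomials of the wrong degree, only contribute coordinates that vanish
  identically on \<open>forms ds\<close>, which does not affect the topology.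
\<close>

definition forms_coords :: "('n, 'k::zero) mpol list \<Rightarrow> nat \<times> 'n monom \<Rightarrow> 'k" where
  "forms_coords fs = (\<lambda>(i, m). if i < length fs then Poly_Mapping.lookup (fs ! i) m else 0)"

definition generic_sequence :: "nat list \<Rightarrow> (('n, 'k::field) mpol list \<Rightarrow> bool) \<Rightarrow> bool" where
  "generic_sequence ds Q \<longleftrightarrow>
     (\<exists>U. zariski_open_in forms_coords (forms ds) U \<and> U \<noteq> {} \<and> (\<forall>fs\<in>U. Q fs))"

definition GL :: "('k::field ^ 'n ^ 'n) set" where
  "GL = {g. invertible g}"

definition matrix_coords :: "'k ^ 'n ^ 'n \<Rightarrow> 'n \<times> 'n \<Rightarrow> 'k" where
  "matrix_coords g = (\<lambda>(i, j). g $ i $ j)"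

text \<open>The substitution of \<open>\<Sum>\<^sub>j g\<^sub>i\<^sub>j x\<^sub>j\<close> for \<open>x\<^sub>i\<close>.\<close>

definition change_coords :: "'k::field ^ 'n ^ 'n \<Rightarrow> ('n::finite, 'k) mpol \<Rightarrow> ('n, 'k) mpol" where
  "change_coords g = eval_with Const (\<lambda>i. \<Sum>j\<in>UNIV. Const (g $ i $ j) * Var j)"

definition Gin :: "('n::{finite,linorder}, 'k::field) mpol set \<Rightarrow> ('n, 'k) mpol set" where
  "Gin I =
     (THE J. \<exists>U. zariski_open_in matrix_coords GL U \<and> U \<noteq> {} \<and>
                 (\<forall>g\<in>U. initial_ideal (change_coords g ` I) = J))"

end

theory Submission
  imports Defs
begin

text \<open>
  Write \<open>S\<^sub>t\<close> for the forms of degree \<open>t\<close> and \<open>A = S/I\<close>. The ideal \<open>J\<close> is a segment: its standard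
  monomials of degree 2, 3 and 4 are the 6, 4 and 1 smallest monomials of these degrees for the
  reverse lexicographic order, and it has none in degree 5. A complete intersection of four quadrics
  has exactly these values of the Hilbert function. So everything comes down to one condition,
  \<open>segment_spans\<close>: in the degrees 2 to 5, \<open>S\<^sub>t\<close> is spanned by the ideal and the standard monomials.

  For an ideal generated by any four quadrics this condition forces the initial ideal to be \<open>J\<close>
  (\<open>initial_ideal_eq_segment_ideal\<close>): four quadrics generate too few forms in degrees 2 to 4 for the
  sum to be anything but direct, and since the standard monomials are the smallest ones, a form with
  standard leading monomial is a combination of standard monomials. The condition is also
  Zariski open, both in the coordinate change \<open>g\<close> and in the coefficients of the quadrics
  (\<open>segment_spans_open\<close>). As \<open>GL\<close> is irreducible (\<open>GL_open_sets_meet\<close>), \<open>Gin(I) = J\<close> follows once a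
  single \<open>g\<close> is known for which \<open>g(I)\<close> satisfies it (\<open>Gin_eq_segment_ideal\<close>). There are three sources
  of such a \<open>g\<close>.

  If \<open>l\<close> is a Lefschetz element, choose \<open>g\<close> with \<open>l \<mapsto> x\<^sub>4\<close>. Bijectivity of
  \<open>l\<^sup>2 : A\<^sub>1 \<rightarrow> A\<^sub>3\<close> is the condition in degree 3, \<open>l\<^sup>4 \<noteq> 0\<close> the one in degree 4. In degree 2,
  injectivity of \<open>l : A\<^sub>1 \<rightarrow> A\<^sub>2\<close> takes care of the four monomials divisible by \<open>x\<^sub>4\<close>. The other two are
  \<open>x\<^sub>3\<^sup>2\<close> and \<open>x\<^sub>2x\<^sub>3\<close>; here \<open>A\<^sub>2/lA\<^sub>1\<close> has dimension 2 and is spanned by squares of linear forms, which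
  makes it possible to find linear forms \<open>a\<close>, \<open>b\<close> for which \<open>a\<^sup>2\<close>, \<open>ab\<close> is a basis, and to let
  \<open>a \<mapsto> x\<^sub>3\<close>, \<open>b \<mapsto> x\<^sub>2\<close> (\<open>lefschetz_element_segment_coordinates\<close>).

  For generic quadrics, openness reduces the claim to one example, the squares of the variables, for
  which \<open>x\<^sub>1 + x\<^sub>2 + x\<^sub>3 + x\<^sub>4\<close> is a Lefschetz element (\<open>squares_segment_coordinates\<close>).

  If \<open>f\<^sub>i \<in> K[x\<^sub>i,\<dots>,x\<^sub>4]\<close>, the coefficient \<open>c\<^sub>i\<close> of \<open>x\<^sub>i\<^sup>2\<close> in \<open>f\<^sub>i\<close> is nonzero, since otherwise the \<open>f\<^sub>i\<close> would have a
  common zero other than the origin (\<open>triangular_leading_coefficients\<close>). Rescaling the variables by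
  suitable powers of \<open>t\<close> deforms \<open>f\<^sub>i\<close> to \<open>c\<^sub>ix\<^sub>i\<^sup>2\<close> as \<open>t\<close> tends to 0. By openness the condition passes from the
  squares to the ideal for some \<open>t \<noteq> 0\<close>, where it differs from \<open>I\<close> only by a change of
  coordinates (\<open>triangular_segment_coordinates\<close>).
\<close>

section \<open>Linear independence modulo a subspace\<close>

locale relative_independence = vector_space scale
  for scale :: "'a::field \<Rightarrow> 'b::ab_group_add \<Rightarrow> 'b" (infixr \<open>\<odot>\<close> 75)
begin

text \<open>
  Equivalently, the residue classes of the elements of \<open>C\<close> in the quotient by the span of \<open>U\<close> are
  distinct and linearly independent. Arguing with representatives keeps quotient spaces out of the
  picture.
\<close>

definition indep_mod :: "'b set \<Rightarrow> 'b set \<Rightarrow> bool" where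
  "indep_mod U C \<longleftrightarrow> (\<forall>c\<in>C. c \<notin> span (U \<union> (C - {c})))"

text \<open>
  The Steinitz exchange argument in the quotient. An element \<open>c\<close> of \<open>C\<close> outside the span of \<open>U\<close> and
  \<open>D\<close> can replace \<open>d\<close>; moving \<open>c\<close> into \<open>U\<close> leads back to the same situation with \<open>D\<close> smaller.
\<close>

lemma indep_mod_card_le:
  assumes "finite D" "C \<subseteq> span (U \<union> D)" "indep_mod U C"
  shows "finite C \<and> card C \<le> card D"
  using assms
proof (induction D arbitrary: U C rule: finite_induct)
  case empty
  have "C = {}"
  proof (rule ccontr)
    assume "C \<noteq> {}"
    then obtain c where c: "c \<in> C" by blast
    then have "c \<in> span U" using empty by auto
    then have "c \<in> span (U \<union> (C - {c}))" using span_mono[of U "U \<union> (C - {c})"] by auto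
    then show False using empty c by (auto simp: indep_mod_def)
  qed
  then show ?case by simp
next
  case (insert d D)
  show ?case
  proof (cases "C \<subseteq> span (U \<union> D)")
    case True
    then show ?thesis using insert.IH[OF True insert.prems(2)] insert.hyps by auto
  next
    case False
    then obtain c where c: "c \<in> C" "c \<notin> span (U \<union> D)" by blast
    have "c \<in> span (insert d (U \<union> D))" using insert.prems c by auto
    from in_span_insert[OF this c(2)] have d: "d \<in> span (insert c (U \<union> D))" .
    have "span (insert d (U \<union> D)) \<subseteq> span (insert c (U \<union> D))"
      using d by (intro span_minimal) (auto intro: span_base)
    then have 1: "C - {c} \<subseteq> span (insert c U \<union> D)"
      using insert.prems by auto
    have 2: "indep_mod (insert c U) (C - {c})"
      unfolding indep_mod_def
    proof
      fix x assume x: "x \<in> C - {c}"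
      then have "insert c U \<union> (C - {c} - {x}) = U \<union> (C - {x})" using c by auto
      then show "x \<notin> span (insert c U \<union> (C - {c} - {x}))"
        using insert.prems x by (simp add: indep_mod_def)
    qed
    have "finite (C - {c}) \<and> card (C - {c}) \<le> card D" by (rule insert.IH[OF 1 2])
    then show ?thesis using c insert.hyps by (auto simp: card_Diff_singleton_if)
  qed
qed

lemma indep_mod_insert:
  assumes "indep_mod U C" "v \<notin> span (U \<union> C)"
  shows "indep_mod U (insert v C)"
  unfolding indep_mod_def
proof
  fix c assume c: "c \<in> insert v C"
  show "c \<notin> span (U \<union> (insert v C - {c}))"
  proof (cases "c = v")
    case True
    then have "span (U \<union> (insert v C - {c})) \<subseteq> span (U \<union> C)" by (intro span_mono) auto
    then show ?thesis using True assms by auto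
  next
    case False
    then have cC: "c \<in> C" using c by auto
    show ?thesis
    proof
      assume "c \<in> span (U \<union> (insert v C - {c}))"
      moreover have "U \<union> (insert v C - {c}) = insert v (U \<union> (C - {c}))" using False by auto
      ultimately have 1: "c \<in> span (insert v (U \<union> (C - {c})))" by simp
      have "c \<notin> span (U \<union> (C - {c}))" using assms(1) cC by (auto simp: indep_mod_def)
      from in_span_insert[OF 1 this] have "v \<in> span (insert c (U \<union> (C - {c})))" .
      moreover have "insert c (U \<union> (C - {c})) = U \<union> C" using cC by auto
      ultimately show False using assms by simp
    qed
  qed
qed

text \<open>
  Otherwise \<open>C\<close> could be enlarged by one element, against the exchange bound.
\<close>

lemma indep_mod_spans:
  assumes "C \<subseteq> V" "indep_mod U C" "V \<subseteq> span (U \<union> D)" "finite D" "card D \<le> card C"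
  shows "V \<subseteq> span (U \<union> C)"
proof
  fix v assume v: "v \<in> V"
  show "v \<in> span (U \<union> C)"
  proof (rule ccontr)
    assume n: "v \<notin> span (U \<union> C)"
    have "finite (insert v C) \<and> card (insert v C) \<le> card D"
      using assms v by (intro indep_mod_card_le[OF assms(4) _ indep_mod_insert[OF assms(2) n]]) auto
    moreover have "v \<notin> C" using n span_base[of v "U \<union> C"] by auto
    ultimately show False using assms(5) by auto
  qed
qed

text \<open>
  Otherwise an element of \<open>C\<close> could be dropped, leaving fewer than \<open>card D\<close> spanning elements.
\<close>

lemma spanning_indep_mod:
  assumes "V \<subseteq> span (U \<union> C)" "finite C" "D \<subseteq> V" "indep_mod U D" "card C \<le> card D"
  shows "indep_mod U C"
  unfolding indep_mod_def
proof (intro ballI notI)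
  fix c assume c: "c \<in> C" and s: "c \<in> span (U \<union> (C - {c}))"
  have "span (U \<union> C) \<subseteq> span (U \<union> (C - {c}))"
  proof (rule span_minimal)
    show "U \<union> C \<subseteq> span (U \<union> (C - {c}))"
      using s span_superset[of "U \<union> (C - {c})"] by auto
  qed simp
  then have "D \<subseteq> span (U \<union> (C - {c}))" using assms by auto
  then have "card D \<le> card (C - {c})" using indep_mod_card_le assms by blast
  then show False using c assms by (metis card_Diff1_less leD le_trans)
qed

lemma indep_mod_extend:
  assumes "C \<subseteq> V" "indep_mod U C" "V \<subseteq> span (U \<union> D)" "finite D"
  obtains C' where "C \<subseteq> C'" "C' \<subseteq> V" "indep_mod U C'" "V \<subseteq> span (U \<union> C')"
proof -
  let ?P = "\<lambda>X. C \<subseteq> X \<and> X \<subseteq> V \<and> indep_mod U X"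
  have P0: "?P C" using assms by auto
  have b: "finite X \<and> card X \<le> card D" if "?P X" for X
    using that assms by (intro indep_mod_card_le) auto
  have "\<exists>X. ?P X \<and> (\<forall>Y. ?P Y \<longrightarrow> card Y \<le> card X)"
    using b by (intro ex_has_greatest_nat[of ?P C card "Suc (card D)"] P0)
      (simp add: less_Suc_eq_le)
  then obtain X where X: "?P X" and m: "\<And>Y. ?P Y \<Longrightarrow> card Y \<le> card X"
    by metis
  have "V \<subseteq> span (U \<union> X)"
  proof
    fix v assume v: "v \<in> V"
    show "v \<in> span (U \<union> X)"
    proof (rule ccontr)
      assume n: "v \<notin> span (U \<union> X)"
      then have vX: "v \<notin> X" using span_base[of v "U \<union> X"] by blast
      have "?P (insert v X)" using X v indep_mod_insert[OF _ n] by blast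
      from m[OF this] show False using b[OF X] vX by simp
    qed
  qed
  then show thesis using that X by blast
qed

lemma indep_mod_sum_zero:
  assumes "indep_mod U L" "finite L" "(\<Sum>l\<in>L. a l \<odot> l) \<in> span U" "l \<in> L"
  shows "a l = 0"
proof (rule ccontr)
  assume n: "a l \<noteq> 0"
  let ?W = "span (U \<union> (L - {l}))"
  have "(\<Sum>x\<in>L - {l}. a x \<odot> x) \<in> ?W"
    by (intro span_sum span_scale span_base) auto
  moreover have "(\<Sum>l\<in>L. a l \<odot> l) \<in> ?W"
    using assms(3) span_mono[of U "U \<union> (L - {l})"] by auto
  moreover have "(\<Sum>l\<in>L. a l \<odot> l) = a l \<odot> l + (\<Sum>x\<in>L - {l}. a x \<odot> x)"
    using assms by (simp add: sum.remove)
  ultimately have "(a l \<odot> l + (\<Sum>x\<in>L - {l}. a x \<odot> x)) - (\<Sum>x\<in>L - {l}. a x \<odot> x) \<in> ?W"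
    by (intro span_diff) simp_all
  then have "a l \<odot> l \<in> ?W" by simp
  then have "inverse (a l) \<odot> (a l \<odot> l) \<in> ?W" by (rule span_scale)
  then have "l \<in> ?W" using n by simp
  then show False using assms by (auto simp: indep_mod_def)
qed

lemma span_imageE:
  assumes "w \<in> span (v ` A)" "finite A"
  obtains b where "w = (\<Sum>j\<in>A. b j \<odot> v j)"
proof -
  have "\<exists>b. w = (\<Sum>j\<in>A. b j \<odot> v j)"
    using assms(2,1)
  proof (induction A arbitrary: w rule: finite_induct)
    case (insert j A)
    then obtain k where k: "w - k \<odot> v j \<in> span (v ` A)" by (auto simp: span_insert)
    from insert.IH[OF this] obtain b where b: "w - k \<odot> v j = (\<Sum>j\<in>A. b j \<odot> v j)" by blast
    have "(\<Sum>i\<in>A. (b(j := k)) i \<odot> v i) = (\<Sum>i\<in>A. b i \<odot> v i)"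
      using insert.hyps by (intro sum.cong) auto
    then have "w = (\<Sum>i\<in>insert j A. (b(j := k)) i \<odot> v i)"
      using insert.hyps b by (simp add: algebra_simps)
    then show ?case by blast
  qed simp
  then show thesis using that by blast
qed

lemma indep_mod_family:
  assumes "finite A" "\<And>a i. (\<Sum>i\<in>A. a i \<odot> v i) \<in> span U \<Longrightarrow> i \<in> A \<Longrightarrow> a i = 0"
  shows "inj_on v A" "indep_mod U (v ` A)"
proof -
  have key: "v i \<notin> span (U \<union> (v ` (A - {i})))" if i: "i \<in> A" for i
  proof
    assume "v i \<in> span (U \<union> (v ` (A - {i})))"
    then obtain u w where uw: "v i = u + w" "u \<in> span U" "w \<in> span (v ` (A - {i}))"
      by (auto simp: span_Un)
    obtain b where w: "w = (\<Sum>j\<in>A - {i}. b j \<odot> v j)"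
      using uw(3) assms(1) by (auto elim: span_imageE)
    have "(\<Sum>j\<in>A - {i}. ((\<lambda>j. - b j)(i := 1)) j \<odot> v j) = - w"
      unfolding w sum_negf[symmetric] by (intro sum.cong) auto
    then have "(\<Sum>j\<in>A. ((\<lambda>j. - b j)(i := 1)) j \<odot> v j) = u"
      using i assms(1) uw(1) by (simp add: sum.remove[of A i])
    then have "(\<Sum>j\<in>A. ((\<lambda>j. - b j)(i := 1)) j \<odot> v j) \<in> span U" using uw(2) by simp
    from assms(2)[OF this i] show False by simp
  qed
  show inj: "inj_on v A"
  proof (rule inj_onI, rule ccontr)
    fix i j assume "i \<in> A" "j \<in> A" "v i = v j" "i \<noteq> j"
    then have "v i \<in> U \<union> (v ` (A - {i}))" by auto
    from key[OF \<open>i \<in> A\<close>] span_base[OF this] show False by (rule notE)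
  qed
  show "indep_mod U (v ` A)"
    unfolding indep_mod_def
  proof clarify
    fix i assume i: "i \<in> A" "v i \<in> span (U \<union> (v ` A - {v i}))"
    have "v ` A - {v i} = v ` (A - {i})" using inj i by (auto simp: inj_on_def)
    then show False using key[OF i(1)] i(2) by simp
  qed
qed

text \<open>
  For a subspace \<open>V\<close> this says that the image of \<open>V\<close> in the quotient by the span of \<open>U\<close> has finite dimension
  \<open>n\<close>. With an ideal as \<open>U\<close> and the forms of degree \<open>t\<close> as \<open>V\<close>, \<open>n\<close> is the value of the Hilbert function
  of the quotient ring at \<open>t\<close>.
\<close>

definition rank_mod :: "'b set \<Rightarrow> 'b set \<Rightarrow> nat \<Rightarrow> bool" where
  "rank_mod U V n \<longleftrightarrow>
     (\<exists>C. finite C \<and> card C = n \<and> C \<subseteq> V \<and> indep_mod U C \<and> V \<subseteq> span (U \<union> C))"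

lemma indep_mod_family_sum_zero:
  assumes "inj_on v A" "indep_mod U (v ` A)" "finite A" "(\<Sum>i\<in>A. a i \<odot> v i) \<in> span U" "i \<in> A"
  shows "a i = 0"
proof -
  define b where "b x = a (the_inv_into A v x)" for x
  have "(\<Sum>x\<in>v ` A. b x \<odot> x) = (\<Sum>i\<in>A. a i \<odot> v i)"
    unfolding sum.reindex[OF assms(1)] b_def o_def
    by (rule sum.cong) (auto simp: the_inv_into_f_f[OF assms(1)])
  then have "(\<Sum>x\<in>v ` A. b x \<odot> x) \<in> span U" using assms(4) by simp
  from indep_mod_sum_zero[OF assms(2) _ this, of "v i"]
  have "b (v i) = 0" using assms(3,5) by simp
  then show ?thesis using assms(5) by (simp add: b_def the_inv_into_f_f[OF assms(1)])
qed

lemma rank_modE: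
  assumes "rank_mod U V n"
  obtains C where "finite C" "card C = n" "C \<subseteq> V" "indep_mod U C" "V \<subseteq> span (U \<union> C)"
  using assms unfolding rank_mod_def by (elim exE conjE)

lemma rank_modI:
  "finite C \<Longrightarrow> card C = n \<Longrightarrow> C \<subseteq> V \<Longrightarrow> indep_mod U C \<Longrightarrow> V \<subseteq> span (U \<union> C) \<Longrightarrow> rank_mod U V n"
  unfolding rank_mod_def by (intro exI conjI)

text \<open>
  This and the next lemma are the two halves of the fact that a linear map between spaces of equal
  finite dimension is injective iff it is surjective. They speak of families because the vectors
  arise as images of basis elements and need not be distinct a priori.
\<close>

lemma rank_mod_indep_family_spans:
  assumes "rank_mod U V n" "finite A" "n \<le> card A" "v ` A \<subseteq> V"
    and ind: "\<And>a i. (\<Sum>i\<in>A. a i \<odot> v i) \<in> span U \<Longrightarrow> i \<in> A \<Longrightarrow> a i = 0"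
  shows "V \<subseteq> span (U \<union> v ` A)"
proof -
  obtain C where C: "finite C" "card C = n" "V \<subseteq> span (U \<union> C)"
    using assms(1) by (rule rank_modE)
  have "inj_on v A" "indep_mod U (v ` A)" by (rule indep_mod_family[OF assms(2)], erule (1) ind)+
  then show ?thesis
    using indep_mod_spans[OF assms(4) _ C(3,1)] C(2) assms(3) by (simp add: card_image)
qed

lemma rank_mod_spanning_family_sum_zero:
  assumes "rank_mod U V n" "finite A" "card A \<le> n" "V \<subseteq> span (U \<union> v ` A)"
    and "(\<Sum>i\<in>A. a i \<odot> v i) \<in> span U" "i \<in> A"
  shows "a i = 0"
proof -
  obtain C where C: "finite C" "card C = n" "C \<subseteq> V" "indep_mod U C"
    using assms(1) by (rule rank_modE)
  have fin: "finite (v ` A)" using assms(2) by simp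
  have le: "card (v ` A) \<le> card A" using assms(2) by (rule card_image_le)
  have "C \<subseteq> span (U \<union> v ` A)" using C(3) assms(4) by (rule order_trans)
  then have "card C \<le> card (v ` A)" using indep_mod_card_le[OF fin _ C(4)] by blast
  then have "card (v ` A) = card A" using le assms(3) C(2) by linarith
  then have inj: "inj_on v A" by (rule eq_card_imp_inj_on[OF assms(2)])
  have "card (v ` A) \<le> card C" using le assms(3) C(2) by linarith
  then have "indep_mod U (v ` A)" by (rule spanning_indep_mod[OF assms(4) fin C(3,4)])
  then show ?thesis using inj assms(2,5,6) by (intro indep_mod_family_sum_zero)
qed

lemma rank_mod_spanning_card:
  assumes "rank_mod U V n" "finite D" "V \<subseteq> span (U \<union> D)"
  shows "n \<le> card D"
proof -
  obtain C where C: "finite C" "card C = n" "C \<subseteq> V" "indep_mod U C"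
    using assms(1) by (rule rank_modE)
  have "C \<subseteq> span (U \<union> D)" using C(3) assms(3) by (rule order_trans)
  then show ?thesis using indep_mod_card_le[OF assms(2) _ C(4)] C(2) by blast
qed

end

section \<open>Monomials, degrees and homogeneous components\<close>

abbreviation lookup :: "('a \<Rightarrow>\<^sub>0 'b::zero) \<Rightarrow> 'a \<Rightarrow> 'b" where "lookup \<equiv> Poly_Mapping.lookup"
abbreviation keys :: "('a \<Rightarrow>\<^sub>0 'b::zero) \<Rightarrow> 'a set" where "keys \<equiv> Poly_Mapping.keys"
abbreviation single :: "'a \<Rightarrow> 'b \<Rightarrow> 'a \<Rightarrow>\<^sub>0 'b::zero" where "single \<equiv> Poly_Mapping.single"

abbreviation mon :: "'n monom \<Rightarrow> ('n, 'k::zero_neq_one) mpol" where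
  "mon m \<equiv> single m 1"

abbreviation homs :: "nat \<Rightarrow> ('n, 'k::zero) mpol set" where
  "homs t \<equiv> {p. homogeneous t p}"

lemma lookup_single_mult:
  "lookup (single n c * p) (n + m) = (c :: 'k::comm_ring_1) * lookup p m"
  for n :: "'n monom"
proof -
  have "lookup (single n c * p) (n + m) =
      (\<Sum>l. (c when n = l) * (\<Sum>q. lookup p q when n + m = l + q))"
    by (simp add: lookup_mult lookup_single)
  also have "\<dots> = (\<Sum>l. c * (\<Sum>q. lookup p q when n + m = l + q) when n = l)"
    by (simp add: when_mult)
  also have "\<dots> = c * lookup p m"
    by (simp add: Sum_any_when_equal')
  finally show ?thesis .
qed

lemma lookup_Const_mult [simp]:
  "lookup (Const c * p) m = (c :: 'k::comm_ring_1) * lookup p m"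
  using lookup_single_mult[of 0 c p m] by (simp add: Const_def)

lemma lookup_Const: "lookup (Const c) m = (if m = 0 then c else 0)"
  by (simp add: Const_def lookup_single when_def)

lemma Const_simps [simp]:
  "Const 0 = (0 :: ('n, 'k::comm_ring_1) mpol)" "Const 1 = (1 :: ('n, 'k::comm_ring_1) mpol)"
  by (simp_all add: Const_def)

lemma Const_add: "Const (a + b) = (Const a + Const b :: ('n, 'k::comm_ring_1) mpol)"
  and Const_mult: "Const (a * b) = (Const a * Const b :: ('n, 'k::comm_ring_1) mpol)"
  and Const_minus: "Const (- a) = (- Const a :: ('n, 'k::comm_ring_1) mpol)"
  by (simp_all add: Const_def single_add mult_single single_uminus)

interpretation mp: relative_independence "\<lambda>c p. Const c * p :: ('n, 'k::field) mpol"
  by unfold_locales (simp_all add: Const_add Const_mult algebra_simps)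

declare mp.scale_scale [simp del] mp.scale_left_commute [simp del]

lemma mon_add: "mon (a + b) = (mon a * mon b :: ('n, 'k::comm_ring_1) mpol)"
  by (simp add: mult_single)

lemma Const_mult_mon: "Const c * mon m = (single m c :: ('n, 'k::comm_ring_1) mpol)"
  by (simp add: Const_def mult_single)

lemma mpol_expand:
  "p = (\<Sum>m\<in>keys p. Const (lookup p m) * mon m :: ('n, 'k::comm_ring_1) mpol)"
proof (rule poly_mapping_eqI)
  fix k
  show "lookup p k =
      lookup (\<Sum>m\<in>keys p. Const (lookup p m) * mon m) k"
    by (auto simp: lookup_sum lookup_single when_def if_distrib in_keys_iff cong: if_cong)
qed

lemma mpol_expand_superset:
  assumes "finite M" "keys p \<subseteq> M"
  shows "p = (\<Sum>m\<in>M. Const (lookup p m) * mon m :: ('n, 'k::comm_ring_1) mpol)"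
  by (subst mpol_expand, rule sum.mono_neutral_left) (use assms in \<open>auto simp: in_keys_iff\<close>)

lemma in_span_mon:
  assumes "keys p \<subseteq> M"
  shows "p \<in> mp.span (mon ` M)"
  by (subst mpol_expand, rule mp.span_sum, rule mp.span_scale, rule mp.span_base) (use assms in auto)

lemma keys_of_span_mon:
  assumes "p \<in> mp.span (mon ` M)"
  shows "keys p \<subseteq> M"
proof -
  have "p \<in> {q. keys q \<subseteq> M}"
    by (rule mp.span_induct_alt[OF assms])
      (auto simp: in_keys_iff lookup_add lookup_single when_def split: if_splits)
  then show ?thesis by simp
qed

text \<open>Linear identities only need to be checked on monomials.\<close>

lemma mpol_linear_induct [case_names add Const_mon]:
  assumes "\<And>p q. P p \<Longrightarrow> P q \<Longrightarrow> P (p + q)" "\<And>c m. P (Const c * mon m)"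
  shows "P (p :: ('n, 'k::comm_ring_1) mpol)"
proof -
  have P0: "P 0" using assms(2)[of 0 0] by simp
  have "P (\<Sum>m\<in>M. Const (lookup p m) * mon m)" if "finite M" for M
    using that by (induction M rule: finite_induct) (auto simp del: Const_simps intro: assms P0)
  then show ?thesis using mpol_expand[of p] by (metis finite_keys)
qed

lemma mdeg_sum: "mdeg m = (\<Sum>i\<in>UNIV. lookup m i)" for m :: "'n::finite monom"
  unfolding mdeg_def by (rule sum.mono_neutral_left) (auto simp: in_keys_iff)

lemma mdeg_add: "mdeg (a + b) = mdeg a + mdeg b" for a :: "'n::finite monom"
  by (simp add: mdeg_sum lookup_add sum.distrib)

lemma mdeg_zero [simp]: "mdeg 0 = 0"
  by (simp add: mdeg_def)

lemma mdeg_single [simp]: "mdeg (single i n) = n"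
  by (simp add: mdeg_def)

lemma finite_mdeg: "finite {m :: 'n::finite monom. mdeg m = t}"
proof -
  have "lookup ` {m :: 'n monom. mdeg m = t} \<subseteq> PiE UNIV (\<lambda>_. {..t})"
    by (auto simp: mdeg_sum intro!: member_le_sum)
  moreover have "finite (PiE (UNIV :: 'n set) (\<lambda>_. {..t}))" by (intro finite_PiE) auto
  ultimately have "finite (lookup ` {m :: 'n monom. mdeg m = t})"
    by (rule finite_subset)
  then show ?thesis
    by (rule finite_imageD) (simp add: inj_on_def Poly_Mapping.lookup_inject)
qed

lemma mdeg_SucE:
  fixes m :: "'n::finite monom"
  assumes "mdeg m = Suc n"
  obtains i m' where "m = single i 1 + m'" "mdeg m' = n"
proof -
  have "m \<noteq> 0" using assms by auto
  then obtain i where i: "lookup m i \<noteq> 0" by (metis lookup_zero poly_mapping_eqI)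
  have eq: "m = single i 1 + (m - single i 1)"
    by (rule poly_mapping_eqI) (use i in \<open>auto simp: lookup_add lookup_minus lookup_single when_def\<close>)
  have "mdeg m = 1 + mdeg (m - single i 1)" by (subst eq) (simp only: mdeg_add mdeg_single)
  then show thesis using that[OF eq] assms by simp
qed

lemma mdeg_eq_0_iff: "mdeg m = 0 \<longleftrightarrow> m = 0" for m :: "'n::finite monom"
  by (auto simp: mdeg_sum intro: poly_mapping_eqI)

lemma homogeneous_zero [simp]: "homogeneous t 0"
  by (simp add: homogeneous_def)

lemma homogeneous_add: "homogeneous t p \<Longrightarrow> homogeneous t q \<Longrightarrow> homogeneous t (p + q)"
  for p :: "('n, 'k::comm_ring_1) mpol"
  by (auto simp: homogeneous_def in_keys_iff lookup_add)

lemma homogeneous_Const_mult: "homogeneous t p \<Longrightarrow> homogeneous t (Const c * p)"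
  for p :: "('n, 'k::comm_ring_1) mpol"
  by (auto simp: homogeneous_def in_keys_iff)

lemma homogeneous_uminus: "homogeneous t p \<Longrightarrow> homogeneous t (- p)"
  for p :: "('n, 'k::comm_ring_1) mpol"
  by (auto simp: homogeneous_def in_keys_iff)

lemma homogeneous_diff: "homogeneous t p \<Longrightarrow> homogeneous t q \<Longrightarrow> homogeneous t (p - q)"
  for p :: "('n, 'k::comm_ring_1) mpol"
  using homogeneous_add[OF _ homogeneous_uminus, of t p q] by simp

lemma homogeneous_sum: "(\<And>i. i \<in> A \<Longrightarrow> homogeneous t (f i)) \<Longrightarrow> homogeneous t (\<Sum>i\<in>A. f i)"
  for f :: "'i \<Rightarrow> ('n, 'k::comm_ring_1) mpol"
  by (induction A rule: infinite_finite_induct) (auto intro: homogeneous_add)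

lemma homogeneous_mon [simp]: "homogeneous t (mon m :: ('n, 'k::zero_neq_one) mpol) \<longleftrightarrow> mdeg m = t"
  by (auto simp: homogeneous_def)

lemma homogeneous_mult: "homogeneous s p \<Longrightarrow> homogeneous t q \<Longrightarrow> homogeneous (s + t) (p * q)"
  for p :: "('n::finite, 'k::comm_ring_1) mpol"
  using keys_mult[of p q] by (force simp: homogeneous_def mdeg_add)

lemma homogeneous_one: "homogeneous 0 (1 :: ('n, 'k::comm_ring_1) mpol)"
  by (simp add: homogeneous_def)

lemma homogeneous_power: "homogeneous s p \<Longrightarrow> homogeneous (n * s) (p ^ n)"
  for p :: "('n::finite, 'k::comm_ring_1) mpol"
  by (induction n) (auto intro: homogeneous_one homogeneous_mult)

lemma subspace_homs: "mp.subspace (homs t)"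
  by (auto simp: mp.subspace_def intro: homogeneous_add homogeneous_Const_mult)

lemma homs_eq_span: "homs t = (mp.span (mon ` {m. mdeg m = t}) :: ('n, 'k::field) mpol set)"
proof
  show "homs t \<subseteq> (mp.span (mon ` {m. mdeg m = t}) :: ('n, 'k) mpol set)"
    by (auto simp: homogeneous_def intro!: in_span_mon)
  show "(mp.span (mon ` {m. mdeg m = t}) :: ('n, 'k) mpol set) \<subseteq> homs t"
    by (rule mp.span_minimal[OF _ subspace_homs]) auto
qed

lemma inj_mon: "inj_on (mon :: 'n monom \<Rightarrow> ('n, 'k::zero_neq_one) mpol) A"
  by (rule inj_onI) (metis keys_single insert_iff empty_iff zero_neq_one)

lemma indep_mon:
  assumes "finite M"
  shows "mp.indep_mod {} (mon ` M :: ('n, 'k::field) mpol set)"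
proof (rule mp.indep_mod_family(2)[OF assms])
  fix a :: "'n monom \<Rightarrow> 'k" and i
  assume "(\<Sum>i\<in>M. Const (a i) * mon i) \<in> mp.span {}" "i \<in> M"
  then have "(\<Sum>m\<in>M. Const (a m) * mon m) = 0" by simp
  from arg_cong[OF this, of "\<lambda>p. lookup p i"]
  show "a i = 0"
    using assms \<open>i \<in> M\<close> by (simp add: lookup_sum lookup_single when_def if_distrib cong: if_cong)
qed

lemma rank_mod_homs:
  "mp.rank_mod {} (homs t :: ('n::finite, 'k::field) mpol set) (card {m :: 'n monom. mdeg m = t})"
proof (rule mp.rank_modI)
  let ?C = "mon ` {m. mdeg m = t} :: ('n, 'k) mpol set"
  show "finite ?C" using finite_mdeg by blast
  show "card ?C = card {m :: 'n monom. mdeg m = t}" by (rule card_image[OF inj_mon])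
  show "?C \<subseteq> homs t" by auto
  show "mp.indep_mod {} ?C" by (rule indep_mon[OF finite_mdeg])
  show "homs t \<subseteq> mp.span ({} \<union> ?C)" using homs_eq_span by auto
qed

definition hcomp :: "nat \<Rightarrow> ('n, 'k::zero) mpol \<Rightarrow> ('n, 'k) mpol" where
  "hcomp t p = Poly_Mapping.mapp (\<lambda>m c. if mdeg m = t then c else 0) p"

lemma lookup_hcomp:
  "lookup (hcomp t p) m = (if mdeg m = t then lookup p m else 0)"
  by (auto simp: hcomp_def lookup_mapp when_def in_keys_iff)

lemma hcomp_add: "hcomp t (p + q) = hcomp t p + hcomp t q"
  for p :: "('n, 'k::comm_ring_1) mpol"
  by (rule poly_mapping_eqI) (simp add: lookup_hcomp lookup_add)

lemma hcomp_Const_mult: "hcomp t (Const c * p) = Const c * hcomp t p"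
  for p :: "('n, 'k::comm_ring_1) mpol"
  by (rule poly_mapping_eqI) (simp add: lookup_hcomp)

lemma hcomp_zero [simp]: "hcomp t 0 = 0"
  by (rule poly_mapping_eqI) (simp add: lookup_hcomp)

lemma homogeneous_hcomp [simp]: "homogeneous t (hcomp t p)"
  by (auto simp: homogeneous_def in_keys_iff lookup_hcomp split: if_splits)

lemma hcomp_homogeneous: "homogeneous s p \<Longrightarrow> hcomp t p = (if s = t then p else 0)"
  by (rule poly_mapping_eqI) (auto simp: lookup_hcomp homogeneous_def in_keys_iff)

lemma hcomp_mon [simp]: "hcomp t (mon m) = (if mdeg m = t then mon m else 0)"
  by (simp add: hcomp_homogeneous[of "mdeg m"])

lemma hcomp_mult:
  fixes f p :: "('n::finite, 'k::comm_ring_1) mpol"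
  assumes "homogeneous d f"
  shows "hcomp (d + t) (f * p) = f * hcomp t p" "s < d \<Longrightarrow> hcomp s (f * p) = 0"
proof -
  have h: "homogeneous (d + mdeg m) (f * (Const c * mon m))" for c m
    by (rule homogeneous_mult[OF assms homogeneous_Const_mult]) simp
  show "hcomp (d + t) (f * p) = f * hcomp t p"
  proof (induction p rule: mpol_linear_induct)
    case (Const_mon c m)
    then show ?case
      using hcomp_homogeneous[OF h, of "d + t"]
      by (simp add: hcomp_Const_mult)
  qed (simp add: hcomp_add distrib_left)
  show "hcomp s (f * p) = 0" if "s < d"
  proof (induction p rule: mpol_linear_induct)
    case (Const_mon c m)
    then show ?case
      using hcomp_homogeneous[OF h, of s] that by simp
  qed (simp add: hcomp_add distrib_left)
qed

lemma hcomp_span: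
  assumes "p \<in> mp.span X"
  shows "hcomp t p \<in> mp.span (hcomp t ` X)"
proof -
  have "p \<in> {p. hcomp t p \<in> mp.span (hcomp t ` X)}"
    by (rule mp.span_induct_alt[OF assms])
      (auto simp: hcomp_add hcomp_Const_mult intro: mp.span_add mp.span_scale mp.span_base mp.span_zero)
  then show ?thesis by simp
qed

section \<open>Homogeneous ideals\<close>

lemma module_ring: "module ((*) :: 'a \<Rightarrow> 'a \<Rightarrow> 'a::comm_ring_1)"
  by unfold_locales (simp_all add: algebra_simps)

lemma ideal_gen_base: "b \<in> B \<Longrightarrow> b \<in> ideal_gen B"
  by (simp add: ideal_gen_def module.span_base[OF module_ring])

lemma ideal_gen_zero [simp]: "0 \<in> ideal_gen B"
  by (simp add: ideal_gen_def module.span_zero[OF module_ring])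

lemma ideal_gen_add: "x \<in> ideal_gen B \<Longrightarrow> y \<in> ideal_gen B \<Longrightarrow> x + y \<in> ideal_gen B"
  by (simp add: ideal_gen_def module.span_add[OF module_ring])

lemma ideal_gen_diff: "x \<in> ideal_gen B \<Longrightarrow> y \<in> ideal_gen B \<Longrightarrow> x - y \<in> ideal_gen B"
  by (simp add: ideal_gen_def module.span_diff[OF module_ring])

lemma ideal_gen_mult: "x \<in> ideal_gen B \<Longrightarrow> a * x \<in> ideal_gen B"
  by (simp add: ideal_gen_def module.span_scale[OF module_ring])

lemma ideal_gen_minimal: "B \<subseteq> ideal_gen C \<Longrightarrow> ideal_gen B \<subseteq> ideal_gen C"
  unfolding ideal_gen_def
  by (rule module.span_minimal[OF module_ring _ module.subspace_span[OF module_ring]])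

lemma ideal_gen_insert: "x \<in> ideal_gen (insert f B) \<longleftrightarrow> (\<exists>a. x - a * f \<in> ideal_gen B)"
  by (simp add: ideal_gen_def module.span_insert[OF module_ring])

lemma ideal_gen_induct [consumes 1, case_names zero step]:
  assumes "x \<in> ideal_gen B" "P 0" "\<And>a b y. b \<in> B \<Longrightarrow> P y \<Longrightarrow> P (a * b + y)"
  shows "P x"
  using assms unfolding ideal_gen_def by (rule module.span_induct_alt[OF module_ring])

lemma subspace_ideal_gen: "mp.subspace (ideal_gen B)"
  by (auto simp: mp.subspace_def intro: ideal_gen_add ideal_gen_mult)

lemma span_ideal_gen [simp]: "mp.span (ideal_gen B) = ideal_gen B"
  by (rule mp.span_eq_iff[THEN iffD2, OF subspace_ideal_gen])

lemma ideal_gen_eq_span: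
  "ideal_gen B = (mp.span {b * mon m | b m. b \<in> B} :: ('n, 'k::field) mpol set)"
proof
  let ?X = "{b * mon m | b m. b \<in> B} :: ('n, 'k) mpol set"
  have 1: "b * p \<in> mp.span ?X" if "b \<in> B" for b p
  proof (induction p rule: mpol_linear_induct)
    case (Const_mon c m)
    have "Const c * (b * mon m) \<in> mp.span ?X"
      using that by (intro mp.span_scale mp.span_base) auto
    then show ?case by (simp only: mult.left_commute[of b])
  qed (auto simp: distrib_left intro: mp.span_add)
  show "ideal_gen B \<subseteq> mp.span ?X"
  proof
    fix x assume "x \<in> ideal_gen B"
    then show "x \<in> mp.span ?X"
    proof (induction rule: ideal_gen_induct)
      case (step a b y)
      have "b * a + y \<in> mp.span ?X" by (rule mp.span_add[OF 1[OF step(1)] step(2)])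
      then show ?case by (simp only: mult.commute[of a b])
    qed (rule mp.span_zero)
  qed
  show "mp.span ?X \<subseteq> ideal_gen B"
  proof (rule mp.span_minimal[OF _ subspace_ideal_gen])
    show "?X \<subseteq> ideal_gen B"
      using ideal_gen_mult[OF ideal_gen_base] by (force simp: mult.commute[of _ "mon _"])
  qed
qed

text \<open>
  Over the field, the ideal is spanned by the products of the generators with monomials. These are
  homogeneous, so taking a homogeneous component selects some of them.
\<close>

lemma hcomp_ideal_gen:
  fixes x :: "('n::finite, 'k::field) mpol"
  assumes "\<And>b. b \<in> B \<Longrightarrow> homogeneous d b" "x \<in> ideal_gen B"
  shows "hcomp (d + t) x \<in> mp.span {b * mon m | b m. b \<in> B \<and> mdeg m = t}"
    "s < d \<Longrightarrow> hcomp s x = 0"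
proof -
  let ?X = "{b * mon m | b m. b \<in> B} :: ('n, 'k) mpol set"
  let ?Y = "{b * mon m | b m. b \<in> B \<and> mdeg m = t} :: ('n, 'k) mpol set"
  have x: "x \<in> mp.span ?X" using assms(2) by (simp add: ideal_gen_eq_span)
  have "hcomp (d + t) (b * mon m) \<in> mp.span ?Y" if "b \<in> B" for b m
    using that
    by (auto simp: hcomp_mult(1)[OF assms(1)] intro: mp.span_base mp.span_zero)
  then have "hcomp (d + t) ` ?X \<subseteq> mp.span ?Y" by auto
  then have "mp.span (hcomp (d + t) ` ?X) \<subseteq> mp.span ?Y" by (rule mp.span_minimal) simp
  then show "hcomp (d + t) x \<in> mp.span ?Y" using hcomp_span[OF x, of "d + t"] by auto
  assume "s < d"
  then have "hcomp s ` ?X \<subseteq> {0}" using hcomp_mult(2)[OF assms(1)] by auto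
  then have "mp.span (hcomp s ` ?X) \<subseteq> {0}" by (rule mp.span_minimal) (simp add: mp.subspace_def)
  then show "hcomp s x = 0" using hcomp_span[OF x, of s] by auto
qed

lemma hcomp_ideal_gen_mem:
  fixes x :: "('n::finite, 'k::field) mpol"
  assumes "\<And>b. b \<in> B \<Longrightarrow> homogeneous d b" "x \<in> ideal_gen B"
  shows "hcomp t x \<in> ideal_gen B"
proof (cases "t < d")
  case True
  then show ?thesis using hcomp_ideal_gen(2)[OF assms] by simp
next
  case False
  then obtain s where t: "t = d + s" by (metis le_add_diff_inverse not_less)
  have "mp.span {b * mon m | b m. b \<in> B \<and> mdeg m = s} \<subseteq> ideal_gen B"
    unfolding ideal_gen_eq_span by (rule mp.span_mono) auto
  then show ?thesis using hcomp_ideal_gen(1)[OF assms, of s] t by auto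
qed

section \<open>Hilbert functions and regular elements\<close>

text \<open>
  The ideal contains no nonzero form of degree less than \<open>d\<close>.
\<close>

lemma rank_mod_below_generators:
  fixes B :: "('n::finite, 'k::field) mpol set"
  assumes "\<And>b. b \<in> B \<Longrightarrow> homogeneous d b" "s < d" "mp.rank_mod {} (homs s :: ('n, 'k) mpol set) n"
  shows "mp.rank_mod (ideal_gen B) (homs s) n"
proof -
  obtain C :: "('n, 'k) mpol set" where
    C: "finite C" "card C = n" "C \<subseteq> homs s" "mp.indep_mod {} C" "homs s \<subseteq> mp.span ({} \<union> C)"
    using assms(3) by (rule mp.rank_modE)
  have "mp.indep_mod (ideal_gen B) C"
    unfolding mp.indep_mod_def
  proof (intro ballI notI)
    fix c assume c: "c \<in> C" "c \<in> mp.span (ideal_gen B \<union> (C - {c}))"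
    then obtain i x where ix: "c = i + x" "i \<in> ideal_gen B" "x \<in> mp.span (C - {c})"
      by (auto simp: mp.span_Un)
    have "mp.span (C - {c}) \<subseteq> homs s" using C by (intro mp.span_minimal subspace_homs) auto
    then have "x \<in> homs s" using ix by auto
    moreover have "c \<in> homs s" using c C by auto
    ultimately have "hcomp s c = c" "hcomp s x = x" by (simp_all add: hcomp_homogeneous)
    then have "c = hcomp s i + x" using hcomp_add[of s i x, folded ix(1)] by simp
    then have "c = x" using hcomp_ideal_gen(2)[OF assms(1) ix(2) assms(2)] by simp
    then show False using C c ix by (auto simp: mp.indep_mod_def)
  qed
  moreover have "mp.span ({} \<union> C) \<subseteq> mp.span (ideal_gen B \<union> C)" by (rule mp.span_mono) auto
  ultimately show ?thesis using C by (intro mp.rank_modI[of C]) auto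
qed

text \<open>
  Exactness of \<open>0 \<rightarrow> (S/I)\<^sub>s \<rightarrow> (S/I)\<^bsub>d+s\<^esub> \<rightarrow> (S/(I,f))\<^bsub>d+s\<^esub> \<rightarrow> 0\<close>, where the first map is multiplication
  by \<open>f\<close>: it carries a basis of \<open>(S/I)\<^sub>s\<close> to an independent set, and the elements that extend this set
  to a basis of \<open>(S/I)\<^bsub>d+s\<^esub>\<close> form a basis of the cokernel.
\<close>

lemma rank_mod_regular_step:
  fixes B :: "('n::finite, 'k::field) mpol set"
  assumes hB: "\<And>b. b \<in> B \<Longrightarrow> homogeneous d b" and hf: "homogeneous d f"
    and reg: "\<And>h. f * h \<in> ideal_gen B \<Longrightarrow> h \<in> ideal_gen B"
    and n: "mp.rank_mod (ideal_gen B) (homs (d + s)) n"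
    and m: "mp.rank_mod (ideal_gen B) (homs s) m"
  shows "mp.rank_mod (ideal_gen (insert f B)) (homs (d + s)) (n - m)"
proof -
  let ?I = "ideal_gen B" and ?I' = "ideal_gen (insert f B)"
  obtain C where C: "finite C" "card C = m" "C \<subseteq> homs s" "mp.indep_mod ?I C" "homs s \<subseteq> mp.span (?I \<union> C)"
    using m by (rule mp.rank_modE)
  obtain E where E: "finite E" "card E = n" "E \<subseteq> homs (d + s)" "mp.indep_mod ?I E"
      "homs (d + s) \<subseteq> mp.span (?I \<union> E)"
    using n by (rule mp.rank_modE)
  have fam: "a i = 0" if "(\<Sum>c\<in>C. Const (a c) * (f * c)) \<in> mp.span ?I" "i \<in> C" for a i
  proof -
    have "(\<Sum>c\<in>C. Const (a c) * (f * c)) = f * (\<Sum>c\<in>C. Const (a c) * c)"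
      by (simp add: sum_distrib_left mult_ac)
    then have "(\<Sum>c\<in>C. Const (a c) * c) \<in> mp.span ?I" using that(1) reg by simp
    then show ?thesis by (rule mp.indep_mod_sum_zero[OF C(4,1) _ that(2)])
  qed
  have inj: "inj_on ((*) f) C" and ind: "mp.indep_mod ?I ((*) f ` C)"
    by (rule mp.indep_mod_family[OF C(1), of "(*) f" ?I], erule (1) fam)+
  have fC: "(*) f ` C \<subseteq> homs (d + s)" using C(3) hf by (auto intro: homogeneous_mult)
  obtain C' where C': "(*) f ` C \<subseteq> C'" "C' \<subseteq> homs (d + s)" "mp.indep_mod ?I C'"
      "homs (d + s) \<subseteq> mp.span (?I \<union> C')"
    by (rule mp.indep_mod_extend[OF fC ind E(5,1)])
  have "finite C' \<and> card C' \<le> card E"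
    using C' E by (intro mp.indep_mod_card_le[of E C' ?I]) auto
  moreover from this have "card E \<le> card C'"
    using mp.indep_mod_card_le[of C' E ?I] C' E by auto
  ultimately have finC': "finite C'" and cardC': "card C' = n" using E by auto
  define D where "D = C' - (*) f ` C"
  have cardD: "card D = n - m"
    unfolding D_def using C'(1) finC' cardC' C(1,2) inj by (simp add: card_Diff_subset card_image)
  have fs: "f * h \<in> mp.span (?I \<union> (*) f ` C)" if "homogeneous s h" for h
  proof -
    have "h \<in> mp.span (?I \<union> C)" using that C(5) by blast
    then obtain i x where ix: "h = i + x" "i \<in> ?I" "x \<in> mp.span C"
      by (auto simp: mp.span_Un)
    obtain b where "x = (\<Sum>c\<in>C. Const (b c) * c)"
      using mp.span_imageE[of x id C] ix(3) C(1) by auto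
    then have "f * x = (\<Sum>c\<in>C. Const (b c) * (f * c))"
      by (simp add: sum_distrib_left mult_ac)
    moreover have "(\<Sum>c\<in>C. Const (b c) * (f * c)) \<in> mp.span ((*) f ` C)"
      by (rule mp.span_sum, rule mp.span_scale, rule mp.span_base) simp
    ultimately have "f * x \<in> mp.span ((*) f ` C)" by simp
    then show ?thesis
      using ix ideal_gen_mult[of i B f] by (auto simp: mp.span_Un distrib_left)
  qed
  have "mp.indep_mod ?I' D"
    unfolding mp.indep_mod_def
  proof (intro ballI notI)
    fix c assume c: "c \<in> D" "c \<in> mp.span (?I' \<union> (D - {c}))"
    then obtain i x where ix: "c = i + x" "i \<in> ?I'" "x \<in> mp.span (D - {c})"
      by (auto simp: mp.span_Un)
    obtain a where a: "i - a * f \<in> ?I" using ix by (auto simp: ideal_gen_insert)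
    have "mp.span (D - {c}) \<subseteq> homs (d + s)"
      using C' by (intro mp.span_minimal subspace_homs) (auto simp: D_def)
    then have x: "homogeneous (d + s) x" using ix by auto
    have "homogeneous (d + s) c" using c C' by (auto simp: D_def)
    then have "c = hcomp (d + s) (i - a * f + f * a + x)"
      using hcomp_homogeneous[of "d + s" c "d + s"] ix(1) by (simp add: mult.commute)
    also have "\<dots> = hcomp (d + s) (i - a * f) + f * hcomp s a + x"
      by (simp only: hcomp_add hcomp_mult(1)[OF hf] hcomp_homogeneous[OF x] if_True simp_thms)
    finally have ceq: "c = hcomp (d + s) (i - a * f) + f * hcomp s a + x" .
    let ?W = "mp.span (?I \<union> (C' - {c}))"
    have "hcomp (d + s) (i - a * f) \<in> ?W"
      using hcomp_ideal_gen_mem[OF hB a] by (intro mp.span_base) auto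
    moreover have "mp.span (?I \<union> (*) f ` C) \<subseteq> ?W"
      using C' c by (intro mp.span_mono) (auto simp: D_def)
    then have "f * hcomp s a \<in> ?W" using fs[OF homogeneous_hcomp] by blast
    moreover have "mp.span (D - {c}) \<subseteq> ?W" by (intro mp.span_mono) (auto simp: D_def)
    then have "x \<in> ?W" using ix by auto
    ultimately have "c \<in> ?W" by (subst ceq) (intro mp.span_add)
    then show False using C'(3) c by (auto simp: mp.indep_mod_def D_def)
  qed
  moreover have "homs (d + s) \<subseteq> mp.span (?I' \<union> D)"
  proof -
    have "?I \<union> C' \<subseteq> ?I' \<union> D"
      using ideal_gen_minimal[of B "insert f B"] ideal_gen_base[of _ "insert f B"]
        ideal_gen_mult[of f "insert f B"]
      by (auto simp: D_def mult.commute)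
    then show ?thesis by (rule order_trans[OF C'(4) mp.span_mono])
  qed
  moreover have "finite D" "D \<subseteq> homs (d + s)" using finC' C' by (auto simp: D_def)
  ultimately show ?thesis using cardD by (intro mp.rank_modI[of D]) auto
qed

section \<open>Substitutions\<close>

text \<open>
  The two instances are the identity of \<open>K\<close> (evaluation at a point) and the embedding \<open>Const\<close> of \<open>K\<close>
  into the polynomial ring (substitution).
\<close>

definition coeff_hom :: "('k::comm_ring_1 \<Rightarrow> 'r::comm_ring_1) \<Rightarrow> bool" where
  "coeff_hom h \<longleftrightarrow> h 0 = 0 \<and> h 1 = 1 \<and> (\<forall>a b. h (a + b) = h a + h b \<and> h (a * b) = h a * h b)"

lemma coeff_hom_id: "coeff_hom (\<lambda>a. a)"
  and coeff_hom_Const: "coeff_hom (Const :: 'k \<Rightarrow> ('n, 'k::comm_ring_1) mpol)"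
  by (simp_all add: coeff_hom_def Const_add Const_mult)

definition monom_value :: "('i \<Rightarrow> 'r::comm_ring_1) \<Rightarrow> 'i monom \<Rightarrow> 'r" where
  "monom_value a m = (\<Prod>i\<in>keys m. a i ^ lookup m i)"

lemma monom_value_superset:
  "finite V \<Longrightarrow> keys m \<subseteq> V \<Longrightarrow> monom_value a m = (\<Prod>i\<in>V. a i ^ lookup m i)"
  unfolding monom_value_def by (rule prod.mono_neutral_left) (auto simp: in_keys_iff)

lemma monom_value_add: "monom_value a (m + n) = monom_value a m * monom_value a n"
proof -
  let ?V = "keys m \<union> keys n"
  have "keys (m + n) \<subseteq> ?V" by (rule keys_add)
  then show ?thesis
    by (simp add: monom_value_superset[of ?V] lookup_add power_add prod.distrib)
qed

lemma eval_with_superset: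
  assumes "coeff_hom h" "finite M" "keys p \<subseteq> M"
  shows "eval_with h a p = (\<Sum>m\<in>M. h (lookup p m) * monom_value a m)"
  unfolding eval_with_def monom_value_def
  by (rule sum.mono_neutral_left) (use assms in \<open>auto simp: in_keys_iff coeff_hom_def\<close>)

lemma eval_with_single:
  "coeff_hom h \<Longrightarrow> eval_with h a (single m c) = h c * monom_value a m"
  by (subst eval_with_superset[of _ "{m}"]) auto

lemma eval_with_add:
  assumes "coeff_hom h"
  shows "eval_with h a (p + q) = eval_with h a p + eval_with h a q"
proof -
  let ?M = "keys p \<union> keys q"
  have "keys (p + q) \<subseteq> ?M" by (rule keys_add)
  then show ?thesis
    using assms
    by (simp add: eval_with_superset[of h ?M] lookup_add coeff_hom_def distrib_right sum.distrib)
qed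

lemma eval_with_mult:
  assumes "coeff_hom h"
  shows "eval_with h a (p * q) = eval_with h a p * eval_with h a q"
proof (induction p rule: mpol_linear_induct)
  case (Const_mon c m)
  show ?case
  proof (induction q rule: mpol_linear_induct)
    case (Const_mon d n)
    then show ?case
      using assms unfolding Const_mult_mon mult_single eval_with_single[OF assms] monom_value_add
      by (simp only: coeff_hom_def mult_ac)
  qed (simp only: distrib_left eval_with_add[OF assms])
qed (simp only: distrib_right eval_with_add[OF assms])

lemma eval_with_Const: "coeff_hom h \<Longrightarrow> eval_with h a (Const c) = h c"
  by (simp add: Const_def eval_with_single monom_value_def)

lemma eval_with_Var: "coeff_hom h \<Longrightarrow> eval_with h a (Var i) = a i"
  by (simp add: Var_def eval_with_single monom_value_def) (simp add: coeff_hom_def)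

lemma Var_power: "Var i ^ n = (mon (single i n) :: ('n, 'k::comm_ring_1) mpol)"
  by (induction n) (simp_all add: Var_def mult_single single_add[symmetric])

lemma mpol_ring_induct [case_names Const Var add mult]:
  assumes "\<And>c. P (Const c)" "\<And>i. P (Var i)" "\<And>p q. P p \<Longrightarrow> P q \<Longrightarrow> P (p + q)"
    "\<And>p q. P p \<Longrightarrow> P q \<Longrightarrow> P (p * q)"
  shows "P (p :: ('n::finite, 'k::comm_ring_1) mpol)"
proof -
  have "P (mon m)" if "mdeg m = n" for m n
    using that
  proof (induction n arbitrary: m)
    case 0
    then show ?case using assms(1)[of 1] by (simp add: mdeg_eq_0_iff)
  next
    case (Suc n)
    then obtain i m' where m: "m = single i 1 + m'" "mdeg m' = n" by (blast elim: mdeg_SucE)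
    have "P (Var i * mon m')" by (rule assms(4)[OF assms(2) Suc.IH[OF m(2)]])
    then show ?case unfolding m(1) mon_add Var_def .
  qed
  then show ?thesis by (induction p rule: mpol_linear_induct) (auto intro: assms)
qed

lemma change_coords_add: "change_coords g (p + q) = change_coords g p + change_coords g q"
  by (simp add: change_coords_def eval_with_add coeff_hom_Const)

lemma change_coords_mult: "change_coords g (p * q) = change_coords g p * change_coords g q"
  by (simp add: change_coords_def eval_with_mult coeff_hom_Const)

lemma change_coords_Const [simp]: "change_coords g (Const c) = Const c"
  by (simp add: change_coords_def eval_with_Const coeff_hom_Const)

lemma change_coords_Var: "change_coords g (Var i) = (\<Sum>j\<in>UNIV. Const (g $ i $ j) * Var j)"
  by (simp add: change_coords_def eval_with_Var coeff_hom_Const)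

lemma change_coords_zero [simp]: "change_coords g 0 = 0"
  and change_coords_one [simp]: "change_coords g 1 = 1"
  using change_coords_Const[of g 0] change_coords_Const[of g 1] by simp_all

lemma change_coords_power: "change_coords g (p ^ n) = change_coords g p ^ n"
  by (induction n) (simp_all add: change_coords_mult)

lemma change_coords_sum: "change_coords g (\<Sum>i\<in>A. f i) = (\<Sum>i\<in>A. change_coords g (f i))"
  by (induction A rule: infinite_finite_induct) (simp_all add: change_coords_add)

lemma Const_sum: "Const (\<Sum>j\<in>A. f j) = (\<Sum>j\<in>A. Const (f j) :: ('n, 'k::comm_ring_1) mpol)"
  by (induction A rule: infinite_finite_induct) (simp_all add: Const_add)

text \<open>
  The matrix of the inner substitution comes first: \<open>x\<^sub>i\<close> goes to \<open>\<Sum>\<^sub>j h\<^sub>i\<^sub>j x\<^sub>j\<close> and then to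
  \<open>\<Sum>\<^sub>j \<Sum>\<^sub>k h\<^sub>i\<^sub>j g\<^sub>j\<^sub>k x\<^sub>k\<close>.
\<close>

lemma change_coords_compose: "change_coords g (change_coords h p) = change_coords (h ** g) p"
proof (induction p rule: mpol_ring_induct)
  case (Var i)
  have "change_coords g (change_coords h (Var i))
      = (\<Sum>j\<in>UNIV. \<Sum>k\<in>UNIV. Const (h $ i $ j * g $ j $ k) * Var k)"
    by (simp add: change_coords_Var change_coords_sum change_coords_mult sum_distrib_left Const_mult mult.assoc)
  also have "\<dots> = (\<Sum>k\<in>UNIV. \<Sum>j\<in>UNIV. Const (h $ i $ j * g $ j $ k) * Var k)"
    by (rule sum.swap)
  also have "\<dots> = change_coords (h ** g) (Var i)"
    by (simp add: change_coords_Var matrix_matrix_mult_def sum_distrib_right Const_sum)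
  finally show ?case .
qed (simp_all add: change_coords_add change_coords_mult)

lemma change_coords_id [simp]: "change_coords (mat 1) p = p"
  for p :: "('n::finite, 'k::field) mpol"
proof (induction p rule: mpol_ring_induct)
  case (Var i)
  have "(\<Sum>j\<in>UNIV. Const ((mat 1 :: 'k ^ 'n ^ 'n) $ i $ j) * Var j)
      = (\<Sum>j\<in>UNIV. if j = i then Var j else 0 :: ('n, 'k) mpol)"
    by (intro sum.cong) (auto simp: mat_def)
  then show ?case by (simp add: change_coords_Var)
qed (simp_all add: change_coords_add change_coords_mult)

lemma homogeneous_Var: "homogeneous 1 (Var i :: ('n, 'k::comm_ring_1) mpol)"
  by (simp add: Var_def)

lemma change_coords_span:
  assumes "x \<in> mp.span X"
  shows "change_coords g x \<in> mp.span (change_coords g ` X)"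
proof -
  have "x \<in> {x. change_coords g x \<in> mp.span (change_coords g ` X)}"
    by (rule mp.span_induct_alt[OF assms])
      (auto simp: change_coords_add change_coords_mult intro: mp.span_add mp.span_scale mp.span_base mp.span_zero)
  then show ?thesis by simp
qed

lemma homogeneous_change_coords:
  assumes "homogeneous t p"
  shows "homogeneous t (change_coords g p)"
proof -
  have "homogeneous n (change_coords g (mon m))" if "mdeg m = n" for m n
    using that
  proof (induction n arbitrary: m)
    case 0
    then show ?case using homogeneous_one by (simp add: mdeg_eq_0_iff)
  next
    case (Suc n)
    then obtain i m' where m: "m = single i 1 + m'" "mdeg m' = n" by (blast elim: mdeg_SucE)
    have "homogeneous 1 (change_coords g (Var i))"
      unfolding change_coords_Var by (intro homogeneous_sum homogeneous_Const_mult homogeneous_Var)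
    from homogeneous_mult[OF this Suc.IH[OF m(2)]]
    show ?case unfolding m(1) mon_add by (simp add: change_coords_mult Var_def)
  qed
  then have "mp.span (change_coords g ` mon ` {m. mdeg m = t}) \<subseteq> homs t"
    by (intro mp.span_minimal subspace_homs) auto
  then show ?thesis using change_coords_span[of p "mon ` {m. mdeg m = t}" g] assms homs_eq_span[of t] by auto
qed

lemma change_coords_inverse:
  assumes "g ** h = mat 1"
  shows "change_coords h (change_coords g p) = p"
  by (simp add: change_coords_compose assms)

lemma change_coords_ideal_gen_subset: "change_coords g ` ideal_gen B \<subseteq> ideal_gen (change_coords g ` B)"
proof
  fix y assume "y \<in> change_coords g ` ideal_gen B"
  then obtain x where x: "x \<in> ideal_gen B" "y = change_coords g x" by blast
  from x(1) have "change_coords g x \<in> ideal_gen (change_coords g ` B)"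
  proof (induction rule: ideal_gen_induct)
    case (step a b y)
    then have "change_coords g b \<in> ideal_gen (change_coords g ` B)"
      by (intro ideal_gen_base) auto
    with step show ?case
      unfolding change_coords_add change_coords_mult by (intro ideal_gen_add ideal_gen_mult)
  qed simp
  then show "y \<in> ideal_gen (change_coords g ` B)" using x by simp
qed

lemma change_coords_ideal_gen:
  assumes "invertible g"
  shows "change_coords g ` ideal_gen B = ideal_gen (change_coords g ` B)"
proof
  obtain h where h: "g ** h = mat 1" "h ** g = mat 1" using assms by (auto simp: invertible_def)
  show "ideal_gen (change_coords g ` B) \<subseteq> change_coords g ` ideal_gen B"
  proof
    fix y assume "y \<in> ideal_gen (change_coords g ` B)"
    then have "change_coords h y \<in> ideal_gen (change_coords h ` (change_coords g ` B))"
      using change_coords_ideal_gen_subset by blast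
    also have "change_coords h ` (change_coords g ` B) = B"
      by (simp add: image_image change_coords_inverse[OF h(1)])
    finally show "y \<in> change_coords g ` ideal_gen B"
      using change_coords_inverse[OF h(2), of y] by (metis image_eqI)
  qed
qed (rule change_coords_ideal_gen_subset)

section \<open>Zariski openness of spanning\<close>

text \<open>
  The functions whose nonvanishing loci are the basic Zariski open sets for the coordinates \<open>c\<close>.
\<close>

definition poly_fun :: "('w \<Rightarrow> 'i \<Rightarrow> 'k::comm_ring_1) \<Rightarrow> ('w \<Rightarrow> 'k) \<Rightarrow> bool" where
  "poly_fun c F \<longleftrightarrow> (\<exists>p :: ('i, 'k) mpol. \<forall>w. F w = eval_with (\<lambda>a. a) (c w) p)"

lemma poly_fun_const: "poly_fun c (\<lambda>_. a)"
  unfolding poly_fun_def by (rule exI[of _ "Const a"]) (simp add: eval_with_Const coeff_hom_id)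

lemma poly_fun_coord: "poly_fun c (\<lambda>w. c w i)"
  unfolding poly_fun_def by (rule exI[of _ "Var i"]) (simp add: eval_with_Var coeff_hom_id)

lemma poly_fun_add: "poly_fun c F \<Longrightarrow> poly_fun c G \<Longrightarrow> poly_fun c (\<lambda>w. F w + G w)"
  unfolding poly_fun_def by (metis eval_with_add coeff_hom_id)

lemma poly_fun_mult: "poly_fun c F \<Longrightarrow> poly_fun c G \<Longrightarrow> poly_fun c (\<lambda>w. F w * G w)"
  unfolding poly_fun_def by (metis eval_with_mult coeff_hom_id)

lemma poly_fun_diff: "poly_fun c F \<Longrightarrow> poly_fun c G \<Longrightarrow> poly_fun c (\<lambda>w. F w - G w)"
  using poly_fun_add[OF _ poly_fun_mult[OF poly_fun_const[of c "- 1"]], of F G] by simp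

lemma poly_fun_sum: "(\<And>i. i \<in> A \<Longrightarrow> poly_fun c (F i)) \<Longrightarrow> poly_fun c (\<lambda>w. \<Sum>i\<in>A. F i w)"
  by (induction A rule: infinite_finite_induct) (auto intro: poly_fun_const poly_fun_add)

definition poly_family :: "('w \<Rightarrow> 'i \<Rightarrow> 'k::comm_ring_1) \<Rightarrow> ('w \<Rightarrow> ('n, 'k) mpol) \<Rightarrow> bool" where
  "poly_family c P \<longleftrightarrow> (\<forall>m. poly_fun c (\<lambda>w. lookup (P w) m))"

lemma poly_family_const: "poly_family c (\<lambda>_. p)"
  by (simp add: poly_family_def poly_fun_const)

lemma poly_family_add: "poly_family c P \<Longrightarrow> poly_family c Q \<Longrightarrow> poly_family c (\<lambda>w. P w + Q w)"
  by (simp add: poly_family_def lookup_add poly_fun_add)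

lemma poly_family_diff: "poly_family c P \<Longrightarrow> poly_family c Q \<Longrightarrow> poly_family c (\<lambda>w. P w - Q w)"
  by (simp add: poly_family_def lookup_minus poly_fun_diff)

lemma poly_family_Const_mult:
  "poly_fun c F \<Longrightarrow> poly_family c P \<Longrightarrow> poly_family c (\<lambda>w. Const (F w) * P w)"
  by (simp add: poly_family_def poly_fun_mult)

lemma lookup_mult_finite:
  fixes p q :: "('n::finite, 'k::comm_ring_1) mpol"
  shows "lookup (p * q) m
    = (\<Sum>(a, b)\<in>{(a, b). a + b = m}. lookup p a * lookup q b)"
proof -
  have "{(a, b). a + b = m} \<subseteq> (\<Union>s\<in>{..mdeg m}. {a. mdeg a = s}) \<times> (\<Union>s\<in>{..mdeg m}. {a. mdeg a = s})"
    by (auto simp: mdeg_add)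
  then have fin: "finite {(a, b). a + b = m}"
    by (rule finite_subset) (auto intro!: finite_mdeg)
  have "lookup (p * q) m
      = (\<Sum>(a, b). lookup p a * lookup q b when m = a + b)"
    by (simp add: times_poly_mapping.rep_eq prod_fun_unfold_prod)
  also have "\<dots> = (\<Sum>(a, b)\<in>{(a, b). a + b = m}.
      lookup p a * lookup q b when m = a + b)"
    by (rule Sum_any.expand_superset[OF fin]) (auto simp: when_def split: if_splits)
  also have "\<dots> = (\<Sum>(a, b)\<in>{(a, b). a + b = m}. lookup p a * lookup q b)"
    by (rule sum.cong) (auto simp: when_def)
  finally show ?thesis .
qed

lemma poly_family_mult:
  fixes P Q :: "'w \<Rightarrow> ('n::finite, 'k::comm_ring_1) mpol"
  shows "poly_family c P \<Longrightarrow> poly_family c Q \<Longrightarrow> poly_family c (\<lambda>w. P w * Q w)"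
  by (simp add: poly_family_def lookup_mult_finite case_prod_beta poly_fun_sum poly_fun_mult)

lemma poly_family_sum:
  "(\<And>i. i \<in> A \<Longrightarrow> poly_family c (P i)) \<Longrightarrow> poly_family c (\<lambda>w. \<Sum>i\<in>A. P i w)"
  by (simp add: poly_family_def lookup_sum poly_fun_sum)

lemma poly_family_change_coords_matrix: "poly_family matrix_coords (\<lambda>g. change_coords g p)"
proof (induction p rule: mpol_ring_induct)
  case (Var i)
  have "poly_fun matrix_coords (\<lambda>g. g $ i $ j)" for j
    using poly_fun_coord[of matrix_coords "(i, j)"] by (simp add: matrix_coords_def)
  then show ?case
    unfolding change_coords_Var by (intro poly_family_sum poly_family_Const_mult poly_family_const)
qed (simp_all add: poly_family_const change_coords_add change_coords_mult poly_family_add poly_family_mult)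

text \<open>
  Gaussian elimination without division. A coefficient of \<open>v l\<close> that is nonzero at \<open>w0\<close> serves as the
  pivot \<open>A\<close>; the other vectors are multiplied by \<open>A\<close> and freed of that coefficient, which
  changes neither the polynomial dependence on \<open>w\<close> nor, where \<open>A\<close> does not vanish, the independence.
  The product of all pivots is the required \<open>F\<close>.
\<close>

lemma independence_open:
  fixes v :: "'j \<Rightarrow> 'w \<Rightarrow> ('n, 'k::field) mpol"
  assumes "finite K" "\<And>k. k \<in> K \<Longrightarrow> poly_family c (v k)"
    "\<And>a k. (\<Sum>k\<in>K. Const (a k) * v k w0) = 0 \<Longrightarrow> k \<in> K \<Longrightarrow> a k = 0"
  shows "\<exists>F. poly_fun c F \<and> F w0 \<noteq> 0 \<and>
    (\<forall>w a k. F w \<noteq> 0 \<longrightarrow> (\<Sum>k\<in>K. Const (a k) * v k w) = 0 \<longrightarrow> k \<in> K \<longrightarrow> a k = 0)"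
  using assms
proof (induction K arbitrary: v rule: finite_induct)
  case empty
  show ?case by (rule exI[of _ "\<lambda>_. 1"]) (simp add: poly_fun_const)
next
  case (insert l K)
  have "v l w0 \<noteq> 0"
  proof
    assume 0: "v l w0 = 0"
    have "(\<Sum>k\<in>insert l K. Const (if k = l then 1 else 0) * v k w0) = 0"
      using insert.hyps 0 by (simp add: if_distrib cong: if_cong) (intro sum.neutral, auto)
    from insert.prems(2)[OF this, of l] show False by simp
  qed
  then obtain m where m: "lookup (v l w0) m \<noteq> 0"
    by (metis lookup_zero poly_mapping_eqI)
  define A where "A w = lookup (v l w) m" for w
  define u where "u k w = Const (A w) * v k w - Const (lookup (v k w) m) * v l w" for k w
  have pu: "poly_family c (u k)" if "k \<in> K" for k
  proof -
    have "poly_family c (v k)" "poly_family c (v l)" using insert.prems(1) that by auto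
    then show ?thesis
      unfolding u_def A_def
      by (intro poly_family_diff poly_family_Const_mult) (simp_all add: poly_family_def)
  qed
  have sum_u: "(\<Sum>k\<in>K. Const (a k) * u k w)
      = Const (A w) * (\<Sum>k\<in>K. Const (a k) * v k w)
        - Const (\<Sum>k\<in>K. a k * lookup (v k w) m) * v l w" for a w
    by (simp add: u_def right_diff_distrib sum_subtractf sum_distrib_left sum_distrib_right
        Const_sum Const_mult mult_ac)
  have iu: "a k = 0" if 0: "(\<Sum>k\<in>K. Const (a k) * u k w0) = 0" and k: "k \<in> K" for a k
  proof -
    define b where "b j = (if j = l then - (\<Sum>k\<in>K. a k * lookup (v k w0) m) else A w0 * a j)" for j
    have "(\<Sum>j\<in>K. Const (b j) * v j w0) = Const (A w0) * (\<Sum>k\<in>K. Const (a k) * v k w0)"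
      unfolding sum_distrib_left b_def
      by (rule sum.cong) (use insert.hyps in \<open>auto simp: Const_mult mult_ac\<close>)
    then have "(\<Sum>j\<in>insert l K. Const (b j) * v j w0) = 0"
      using insert.hyps 0 unfolding sum_u by (simp add: b_def Const_minus)
    from insert.prems(2)[OF this, of k] have "b k = 0" using k by simp
    then show ?thesis using k insert.hyps m by (auto simp: b_def A_def split: if_splits)
  qed
  have "\<exists>F. poly_fun c F \<and> F w0 \<noteq> 0 \<and>
    (\<forall>w a k. F w \<noteq> 0 \<longrightarrow> (\<Sum>k\<in>K. Const (a k) * u k w) = 0 \<longrightarrow> k \<in> K \<longrightarrow> a k = 0)"
    by (rule insert.IH) (erule pu, erule (1) iu)
  then obtain F where F: "poly_fun c F" "F w0 \<noteq> 0"
    "\<And>w a k. F w \<noteq> 0 \<Longrightarrow> (\<Sum>k\<in>K. Const (a k) * u k w) = 0 \<Longrightarrow> k \<in> K \<Longrightarrow> a k = 0"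
    by (elim exE conjE) blast
  show ?case
  proof (intro exI[of _ "\<lambda>w. A w * F w"] conjI allI impI)
    have "poly_family c (v l)" using insert.prems(1) by simp
    then have "poly_fun c A" unfolding A_def poly_family_def by blast
    then show "poly_fun c (\<lambda>w. A w * F w)" using F(1) by (rule poly_fun_mult)
    show "A w0 * F w0 \<noteq> 0" using F(2) m by (simp add: A_def)
    fix w a k
    assume AF: "A w * F w \<noteq> 0" and 0: "(\<Sum>k\<in>insert l K. Const (a k) * v k w) = 0" and k: "k \<in> insert l K"
    have 1: "(\<Sum>k\<in>K. Const (a k) * v k w) = - (Const (a l) * v l w)"
      using 0 insert.hyps by (simp add: eq_neg_iff_add_eq_0 add.commute)
    then have "lookup (\<Sum>k\<in>K. Const (a k) * v k w) m = - (a l * A w)"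
      by (simp add: A_def)
    then have "(\<Sum>k\<in>K. a k * lookup (v k w) m) = - (a l * A w)"
      by (simp add: lookup_sum)
    then have "(\<Sum>k\<in>K. Const (a k) * u k w) = 0"
      unfolding sum_u 1 by (simp add: Const_minus Const_mult mult_ac)
    then have aK: "\<And>k. k \<in> K \<Longrightarrow> a k = 0" using F(3) AF by auto
    then have "Const (a l) * v l w = 0" using 1 by simp
    from arg_cong[OF this, of "\<lambda>p. lookup p m"]
    have "a l * A w = 0" by (simp add: A_def)
    then show "a k = 0" using AF aK k by auto
  qed
qed

text \<open>
  Some of the vectors form a basis of the forms of degree \<open>t\<close> at \<open>w0\<close>. They remain
  independent on a neighbourhood of \<open>w0\<close>, and being as many as there are monomials of degree \<open>t\<close>, they still span.
\<close>

lemma spanning_open: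
  fixes v :: "'j \<Rightarrow> 'w \<Rightarrow> ('n::finite, 'k::field) mpol"
  assumes K: "finite K" and pv: "\<And>k. k \<in> K \<Longrightarrow> poly_family c (v k)"
    and hv: "\<And>k w. k \<in> K \<Longrightarrow> w \<in> W \<Longrightarrow> homogeneous t (v k w)"
    and sp: "homs t \<subseteq> mp.span ((\<lambda>k. v k w0) ` K)"
  shows "\<exists>F. poly_fun c F \<and> F w0 \<noteq> 0 \<and>
    (\<forall>w\<in>W. F w \<noteq> 0 \<longrightarrow> homs t \<subseteq> mp.span ((\<lambda>k. v k w) ` K))"
proof -
  let ?V = "(\<lambda>k. v k w0) ` K"
  let ?M = "mon ` {m :: 'n monom. mdeg m = t} :: ('n, 'k) mpol set"
  have e: "mp.indep_mod {} {}" by (simp add: mp.indep_mod_def)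
  have "?V \<subseteq> mp.span ({} \<union> ?V)" using mp.span_superset by simp
  from mp.indep_mod_extend[OF empty_subsetI e this finite_imageI[OF K]]
  obtain B where B: "B \<subseteq> ?V" "mp.indep_mod {} B" "?V \<subseteq> mp.span ({} \<union> B)" .
  obtain K' where K': "K' \<subseteq> K" "inj_on (\<lambda>k. v k w0) K'" "B = (\<lambda>k. v k w0) ` K'"
    using B(1) by (auto simp: subset_image_inj)
  have finK': "finite K'" using K' K finite_subset by blast
  have ind0: "a k = 0" if 0: "(\<Sum>k\<in>K'. Const (a k) * v k w0) = 0" and k: "k \<in> K'" for a k
    using mp.indep_mod_family_sum_zero[OF K'(2) _ finK', where U = "{}"] B(2) K'(3) 0 k by simp
  have pvK: "\<And>k. k \<in> K' \<Longrightarrow> poly_family c (v k)" using pv K'(1) by blast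
  have "\<exists>F. poly_fun c F \<and> F w0 \<noteq> 0 \<and>
    (\<forall>w a k. F w \<noteq> 0 \<longrightarrow> (\<Sum>k\<in>K'. Const (a k) * v k w) = 0 \<longrightarrow> k \<in> K' \<longrightarrow> a k = 0)"
    by (rule independence_open[OF finK']) (erule pvK, erule (1) ind0)
  then obtain F where F: "poly_fun c F" "F w0 \<noteq> 0"
    "\<And>w a k. F w \<noteq> 0 \<Longrightarrow> (\<Sum>k\<in>K'. Const (a k) * v k w) = 0 \<Longrightarrow> k \<in> K' \<Longrightarrow> a k = 0"
    by (elim exE conjE) blast
  have finM: "finite ?M" using finite_mdeg by blast
  have "mp.span ?V \<subseteq> mp.span B" using B(3) by (intro mp.span_minimal) auto
  moreover have "?M \<subseteq> homs t" by auto
  ultimately have "?M \<subseteq> mp.span ({} \<union> B)" using sp by simp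
  then have "card ?M \<le> card B"
    using mp.indep_mod_card_le[of B ?M "{}"] finK' K'(3) indep_mon[OF finite_mdeg] by blast
  then have cM: "card ?M \<le> card K'" using K' by (simp add: card_image)
  show ?thesis
  proof (intro exI[of _ F] conjI ballI impI F(1,2))
    fix w assume w: "w \<in> W" "F w \<noteq> 0"
    have inj: "inj_on (\<lambda>k. v k w) K'" and ind: "mp.indep_mod {} ((\<lambda>k. v k w) ` K')"
    proof -
      have "a k = 0" if "(\<Sum>k\<in>K'. Const (a k) * v k w) \<in> mp.span {}" "k \<in> K'" for a k
        using F(3)[OF w(2)] that by simp
      then show "inj_on (\<lambda>k. v k w) K'" "mp.indep_mod {} ((\<lambda>k. v k w) ` K')"
        using mp.indep_mod_family[OF finK', where U = "{}" and v = "\<lambda>k. v k w"] by blast+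
    qed
    have "homs t \<subseteq> mp.span ({} \<union> (\<lambda>k. v k w) ` K')"
    proof (rule mp.indep_mod_spans[OF _ ind _ finM])
      show "(\<lambda>k. v k w) ` K' \<subseteq> homs t" using hv w K' by auto
      show "homs t \<subseteq> mp.span ({} \<union> ?M)" using homs_eq_span by auto
      show "card ?M \<le> card ((\<lambda>k. v k w) ` K')" using cM inj by (simp add: card_image)
    qed
    also have "\<dots> \<subseteq> mp.span ((\<lambda>k. v k w) ` K)" using K' by (intro mp.span_mono) auto
    finally show "homs t \<subseteq> mp.span ((\<lambda>k. v k w) ` K)" .
  qed
qed

section \<open>Irreducibility of the general linear group\<close>

lemma poly_fun_on_curve:
  fixes F :: "'w \<Rightarrow> 'k::comm_ring_1"
  assumes "poly_fun c F" "\<And>i. \<exists>q. \<forall>s. c (\<gamma> s) i = poly q s"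
  shows "\<exists>q. \<forall>s. F (\<gamma> s) = poly q s"
proof -
  obtain p where p: "\<And>w. F w = eval_with (\<lambda>a. a) (c w) p" using assms(1) by (auto simp: poly_fun_def)
  obtain q where q: "\<And>i s. c (\<gamma> s) i = poly (q i) s" using assms(2) by metis
  have "F (\<gamma> s) = poly (\<Sum>m\<in>keys p. [:lookup p m:] *
      (\<Prod>i\<in>keys m. q i ^ lookup m i)) s" for s
    by (simp add: p eval_with_def q poly_sum poly_prod)
  then show ?thesis by blast
qed

lemma nonzero_poly_product_nonroot:
  fixes p q r :: "'k::field_char_0 poly"
  assumes "p \<noteq> 0" "q \<noteq> 0" "r \<noteq> 0"
  obtains s where "poly p s \<noteq> 0" "poly q s \<noteq> 0" "poly r s \<noteq> 0"
proof -
  have "finite {s. poly (p * q * r) s = 0}" using assms by (intro poly_roots_finite) auto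
  then obtain s where "poly (p * q * r) s \<noteq> 0"
    using infinite_UNIV_char_0[where 'a = 'k] by (metis (mono_tags, lifting) UNIV_eq_I mem_Collect_eq)
  then show thesis using that by auto
qed

text \<open>
  On the line through a point of \<open>U\<close> and a point of \<open>V\<close>, the determinant and the two functions that are
  nonzero at these points become nonzero polynomials in one variable. Over an infinite field there is a
  parameter at which none of the three vanishes.
\<close>

lemma GL_open_sets_meet:
  fixes U V :: "('k::field_char_0 ^ 'n ^ 'n) set"
  assumes "zariski_open_in matrix_coords GL U" "U \<noteq> {}" "zariski_open_in matrix_coords GL V" "V \<noteq> {}"
  shows "U \<inter> V \<noteq> {}"
proof -
  obtain P Q where P: "U = {w \<in> GL. \<exists>p\<in>P. eval_with (\<lambda>a. a) (matrix_coords w) p \<noteq> 0}"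
    and Q: "V = {w \<in> GL. \<exists>p\<in>Q. eval_with (\<lambda>a. a) (matrix_coords w) p \<noteq> 0}"
    using assms by (auto simp: zariski_open_in_def)
  obtain g p where g: "g \<in> GL" "p \<in> P" "eval_with (\<lambda>a. a) (matrix_coords g) p \<noteq> 0"
    using assms(2) P by auto
  obtain h q where h: "h \<in> GL" "q \<in> Q" "eval_with (\<lambda>a. a) (matrix_coords h) q \<noteq> 0"
    using assms(4) Q by auto
  define \<gamma> where "\<gamma> s = (\<chi> i j. g $ i $ j + s * (h $ i $ j - g $ i $ j))" for s
  have \<gamma>0: "\<gamma> 0 = g" and \<gamma>1: "\<gamma> 1 = h" by (simp_all add: \<gamma>_def vec_eq_iff)
  have co: "\<exists>q. \<forall>s. matrix_coords (\<gamma> s) ij = poly q s" for ij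
    by (cases ij, rule exI[of _ "[:g $ fst ij $ snd ij, h $ fst ij $ snd ij - g $ fst ij $ snd ij:]"])
      (simp add: matrix_coords_def \<gamma>_def)
  have "poly_fun matrix_coords (\<lambda>w. eval_with (\<lambda>a. a) (matrix_coords w) p)" for p
    :: "('n \<times> 'n, 'k) mpol"
    by (auto simp: poly_fun_def)
  then have "\<exists>r. \<forall>s. eval_with (\<lambda>a. a) (matrix_coords (\<gamma> s)) p = poly r s" for p
    :: "('n \<times> 'n, 'k) mpol"
    by (rule poly_fun_on_curve) (rule co)
  then obtain r where r: "\<And>p s. eval_with (\<lambda>a. a) (matrix_coords (\<gamma> s)) p = poly (r p) s" by metis
  have "det (\<gamma> s) = poly (\<Sum>\<pi> | \<pi> permutes UNIV. of_int (sign \<pi>) *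
      (\<Prod>i\<in>UNIV. [:g $ i $ \<pi> i, h $ i $ \<pi> i - g $ i $ \<pi> i:])) s" for s
    by (simp add: det_def poly_sum poly_prod \<gamma>_def)
  then obtain d where d: "\<And>s. det (\<gamma> s) = poly d s" by blast
  have "poly (r p) 0 \<noteq> 0" "poly (r q) 1 \<noteq> 0" "poly d 0 \<noteq> 0"
    using g h by (simp_all add: r[symmetric] d[symmetric] \<gamma>0 \<gamma>1 GL_def invertible_det_nz)
  then have "r p \<noteq> 0" "r q \<noteq> 0" "d \<noteq> 0" by auto
  then obtain s where "poly (r p) s \<noteq> 0" "poly (r q) s \<noteq> 0" "poly d s \<noteq> 0"
    by (rule nonzero_poly_product_nonroot)
  then have "\<gamma> s \<in> U \<inter> V"
    using g h by (auto simp: P Q GL_def invertible_det_nz r d)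
  then show ?thesis by blast
qed

text \<open>
  Nonempty open sets meet, so the definite description in \<open>Gin\<close> has at most one candidate.
\<close>

lemma Gin_eqI:
  fixes I :: "('n::{finite, linorder}, 'k::field_char_0) mpol set"
  assumes F: "poly_fun matrix_coords F" "F g0 \<noteq> 0" "invertible g0"
    and J: "\<And>g. invertible g \<Longrightarrow> F g \<noteq> 0 \<Longrightarrow> initial_ideal (change_coords g ` I) = J"
  shows "Gin I = J"
  unfolding Gin_def
proof (rule the_equality)
  obtain p where p: "\<And>g. F g = eval_with (\<lambda>a. a) (matrix_coords g) p"
    using F(1) by (auto simp: poly_fun_def)
  let ?U = "{g \<in> GL. F g \<noteq> 0}"
  have U: "zariski_open_in matrix_coords GL ?U"
    unfolding zariski_open_in_def by (rule exI[of _ "{p}"]) (simp add: p)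
  have ne: "?U \<noteq> {}" using F by (auto simp: GL_def)
  have UJ: "\<forall>g\<in>?U. initial_ideal (change_coords g ` I) = J" using J by (auto simp: GL_def)
  show "\<exists>U. zariski_open_in matrix_coords GL U \<and> U \<noteq> {} \<and> (\<forall>g\<in>U. initial_ideal (change_coords g ` I) = J)"
    using U ne UJ by blast
  fix J' assume "\<exists>U. zariski_open_in matrix_coords GL U \<and> U \<noteq> {} \<and>
    (\<forall>g\<in>U. initial_ideal (change_coords g ` I) = J')"
  then obtain V where V: "zariski_open_in matrix_coords GL V" "V \<noteq> {}"
    "\<forall>g\<in>V. initial_ideal (change_coords g ` I) = J'" by blast
  from GL_open_sets_meet[OF U ne V(1,2)] UJ V(3) show "J' = J" by blast
qed

section \<open>Leading monomials\<close>

lemma revlex_less_irrefl: "\<not> revlex_less a a"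
  by (auto simp: revlex_less_def)

lemma revlex_less_trans:
  assumes "revlex_less a b" "revlex_less b c"
  shows "revlex_less a c"
proof (cases "mdeg a < mdeg b \<or> mdeg b < mdeg c")
  case True
  then show ?thesis using assms by (auto simp: revlex_less_def)
next
  case False
  then obtain i j where
    i: "lookup a i > lookup b i" "\<forall>k>i. lookup a k = lookup b k" and
    j: "lookup b j > lookup c j" "\<forall>k>j. lookup b k = lookup c k" and
    d: "mdeg a = mdeg b" "mdeg b = mdeg c"
    using assms by (auto simp: revlex_less_def)
  have "lookup a (max i j) > lookup c (max i j)"
    using i j by (cases i j rule: linorder_cases) (auto simp: max_def)
  moreover have "\<forall>k>max i j. lookup a k = lookup c k" using i j by auto
  ultimately show ?thesis using d by (auto simp: revlex_less_def)
qed

text \<open>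
  The last variable in which the exponents differ decides.
\<close>

lemma revlex_less_total:
  fixes a b :: "'n::{finite, linorder} monom"
  assumes "a \<noteq> b"
  shows "revlex_less a b \<or> revlex_less b a"
proof (cases "mdeg a = mdeg b")
  case True
  let ?D = "{i. lookup a i \<noteq> lookup b i}"
  have ne: "?D \<noteq> {}" using assms by (auto intro: poly_mapping_eqI)
  then have "Max ?D \<in> ?D" by (intro Max_in) auto
  moreover have "\<forall>k>Max ?D. lookup a k = lookup b k"
    using Max_ge[of ?D] by (auto simp: not_less[symmetric])
  ultimately obtain i where i: "lookup a i \<noteq> lookup b i"
    "\<forall>k>i. lookup a k = lookup b k" by blast
  then consider "lookup a i > lookup b i" | "lookup b i > lookup a i"
    by linarith
  then show ?thesis
  proof cases
    case 1
    then have "revlex_less a b" unfolding revlex_less_def using True i by blast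
    then show ?thesis ..
  next
    case 2
    then have "revlex_less b a" unfolding revlex_less_def using True i by (metis (full_types))
    then show ?thesis ..
  qed
qed (auto simp: revlex_less_def)

lemma lead_monom_eqI:
  assumes "m \<in> keys f" "\<And>m'. m' \<in> keys f \<Longrightarrow> m' \<noteq> m \<Longrightarrow> revlex_less m' m"
  shows "lead_monom f = m"
  unfolding lead_monom_def
proof (rule the_equality)
  fix n assume "n \<in> keys f \<and> (\<forall>m'\<in>keys f. m' \<noteq> n \<longrightarrow> revlex_less m' n)"
  then show "n = m" using assms revlex_less_trans revlex_less_irrefl by metis
qed (use assms in auto)

lemma lead_monom:
  fixes f :: "('n::{finite, linorder}, 'k::zero) mpol"
  assumes "f \<noteq> 0"
  shows "lead_monom f \<in> keys f"
    and "\<And>m. m \<in> keys f \<Longrightarrow> m \<noteq> lead_monom f \<Longrightarrow> revlex_less m (lead_monom f)"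
proof -
  have "\<exists>m\<in>A. \<forall>x\<in>A. x \<noteq> m \<longrightarrow> revlex_less x m" if "finite A" "A \<noteq> {}" for A :: "'n monom set"
    using that
  proof (induction A rule: finite_ne_induct)
    case (insert x A)
    then obtain m where m: "m \<in> A" "\<forall>y\<in>A. y \<noteq> m \<longrightarrow> revlex_less y m" by blast
    have "x \<noteq> m" using insert m by blast
    then consider "revlex_less x m" | "revlex_less m x" using revlex_less_total by blast
    then show ?case
    proof cases
      case 1
      then show ?thesis using m by (intro bexI[of _ m]) auto
    next
      case 2
      then show ?thesis using m revlex_less_trans[of _ m x] by (intro bexI[of _ x]) auto
    qed
  qed simp
  from this[of "keys f"] obtain m where
    m: "m \<in> keys f" "\<forall>x\<in>keys f. x \<noteq> m \<longrightarrow> revlex_less x m"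
    using assms by (auto simp: poly_mapping_eq_iff fun_eq_iff in_keys_iff set_eq_iff)
  then have "lead_monom f = m" by (intro lead_monom_eqI) auto
  then show "lead_monom f \<in> keys f"
    and "\<And>m. m \<in> keys f \<Longrightarrow> m \<noteq> lead_monom f \<Longrightarrow> revlex_less m (lead_monom f)"
    using m by auto
qed

section \<open>Four variables\<close>

lemma UNIV_four: "(UNIV :: 4 set) = {0, 1, 2, 3}"
  using UNIV_4 by auto

lemma all_four: "(\<forall>i::4. P i) \<longleftrightarrow> P 0 \<and> P 1 \<and> P 2 \<and> P 3"
  and ex_four: "(\<exists>i::4. P i) \<longleftrightarrow> P 0 \<or> P 1 \<or> P 2 \<or> P 3"
  using UNIV_four by (metis UNIV_I empty_iff insert_iff)+

lemma sum_four: "sum f (UNIV :: 4 set) = f 0 + f 1 + f 2 + f 3"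
  unfolding UNIV_four by (simp add: ac_simps)

lemma less_four [simp]:
  "(0::4) < 1" "(0::4) < 2" "(0::4) < 3" "(1::4) < 2" "(1::4) < 3" "(2::4) < 3"
  by (simp_all add: less_bit0_def bit0.Rep_0 bit0.Rep_1 bit0.Rep_numeral)

lemma not_less_four [simp]:
  "\<not> (1::4) < 0" "\<not> (2::4) < 0" "\<not> (3::4) < 0" "\<not> (2::4) < 1" "\<not> (3::4) < 1" "\<not> (3::4) < 2"
  by (simp_all add: not_less order_less_imp_le)

definition monom4 :: "nat \<Rightarrow> nat \<Rightarrow> nat \<Rightarrow> nat \<Rightarrow> 4 monom" where
  "monom4 a b c d = single 0 a + single 1 b
    + single 2 c + single 3 d"

lemma lookup_monom4 [simp]:
  "lookup (monom4 a b c d) 0 = a" "lookup (monom4 a b c d) 1 = b"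
  "lookup (monom4 a b c d) 2 = c" "lookup (monom4 a b c d) 3 = d"
  by (simp_all add: monom4_def lookup_add lookup_single)

lemma monom4_eq_iff:
  "m = n \<longleftrightarrow> lookup m 0 = lookup n 0 \<and> lookup m 1 = lookup n 1
    \<and> lookup m 2 = lookup n 2 \<and> lookup m 3 = lookup n 3"
  for m n :: "4 monom"
  using all_four[of "\<lambda>i. lookup m i = lookup n i"]
  by (auto intro: poly_mapping_eqI)

lemma monom4_cases: obtains a b c d where "m = monom4 a b c d"
  using that[of "lookup m 0" "lookup m 1" "lookup m 2" "lookup m 3"]
  by (simp add: monom4_eq_iff[of m])

lemma mdeg_monom4 [simp]: "mdeg (monom4 a b c d) = a + b + c + d"
  by (simp add: mdeg_sum sum_four)

lemma monom4_add: "monom4 a b c d + monom4 a' b' c' d' = monom4 (a + a') (b + b') (c + c') (d + d')"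
  by (simp add: monom4_eq_iff lookup_add)

lemma monom4_inject: "monom4 a b c d = monom4 a' b' c' d' \<longleftrightarrow> a = a' \<and> b = b' \<and> c = c' \<and> d = d'"
  by (simp add: monom4_eq_iff)

lemma mon_monom4:
  "mon (monom4 a b c d) = (x1 ^ a * x2 ^ b * x3 ^ c * x4 ^ d :: (4, 'k::comm_ring_1) mpol)"
  by (simp add: monom4_def mon_add Var_power)

text \<open>
  The first three exponents determine a monomial of degree \<open>t\<close>, which turns the count into a
  computation on lists.
\<close>

lemma card_monomials:
  "card {m :: 4 monom. mdeg m = t} =
    length (filter (\<lambda>(a, b, c). a + b + c \<le> t) (List.product [0..<Suc t] (List.product [0..<Suc t] [0..<Suc t])))"
proof -
  let ?l = "filter (\<lambda>(a, b, c). a + b + c \<le> t) (List.product [0..<Suc t] (List.product [0..<Suc t] [0..<Suc t]))"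
  have "{m :: 4 monom. mdeg m = t} = (\<lambda>(a, b, c). monom4 a b c (t - a - b - c)) ` set ?l"
  proof (intro equalityI subsetI)
    fix m :: "4 monom" assume m: "m \<in> {m. mdeg m = t}"
    obtain a b c d where abcd: "m = monom4 a b c d" by (rule monom4_cases)
    then show "m \<in> (\<lambda>(a, b, c). monom4 a b c (t - a - b - c)) ` set ?l"
      using m by (intro image_eqI[of _ _ "(a, b, c)"]) (auto simp del: upt_Suc)
  qed (auto simp del: upt_Suc)
  moreover have "inj_on (\<lambda>(a, b, c). monom4 a b c (t - a - b - c)) (set ?l)"
    by (auto simp: inj_on_def monom4_inject simp del: upt_Suc)
  moreover have "distinct ?l" by (intro distinct_filter distinct_product distinct_upt)
  ultimately show ?thesis by (simp only: card_image distinct_card)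
qed

lemma card_monomials_values:
  "card {m :: 4 monom. mdeg m = 0} = 1" "card {m :: 4 monom. mdeg m = 1} = 4"
  "card {m :: 4 monom. mdeg m = 2} = 10" "card {m :: 4 monom. mdeg m = 3} = 20"
  "card {m :: 4 monom. mdeg m = 4} = 35" "card {m :: 4 monom. mdeg m = 5} = 56"
  unfolding card_monomials by code_simp+

section \<open>A reverse lexicographic segment ideal\<close>

text \<open>
  The monomials outside \<open>J\<close>: all those of degree at most 1, then
  \<open>x\<^sub>1x\<^sub>4, x\<^sub>2x\<^sub>4, x\<^sub>3x\<^sub>4, x\<^sub>4\<^sup>2, x\<^sub>2x\<^sub>3, x\<^sub>3\<^sup>2\<close> in degree 2, \<open>x\<^sub>1x\<^sub>4\<^sup>2, x\<^sub>2x\<^sub>4\<^sup>2, x\<^sub>3x\<^sub>4\<^sup>2, x\<^sub>4\<^sup>3\<close> in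
  degree 3, and \<open>x\<^sub>4\<^sup>4\<close>.
\<close>

definition standard :: "4 monom \<Rightarrow> bool" where
  "standard m \<longleftrightarrow> mdeg m \<le> 1 \<or>
     mdeg m = 2 \<and> (lookup m 3 \<ge> 1 \<or> lookup m 2 \<ge> 1 \<and> lookup m 0 = 0) \<or>
     mdeg m = 3 \<and> lookup m 3 \<ge> 2 \<or>
     mdeg m = 4 \<and> lookup m 3 \<ge> 4"

text \<open>
  The standard monomials are the smallest ones of their degree, so a form whose leading monomial is standard
  involves only standard monomials.
\<close>

lemma standard_down_closed:
  assumes "standard m" "mdeg n = mdeg m" "revlex_less n m"
  shows "standard n"
proof -
  obtain a b c d where m: "m = monom4 a b c d" by (rule monom4_cases)
  obtain a' b' c' d' where n: "n = monom4 a' b' c' d'" by (rule monom4_cases)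
  have "a' + b' + c' + d' = a + b + c + d" using assms m n by simp
  moreover have "d' > d \<or> d' = d \<and> (c' > c \<or> c' = c \<and> (b' > b \<or> b' = b \<and> a' > a))"
    using assms m n by (auto simp: revlex_less_def ex_four all_four)
  ultimately show ?thesis using assms(1) unfolding m n standard_def by auto
qed

abbreviation standard_of_degree :: "nat \<Rightarrow> (4, 'k::zero_neq_one) mpol set" where
  "standard_of_degree t \<equiv> mon ` {m. standard m \<and> mdeg m = t}"

abbreviation segment_ideal :: "(4, 'k::comm_ring_1) mpol set" where
  "segment_ideal \<equiv> ideal_gen {x1^2, x1*x2, x2^2, x1*x3, x2*x3^2, x3^3, x2*x3*x4, x3^2*x4,
                    x1*x4^3, x2*x4^3, x3*x4^3, x4^5}"

definition segment_generators :: "4 monom set" where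
  "segment_generators = {monom4 2 0 0 0, monom4 1 1 0 0, monom4 0 2 0 0, monom4 1 0 1 0, monom4 0 1 2 0,
     monom4 0 0 3 0, monom4 0 1 1 1, monom4 0 0 2 1, monom4 1 0 0 3, monom4 0 1 0 3, monom4 0 0 1 3,
     monom4 0 0 0 5}"

lemma segment_ideal_eq: "segment_ideal = ideal_gen (mon ` segment_generators)"
  by (simp add: segment_generators_def mon_monom4)

lemma segment_generators_nonstandard:
  "m \<in> segment_generators \<Longrightarrow> \<not> standard m \<and> mdeg m \<in> {2..5}"
  by (auto simp: segment_generators_def standard_def)

text \<open>
  If no generator divides \<open>m\<close>, the exponents are bounded by 1, 1, 2 and 4, and the remaining
  combinations are checked one by one.
\<close>

lemma nonstandard_in_segment_ideal:
  assumes "\<not> standard m"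
  shows "mon m \<in> (segment_ideal :: (4, 'k::comm_ring_1) mpol set)"
proof -
  obtain a b c d where m: "m = monom4 a b c d" by (rule monom4_cases)
  have dvd: "mon m \<in> (segment_ideal :: (4, 'k) mpol set)"
    if "monom4 a' b' c' d' \<in> segment_generators" "a' \<le> a" "b' \<le> b" "c' \<le> c" "d' \<le> d" for a' b' c' d'
  proof -
    have eq: "mon m = (mon (monom4 (a - a') (b - b') (c - c') (d - d')) * mon (monom4 a' b' c' d') :: (4, 'k) mpol)"
      using that by (simp add: m mon_add[symmetric] monom4_add)
    show ?thesis unfolding segment_ideal_eq eq by (intro ideal_gen_mult ideal_gen_base imageI that(1))
  qed
  have "a \<ge> 2 \<or> a \<ge> 1 \<and> b \<ge> 1 \<or> b \<ge> 2 \<or> a \<ge> 1 \<and> c \<ge> 1 \<or> b \<ge> 1 \<and> c \<ge> 2 \<or> c \<ge> 3 \<or> b \<ge> 1 \<and> c \<ge> 1 \<and> d \<ge> 1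
    \<or> c \<ge> 2 \<and> d \<ge> 1 \<or> a \<ge> 1 \<and> d \<ge> 3 \<or> b \<ge> 1 \<and> d \<ge> 3 \<or> c \<ge> 1 \<and> d \<ge> 3 \<or> d \<ge> 5"
  proof (rule ccontr)
    assume n: "\<not> ?thesis"
    then have "a < 2" "b < 2" "c < 3" "d < 5" unfolding not_le[symmetric] by blast+
    then have "a \<in> {0, 1}" "b \<in> {0, 1}" "c \<in> {0, 1, 2}" "d \<in> {0, 1, 2, 3, 4}" by auto
    then show False using n assms unfolding m standard_def mdeg_monom4 lookup_monom4
      by (elim insertE emptyE; simp)
  qed
  then show ?thesis
    using dvd[of 2 0 0 0] dvd[of 1 1 0 0] dvd[of 0 2 0 0] dvd[of 1 0 1 0] dvd[of 0 1 2 0] dvd[of 0 0 3 0]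
      dvd[of 0 1 1 1] dvd[of 0 0 2 1] dvd[of 1 0 0 3] dvd[of 0 1 0 3] dvd[of 0 0 1 3] dvd[of 0 0 0 5]
    unfolding segment_generators_def by auto
qed

text \<open>
  In degrees 0 and 1 all monomials are standard, and from degree 5 on none is, so the condition in
  degree 5 says that the ideal contains all forms of that degree.
\<close>

definition segment_spans :: "(4, 'k::field) mpol set \<Rightarrow> bool" where
  "segment_spans I \<longleftrightarrow> (\<forall>t\<in>{2..5}. homs t \<subseteq> mp.span (I \<union> standard_of_degree t))"

lemma homs_subset_span_graded:
  fixes I :: "('n, 'k::field) mpol set"
  assumes "mp.subspace I" "L \<subseteq> homs t" "homs t \<subseteq> mp.span (I \<union> L)" "I \<inter> homs t \<subseteq> mp.span G"
  shows "homs t \<subseteq> mp.span (G \<union> L)"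
proof
  fix p :: "('n, 'k) mpol" assume p: "p \<in> homs t"
  then have "p \<in> mp.span (I \<union> L)" using assms(3) by blast
  then obtain i l where il: "p = i + l" "i \<in> mp.span I" "l \<in> mp.span L" by (auto simp: mp.span_Un)
  have "i \<in> I" using il(2) mp.span_eq_iff[THEN iffD2, OF assms(1)] by simp
  moreover have "mp.span L \<subseteq> homs t" using assms(2) by (intro mp.span_minimal subspace_homs)
  then have "l \<in> homs t" using il(3) by blast
  then have "p - l \<in> homs t" using p homogeneous_diff[of t p l] by simp
  moreover have "p - l = i" using il(1) by simp
  ultimately have "i \<in> mp.span G" using assms(4) by auto
  then show "p \<in> mp.span (G \<union> L)" using il by (auto simp: mp.span_Un)
qed

text \<open>
  \<open>G\<close> and the standard monomials together span the forms of degree \<open>t\<close> and are not more than the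
  dimension of that space. Hence they are independent, and the sum of their spans is direct.
\<close>

lemma standard_independent:
  fixes I :: "(4, 'k::field) mpol set"
  assumes "mp.subspace I" and sp: "homs t \<subseteq> mp.span (I \<union> standard_of_degree t)"
    and G: "finite G" "I \<inter> homs t \<subseteq> mp.span G"
    and card: "card G + card {m. standard m \<and> mdeg m = t} \<le> card {m :: 4 monom. mdeg m = t}"
    and x: "x \<in> I" "x \<in> mp.span (standard_of_degree t)"
  shows "x = 0"
proof -
  let ?L = "standard_of_degree t :: (4, 'k) mpol set"
  let ?M = "mon ` {m. mdeg m = t} :: (4, 'k) mpol set"
  have finL: "finite ?L" using finite_subset[OF _ finite_mdeg, of "{m. standard m \<and> mdeg m = t}" t] by auto
  have L: "mp.span ?L \<subseteq> homs t" by (intro mp.span_minimal subspace_homs) auto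
  have spGL: "homs t \<subseteq> mp.span (G \<union> ?L)"
    by (rule homs_subset_span_graded[OF assms(1) _ sp G(2)]) auto
  have M: "?M \<subseteq> homs t" "mp.indep_mod {} ?M" "card ?M = card {m :: 4 monom. mdeg m = t}" "finite ?M"
    using indep_mon[OF finite_mdeg] card_image[OF inj_mon] finite_mdeg by auto
  have cL: "card ?L \<le> card {m. standard m \<and> mdeg m = t}"
    by (rule card_image_le) (rule finite_subset[OF _ finite_mdeg, of _ t], auto)
  have cU: "card (G \<union> ?L) \<le> card G + card ?L" by (rule card_Un_le)
  have "card ?M \<le> card (G \<union> ?L)"
    using mp.indep_mod_card_le[of "G \<union> ?L" ?M "{}"] M spGL finL G by auto
  with card cL cU M(3) have eq: "card (G \<union> ?L) = card G + card ?L" by linarith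
  have "card (G \<union> ?L) + card (G \<inter> ?L) = card G + card ?L"
    using card_Un_Int[OF G(1) finL] by simp
  then have disj: "G \<inter> ?L = {}" using eq G(1) finL by simp
  have ind: "mp.indep_mod {} (G \<union> ?L)"
    by (rule mp.spanning_indep_mod[OF _ _ M(1,2)]) (use spGL finL G(1) card cL cU M(3) in auto)
  have ind': "mp.indep_mod G ?L"
    unfolding mp.indep_mod_def
  proof
    fix l assume l: "l \<in> ?L"
    then have eq: "{} \<union> (G \<union> ?L - {l}) = G \<union> (?L - {l})" using disj by auto
    have "l \<in> G \<union> ?L" using l by simp
    from bspec[OF ind[unfolded mp.indep_mod_def] this]
    show "l \<notin> mp.span (G \<union> (?L - {l}))" unfolding eq .
  qed
  obtain b where b: "x = (\<Sum>l\<in>?L. Const (b l) * l)"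
    using mp.span_imageE[of x id ?L] x(2) finL by auto
  have "x \<in> mp.span G" using G(2) x L by auto
  then have "\<And>l. l \<in> ?L \<Longrightarrow> b l = 0" using mp.indep_mod_sum_zero[OF ind' finL, of b] b by simp
  then show "x = 0" using b by simp
qed

lemma standard_degree_2:
  "{m. standard m \<and> mdeg m = 2} = {monom4 1 0 0 1, monom4 0 1 0 1, monom4 0 0 1 1, monom4 0 0 0 2,
     monom4 0 0 2 0, monom4 0 1 1 0}" (is "?A = ?B")
proof (intro equalityI subsetI)
  fix m assume "m \<in> ?A"
  moreover obtain a b c d where m: "m = monom4 a b c d" by (rule monom4_cases)
  ultimately have e: "a + b + c + d = 2" "d \<ge> 1 \<or> c \<ge> 1 \<and> a = 0" by (auto simp: standard_def)
  then have "a \<in> {0, 1, 2}" "b \<in> {0, 1, 2}" "c \<in> {0, 1, 2}" by auto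
  then show "m \<in> ?B" using e unfolding m by (elim insertE emptyE; simp add: monom4_inject)
qed (auto simp: standard_def)

lemma standard_degree_3:
  "{m. standard m \<and> mdeg m = 3} = {monom4 1 0 0 2, monom4 0 1 0 2, monom4 0 0 1 2, monom4 0 0 0 3}"
  (is "?A = ?B")
proof (intro equalityI subsetI)
  fix m assume "m \<in> ?A"
  moreover obtain a b c d where m: "m = monom4 a b c d" by (rule monom4_cases)
  ultimately have e: "a + b + c + d = 3" "d \<ge> 2" by (auto simp: standard_def)
  then have "a \<in> {0, 1}" "b \<in> {0, 1}" "c \<in> {0, 1}" by auto
  then show "m \<in> ?B" using e unfolding m by (elim insertE emptyE; simp add: monom4_inject)
qed (auto simp: standard_def)

lemma standard_degree_4: "{m. standard m \<and> mdeg m = 4} = {monom4 0 0 0 4}" (is "?A = ?B")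
proof (intro equalityI subsetI)
  fix m assume "m \<in> ?A"
  moreover obtain a b c d where m: "m = monom4 a b c d" by (rule monom4_cases)
  ultimately show "m \<in> ?B" by (auto simp: standard_def monom4_inject)
qed (auto simp: standard_def)

lemma card_standard:
  "card {m. standard m \<and> mdeg m = 2} = 6" "card {m. standard m \<and> mdeg m = 3} = 4"
  "card {m. standard m \<and> mdeg m = 4} = 1"
  unfolding standard_degree_2 standard_degree_3 standard_degree_4 by (simp_all add: monom4_inject)

lemma mult_span:
  assumes "x \<in> mp.span X"
  shows "b * x \<in> mp.span ((*) b ` X)"
proof -
  have "x \<in> {x. b * x \<in> mp.span ((*) b ` X)}"
  proof (rule mp.span_induct_alt[OF assms])
    fix c x y assume xy: "x \<in> X" "y \<in> {x. b * x \<in> mp.span ((*) b ` X)}"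
    have "Const c * (b * x) + b * y \<in> mp.span ((*) b ` X)"
      by (rule mp.span_add, rule mp.span_scale, rule mp.span_base) (use xy in auto)
    then show "Const c * x + y \<in> {x. b * x \<in> mp.span ((*) b ` X)}"
      by (simp add: distrib_left mult.left_commute)
  qed (simp add: mp.span_zero)
  then show ?thesis by simp
qed

lemma ideal_gen_homs_subset:
  fixes B :: "('n::finite, 'k::field) mpol set"
  assumes "\<And>b. b \<in> B \<Longrightarrow> homogeneous d b"
  shows "ideal_gen B \<inter> homs (d + s) \<subseteq> mp.span ((\<lambda>(b, m). b * mon m) ` (B \<times> {m. mdeg m = s}))"
proof
  fix x assume x: "x \<in> ideal_gen B \<inter> homs (d + s)"
  then have "hcomp (d + s) x = x" using hcomp_homogeneous[of "d + s" x "d + s"] by simp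
  moreover have "hcomp (d + s) x \<in> mp.span {b * mon m | b m. b \<in> B \<and> mdeg m = s}"
    by (rule hcomp_ideal_gen(1)[OF assms]) (use x in auto)
  moreover have "{b * mon m | b m. b \<in> B \<and> mdeg m = s} = (\<lambda>(b, m). b * mon m) ` (B \<times> {m. mdeg m = s})"
    by auto
  ultimately show "x \<in> mp.span ((\<lambda>(b, m). b * mon m) ` (B \<times> {m. mdeg m = s}))" by simp
qed

text \<open>
  The forms of degrees 2 and 3 in the ideal are spanned by 4 and by 16 products, which leaves room for the
  \<open>6 = 10 - 4\<close> and \<open>4 = 20 - 16\<close> standard monomials. In degree 4 there are 40 products of generators with
  monomials, subject to the Koszul relations. To account for these, \<open>S\<^sub>2\<close> is replaced by its spanning set
  consisting of the generators and the 6 standard monomials: the 10 products of two generators and the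
  24 products of a generator with a standard monomial remain, and \<open>34 = 35 - 1\<close>.
\<close>

lemma segment_spans_independent:
  fixes h1 h2 h3 h4 :: "(4, 'k::field) mpol"
  defines "B \<equiv> {h1, h2, h3, h4}"
  assumes h: "\<And>b. b \<in> B \<Longrightarrow> homogeneous 2 b"
    and sp: "segment_spans (ideal_gen B)"
    and x: "x \<in> ideal_gen B" "x \<in> mp.span (standard_of_degree t)"
  shows "x = 0"
proof -
  let ?I = "ideal_gen B"
  have B: "finite B" "card B \<le> 4"
    unfolding B_def using card_length[of "[h1, h2, h3, h4]"] by simp_all
  have "mp.span (standard_of_degree t) \<subseteq> (homs t :: (4, 'k) mpol set)"
    by (intro mp.span_minimal subspace_homs) auto
  then have hx: "homogeneous t x" using x by auto
  note ind = standard_independent[OF subspace_ideal_gen _ _ _ _ x]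
  have sp': "homs t \<subseteq> mp.span (?I \<union> standard_of_degree t)" if "t \<in> {2..5}" for t
    using sp that by (simp add: segment_spans_def)
  let ?G = "\<lambda>s. (\<lambda>(b, m). b * mon m) ` (B \<times> {m. mdeg m = s})"
  have G: "finite (?G s)" "card (?G s) \<le> 4 * card {m :: 4 monom. mdeg m = s}" for s
  proof -
    have fin: "finite (B \<times> {m :: 4 monom. mdeg m = s})" using B finite_mdeg by blast
    then show "finite (?G s)" by blast
    have "card (?G s) \<le> card (B \<times> {m :: 4 monom. mdeg m = s})" by (rule card_image_le[OF fin])
    also have "\<dots> \<le> 4 * card {m :: 4 monom. mdeg m = s}" using B by (simp add: card_cartesian_product)
    finally show "card (?G s) \<le> 4 * card {m :: 4 monom. mdeg m = s}" .
  qed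
  have IG: "?I \<inter> homs (2 + s) \<subseteq> mp.span (?G s)" for s
    by (rule ideal_gen_homs_subset[OF h])
  consider "t < 2" | "t = 2" | "t = 3" | "t = 4" | "t \<ge> 5" by linarith
  then show "x = 0"
  proof cases
    case 1
    have "hcomp t x = x" using hcomp_homogeneous[OF hx, of t] by simp
    then show ?thesis using hcomp_ideal_gen(2)[OF h x(1) 1] by simp
  next
    case 2
    show ?thesis
      by (rule ind[of "?G 0"]) (use 2 sp'[of 2] G[of 0] IG[of 0] card_standard card_monomials_values in auto)
  next
    case 3
    show ?thesis
      by (rule ind[of "?G 1"]) (use 3 sp'[of 3] G[of 1] IG[of 1] card_standard card_monomials_values in auto)
  next
    case 4
    let ?L = "standard_of_degree 2 :: (4, 'k) mpol set"
    let ?P = "set [h1 * h1, h1 * h2, h1 * h3, h1 * h4, h2 * h2, h2 * h3, h2 * h4, h3 * h3, h3 * h4, h4 * h4]"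
    let ?H = "?P \<union> (\<lambda>(b, l). b * l) ` (B \<times> ?L)"
    have finL: "finite ?L" unfolding standard_degree_2 by simp
    have "card ?L \<le> 6" using card_image_le[of "{m. standard m \<and> mdeg m = 2}" mon] card_standard(1)
      unfolding standard_degree_2 by simp
    then have "card B * card ?L \<le> 4 * 6" using B by (intro mult_mono) auto
    then have "card (B \<times> ?L) \<le> 24" by (simp add: card_cartesian_product)
    moreover have "card ((\<lambda>(b, l). b * l) ` (B \<times> ?L)) \<le> card (B \<times> ?L)"
      by (rule card_image_le) (use B finL in auto)
    moreover have "card ?P \<le> 10" using card_length[of "[h1 * h1, h1 * h2, h1 * h3, h1 * h4, h2 * h2, h2 * h3,
        h2 * h4, h3 * h3, h3 * h4, h4 * h4]"] by simp
    ultimately have cH: "card ?H \<le> 34"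
      using card_Un_le[of ?P "(\<lambda>(b, l). b * l) ` (B \<times> ?L)"] by linarith
    have PB: "b * c \<in> ?P" if "b \<in> B" "c \<in> B" for b c
      using that unfolding B_def by (auto simp: mult.commute)
    have "?G 0 \<subseteq> B"
      by (auto simp: mdeg_eq_0_iff)
    then have "mp.span (?G 0) \<subseteq> mp.span B" by (rule mp.span_mono)
    then have IB: "?I \<inter> homs 2 \<subseteq> mp.span B" using IG[of 0] by simp
    have BL: "homs 2 \<subseteq> mp.span (B \<union> ?L)"
      by (rule homs_subset_span_graded[OF subspace_ideal_gen _ _ IB]) (use sp'[of 2] in auto)
    have "?G 2 \<subseteq> mp.span ?H"
    proof clarify
      fix b and m :: "4 monom" assume b: "b \<in> B" and m: "mdeg m = 2"
      have "(mon m :: (4, 'k) mpol) \<in> mp.span (B \<union> ?L)" using m BL by auto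
      then have "b * mon m \<in> mp.span ((*) b ` (B \<union> ?L))" by (rule mult_span)
      moreover have "(*) b ` (B \<union> ?L) \<subseteq> ?H" using b PB[OF b] by auto
      ultimately show "b * mon m \<in> mp.span ?H" using mp.span_mono by blast
    qed
    then have "mp.span (?G 2) \<subseteq> mp.span ?H" by (intro mp.span_minimal) auto
    then have IH: "?I \<inter> homs 4 \<subseteq> mp.span ?H" using IG[of 2] by auto
    have finH: "finite ?H" using B finL by blast
    show ?thesis
      by (rule ind[of ?H]) (use 4 sp'[of 4] finH IH cH card_standard(3) card_monomials_values(5) in auto)
  next
    case 5
    then have e: "standard_of_degree t = ({} :: (4, 'k) mpol set)" by (auto simp: standard_def)
    show ?thesis using x(2) unfolding e by simp
  qed
qed

text \<open>
  If the leading monomial of an element of the ideal were standard, the component of that degree would be a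
  combination of standard monomials in the ideal, hence zero. Conversely, a nonstandard monomial \<open>m\<close> of
  degree 2 to 5 differs from an element of the ideal by standard monomials, which are smaller than \<open>m\<close>,
  so \<open>m\<close> is the leading monomial of that element.
\<close>

lemma initial_ideal_eq_segment_ideal:
  fixes h1 h2 h3 h4 :: "(4, 'k::field) mpol"
  defines "B \<equiv> {h1, h2, h3, h4}"
  assumes h: "\<And>b. b \<in> B \<Longrightarrow> homogeneous 2 b"
    and sp: "segment_spans (ideal_gen B)"
  shows "initial_ideal (ideal_gen B) = segment_ideal"
proof
  let ?I = "ideal_gen B"
  note ind = segment_spans_independent[of h1 h2 h3 h4, folded B_def, OF h sp]
  show "initial_ideal ?I \<subseteq> segment_ideal"
    unfolding initial_ideal_def
  proof (rule ideal_gen_minimal, clarify)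
    fix f assume f: "f \<in> ?I" "f \<noteq> 0"
    let ?d = "mdeg (lead_monom f)"
    have "\<not> standard (lead_monom f)"
    proof
      assume st: "standard (lead_monom f)"
      have "standard m" if "m \<in> keys f" "mdeg m = ?d" for m
        using lead_monom(2)[OF f(2) that(1)] st that standard_down_closed by metis
      then have "keys (hcomp ?d f) \<subseteq> {m. standard m \<and> mdeg m = ?d}"
        by (auto simp: in_keys_iff lookup_hcomp split: if_splits)
      then have "hcomp ?d f \<in> mp.span (standard_of_degree ?d)" by (rule in_span_mon)
      moreover have "hcomp ?d f \<in> ?I" by (rule hcomp_ideal_gen_mem[OF h f(1)])
      ultimately have "hcomp ?d f = 0" by (intro ind)
      then have "lookup f (lead_monom f) = 0"
        using lookup_hcomp[of ?d f "lead_monom f"] by simp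
      then show False using lead_monom(1)[OF f(2)] by (simp add: in_keys_iff)
    qed
    then show "mon (lead_monom f) \<in> segment_ideal" by (rule nonstandard_in_segment_ideal)
  qed
  show "segment_ideal \<subseteq> initial_ideal ?I"
    unfolding segment_ideal_eq initial_ideal_def
  proof (rule ideal_gen_minimal, clarify)
    fix m assume "m \<in> segment_generators"
    from segment_generators_nonstandard[OF this]
    have m: "\<not> standard m" "mdeg m \<in> {2..5}" by auto
    have "(mon m :: (4, 'k) mpol) \<in> homs (mdeg m)" by simp
    then have "(mon m :: (4, 'k) mpol) \<in> mp.span (?I \<union> standard_of_degree (mdeg m))"
      using sp m(2) unfolding segment_spans_def by blast
    then obtain i l where il: "mon m = i + l" "i \<in> mp.span ?I" "l \<in> mp.span (standard_of_degree (mdeg m))"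
      by (auto simp: mp.span_Un)
    have kl: "keys l \<subseteq> {n. standard n \<and> mdeg n = mdeg m}" using il(3) by (rule keys_of_span_mon)
    have "m \<notin> keys l" using kl m by auto
    then have "lookup i m = 1"
      using arg_cong[OF il(1), of "\<lambda>p. lookup p m"] by (simp add: lookup_add in_keys_iff)
    then have mi: "m \<in> keys i" by (simp add: in_keys_iff)
    have "lead_monom i = m"
    proof (rule lead_monom_eqI[OF mi])
      fix n assume n: "n \<in> keys i" "n \<noteq> m"
      have "i = mon m - l" using il(1) by simp
      then have "n \<in> keys l" using n by (auto simp: in_keys_iff lookup_minus lookup_single when_def)
      then have "standard n" "mdeg n = mdeg m" using kl by auto
      then have "\<not> revlex_less m n" using standard_down_closed[of n m] m by auto
      then show "revlex_less n m" using revlex_less_total n by blast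
    qed
    then have "mon m = mon (lead_monom i) \<and> i \<in> ?I \<and> i \<noteq> 0" using il(2) mi by auto
    then show "mon m \<in> ideal_gen {mon (lead_monom f) | f. f \<in> ?I \<and> f \<noteq> 0}"
      by (intro ideal_gen_base) blast
  qed
qed

section \<open>Linear forms\<close>

lemma Const_eq_0_iff: "Const c = (0 :: ('n, 'k::comm_ring_1) mpol) \<longleftrightarrow> c = 0"
  by (metis Const_simps(1) lookup_Const)

lemma linear_form_expand:
  fixes p :: "('n::finite, 'k::field) mpol"
  assumes "homogeneous 1 p"
  shows "p = (\<Sum>j\<in>UNIV. Const (lookup p (single j 1)) * Var j)"
proof -
  let ?M = "range (\<lambda>j :: 'n. single j (1 :: nat))"
  have "keys p \<subseteq> ?M"
  proof
    fix m assume "m \<in> keys p"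
    then have "mdeg m = Suc 0" using assms by (simp add: homogeneous_def)
    then obtain i m' where "m = single i 1 + m'" "mdeg m' = 0" by (rule mdeg_SucE)
    then show "m \<in> ?M" by (auto simp: mdeg_eq_0_iff)
  qed
  then have "p = (\<Sum>m\<in>?M. Const (lookup p m) * mon m)" by (intro mpol_expand_superset) auto
  moreover have "inj (\<lambda>j :: 'n. single j (1 :: nat))"
    by (rule injI) (metis keys_single insert_iff empty_iff one_neq_zero)
  ultimately show ?thesis by (simp add: sum.reindex Var_def)
qed

text \<open>
  The rows of the matrix are the coefficient vectors of the forms.
\<close>

lemma independent_linear_forms_substitution:
  fixes r :: "'n::finite \<Rightarrow> ('n, 'k::field) mpol"
  assumes hom: "\<And>i. homogeneous 1 (r i)"
    and ind: "\<And>c i. (\<Sum>i\<in>UNIV. Const (c i) * r i) = 0 \<Longrightarrow> c i = 0"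
  shows "\<exists>g. invertible g \<and> (\<forall>i. change_coords g (Var i) = r i)"
proof -
  define g where "g = (\<chi> i j. lookup (r i) (single j 1))"
  have "c i = 0" if c: "(\<Sum>i\<in>UNIV. c i *s row i g) = 0" for c i
  proof (rule ind)
    let ?q = "\<Sum>i\<in>UNIV. Const (c i) * r i"
    have "homogeneous 1 ?q" by (intro homogeneous_sum homogeneous_Const_mult hom)
    then have exp: "?q = (\<Sum>j\<in>UNIV. Const (lookup ?q (single j 1)) * Var j)"
      by (rule linear_form_expand)
    have coeff: "lookup ?q (single j 1) = 0" for j
      using arg_cong[OF c, of "\<lambda>v. v $ j"] by (simp add: lookup_sum g_def row_def)
    show "?q = 0" by (subst exp, simp only: coeff) simp
  qed
  then obtain B where "g ** B = mat 1" using matrix_right_invertible_independent_rows[of g] by blast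
  then have "invertible g" unfolding invertible_def using matrix_left_right_inverse by blast
  moreover have "change_coords g (Var i) = r i" for i
    using linear_form_expand[OF hom[of i]] by (simp add: change_coords_Var g_def)
  ultimately show ?thesis by blast
qed

text \<open>
  Polarization: \<open>2xy = (x + y)\<^sup>2 - x\<^sup>2 - y\<^sup>2\<close>.
\<close>

lemma squares_span_quadrics:
  fixes V :: "('n::finite, 'k::field_char_0) mpol set"
  assumes V: "mp.subspace V" and sq: "\<And>p. homogeneous 1 p \<Longrightarrow> p * p \<in> V"
  shows "homs 2 \<subseteq> V"
proof -
  have "mon m \<in> V" if m: "mdeg m = 2" for m :: "'n monom"
  proof -
    obtain i m' where i: "m = single i 1 + m'" "mdeg m' = 1"
      using mdeg_SucE[of m 1] m by auto
    obtain j m'' where j: "m' = single j 1 + m''" "mdeg m'' = 0"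
      using mdeg_SucE[of m' 0] i by auto
    have mon: "mon m = (Var i * Var j :: ('n, 'k) mpol)"
      using i j by (simp add: mdeg_eq_0_iff mon_add Var_def)
    let ?s = "(Var i + Var j) * (Var i + Var j) - Var i * Var i - Var j * Var j :: ('n, 'k) mpol"
    have "?s \<in> V"
      by (intro mp.subspace_diff[OF V] sq homogeneous_add homogeneous_Var)
    then have "Const (1/2) * ?s \<in> V" by (rule mp.subspace_scale[OF V])
    also have "?s = (1 + 1) * (Var i * Var j)" by (simp add: algebra_simps)
    also have "1 + 1 = (Const (1 + 1) :: ('n, 'k) mpol)" by (simp only: Const_add Const_simps)
    also have "Const (1/2) * (Const (1 + 1) * (Var i * Var j)) = (Var i * Var j :: ('n, 'k) mpol)"
      by (simp add: mult.assoc[symmetric] Const_mult[symmetric])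
    finally show ?thesis using mon by simp
  qed
  then have "mp.span (mon ` {m. mdeg m = 2}) \<subseteq> V" using V by (intro mp.span_minimal) auto
  then show ?thesis by (simp add: homs_eq_span)
qed

text \<open>
  As the squares span the quadrics, there are \<open>p\<close>, \<open>q\<close> with \<open>p\<^sup>2\<close>, \<open>q\<^sup>2\<close> independent modulo \<open>W\<close>. If neither
  \<open>(p, q)\<close> nor \<open>(q, p)\<close> has the required property, then \<open>pq\<close> is modulo \<open>W\<close> a multiple of \<open>p\<^sup>2\<close> and also of
  \<open>q\<^sup>2\<close>, hence zero. Then \<open>(p + q)\<^sup>2 \<equiv> p\<^sup>2 + q\<^sup>2\<close> and \<open>(p + q)q \<equiv> q\<^sup>2\<close> modulo \<open>W\<close>, and \<open>(p + q, q)\<close> has it.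
\<close>

lemma exists_square_and_product_independent:
  fixes W :: "('n::finite, 'k::field_char_0) mpol set"
  assumes W: "mp.subspace W"
    and codim: "\<And>C. finite C \<Longrightarrow> homs 2 \<subseteq> mp.span (W \<union> C) \<Longrightarrow> 2 \<le> card C"
  shows "\<exists>a b. homogeneous 1 a \<and> homogeneous 1 b \<and>
    (\<forall>\<alpha> \<beta>. Const \<alpha> * (a * a) + Const \<beta> * (a * b) \<in> W \<longrightarrow> \<alpha> = 0 \<and> \<beta> = 0)" (is ?thesis)
proof -
  have witness: ?thesis if "homogeneous 1 a" "homogeneous 1 b"
    "\<And>\<alpha> \<beta>. Const \<alpha> * (a * a) + Const \<beta> * (a * b) \<in> W \<Longrightarrow> \<alpha> = 0 \<and> \<beta> = 0" for a b
    using that by blast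
  have "\<exists>p. homogeneous 1 p \<and> p * p \<notin> W"
  proof (rule ccontr)
    assume "\<nexists>p. homogeneous 1 p \<and> p * p \<notin> W"
    then have "homs 2 \<subseteq> W" by (intro squares_span_quadrics[OF W]) auto
    then have "homs 2 \<subseteq> mp.span (W \<union> {})" using mp.span_superset[of W] by auto
    then show False using codim[of "{}"] by auto
  qed
  then obtain p where p: "homogeneous 1 p" "p * p \<notin> W" by blast
  have "\<exists>q. homogeneous 1 q \<and> q * q \<notin> mp.span (insert (p * p) W)"
  proof (rule ccontr)
    assume "\<nexists>q. homogeneous 1 q \<and> q * q \<notin> mp.span (insert (p * p) W)"
    then have "homs 2 \<subseteq> mp.span (insert (p * p) W)" by (intro squares_span_quadrics) auto
    then have "homs 2 \<subseteq> mp.span (W \<union> {p * p})" by simp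
    then show False using codim[of "{p * p}"] by simp
  qed
  then obtain q where q: "homogeneous 1 q" "q * q \<notin> mp.span (insert (p * p) W)" by blast
  have spW: "mp.span W = W" using mp.span_eq_iff W by blast
  have scale: "x \<in> W" if "Const c * x \<in> W" "c \<noteq> 0" for c x
  proof -
    have "Const (inverse c) * (Const c * x) \<in> W" by (rule mp.subspace_scale[OF W that(1)])
    then show ?thesis using that(2) by (simp add: mult.assoc[symmetric] Const_mult[symmetric])
  qed
  have pq: "\<alpha> = 0 \<and> \<beta> = 0" if "Const \<alpha> * (p * p) + Const \<beta> * (q * q) \<in> W" for \<alpha> \<beta>
  proof -
    have "\<beta> = 0"
    proof (rule ccontr)
      assume b: "\<beta> \<noteq> 0"
      have "Const \<beta> * (q * q) - (- Const \<alpha>) * (p * p) \<in> W" using that by (simp add: add.commute)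
      then have "Const \<beta> * (q * q) - (- Const \<alpha>) * (p * p) \<in> mp.span W" unfolding spW .
      then have "Const \<beta> * (q * q) \<in> mp.span (insert (p * p) W)"
        unfolding mp.span_insert Const_minus[symmetric] by blast
      then have "Const (inverse \<beta>) * (Const \<beta> * (q * q)) \<in> mp.span (insert (p * p) W)" by (rule mp.span_scale)
      then show False using q b by (simp add: mult.assoc[symmetric] Const_mult[symmetric])
    qed
    then show ?thesis using that p scale by auto
  qed
  show ?thesis
  proof (cases "\<exists>a b. (a, b) \<in> {(p, q), (q, p)} \<and>
      (\<forall>\<alpha> \<beta>. Const \<alpha> * (a * a) + Const \<beta> * (a * b) \<in> W \<longrightarrow> \<alpha> = 0 \<and> \<beta> = 0)")
    case True
    then show ?thesis using p(1) q(1) by blast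
  next
    case False
    have qW: "q * q \<notin> W" using q(2) mp.span_base[of "q * q" "insert (p * p) W"] by blast
    obtain \<alpha> \<beta> where 1: "Const \<alpha> * (p * p) + Const \<beta> * (p * q) \<in> W" "\<not> (\<alpha> = 0 \<and> \<beta> = 0)"
      using False by blast
    obtain \<gamma> \<delta> where 2: "Const \<gamma> * (q * q) + Const \<delta> * (q * p) \<in> W" "\<not> (\<gamma> = 0 \<and> \<delta> = 0)"
      using False by blast
    note 2 = 2[unfolded mult.commute[of q p]]
    have b0: "\<beta> \<noteq> 0" using 1 p(2) scale by auto
    have d0: "\<delta> \<noteq> 0" using 2 qW scale by auto
    have "Const \<delta> * (Const \<alpha> * (p * p) + Const \<beta> * (p * q))
        - Const \<beta> * (Const \<gamma> * (q * q) + Const \<delta> * (p * q)) \<in> W"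
      by (intro mp.subspace_diff[OF W] mp.subspace_scale[OF W] 1 2)
    also have "Const \<delta> * (Const \<alpha> * (p * p) + Const \<beta> * (p * q))
        - Const \<beta> * (Const \<gamma> * (q * q) + Const \<delta> * (p * q))
        = Const (\<delta> * \<alpha>) * (p * p) + Const (- (\<beta> * \<gamma>)) * (q * q)"
      by (simp add: Const_mult Const_minus algebra_simps)
    finally have "\<gamma> = 0" using pq[of "\<delta> * \<alpha>" "- (\<beta> * \<gamma>)"] b0 by simp
    then have pqW: "p * q \<in> W" using 2 scale by auto
    show ?thesis
    proof (rule witness)
      show "homogeneous 1 (p + q)" using p q homogeneous_add by blast
      show "homogeneous 1 q" by (rule q(1))
      fix \<alpha> \<beta> assume W1: "Const \<alpha> * ((p + q) * (p + q)) + Const \<beta> * ((p + q) * q) \<in> W"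
      have W2: "Const (\<alpha> + \<alpha> + \<beta>) * (p * q) \<in> W" by (rule mp.subspace_scale[OF W pqW])
      have "Const \<alpha> * ((p + q) * (p + q)) + Const \<beta> * ((p + q) * q) - Const (\<alpha> + \<alpha> + \<beta>) * (p * q)
          = Const \<alpha> * (p * p) + Const (\<alpha> + \<beta>) * (q * q)"
        unfolding Const_add by (simp add: algebra_simps)
      then have "Const \<alpha> * (p * p) + Const (\<alpha> + \<beta>) * (q * q) \<in> W"
        using mp.subspace_diff[OF W W1 W2] by simp
      then show "\<alpha> = 0 \<and> \<beta> = 0" using pq by force
    qed
  qed
qed

section \<open>Coordinates adapted to a Lefschetz element\<close>

text \<open>
  The coordinate change is the inverse of a substitution \<open>h\<close> with \<open>x\<^sub>4 \<mapsto> l\<close>, \<open>x\<^sub>3 \<mapsto> a\<close>, \<open>x\<^sub>2 \<mapsto> b\<close>, where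
  \<open>a\<^sup>2\<close>, \<open>ab\<close> are independent modulo \<open>I\<close> and the multiples of \<open>l\<close>. The standard monomials
  are as many as the rank in each degree, so it suffices that \<open>h\<close> maps them to forms
  independent modulo \<open>I\<close>: in degree 2 to \<open>l\<close> times the four images of the variables, \<open>a\<^sup>2\<close> and
  \<open>ab\<close>, in degree 3 to \<open>l\<^sup>2\<close> times the images of the variables, in degree 4 to \<open>l\<^sup>4\<close>.
\<close>

lemma lefschetz_element_segment_coordinates:
  fixes B :: "(4, 'k::field_char_0) mpol set" and l :: "(4, 'k) mpol"
  defines "I \<equiv> ideal_gen B"
  assumes rank: "mp.rank_mod I (homs 2) 6" "mp.rank_mod I (homs 3) 4" "mp.rank_mod I (homs 4) 1"
      "mp.rank_mod I (homs 5) 0"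
    and l: "homogeneous 1 l"
    and inj: "\<And>p. homogeneous 1 p \<Longrightarrow> l ^ 2 * p \<in> I \<Longrightarrow> p = 0"
    and l4: "l ^ 4 \<notin> I"
  obtains g where "invertible g" "segment_spans (change_coords g ` I)"
proof -
  have spI: "mp.span I = I" unfolding I_def by simp
  have I_mult: "x * y \<in> I" if "y \<in> I" for x y using that unfolding I_def by (rule ideal_gen_mult)
  have I_add: "x + y \<in> I" if "x \<in> I" "y \<in> I" for x y using that unfolding I_def by (rule ideal_gen_add)
  have inj1: "p = 0" if "homogeneous 1 p" "l * p \<in> I" for p
    using inj[OF that(1)] I_mult[OF that(2), of l] by (simp add: power2_eq_square mult.assoc)
  have l0: "l \<noteq> 0" using l4 by (auto simp: I_def)
  define W where "W = mp.span (I \<union> (*) l ` homs 1)"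
  have W: "mp.subspace W" unfolding W_def by (rule mp.subspace_span)
  have WE: "\<exists>p. homogeneous 1 p \<and> x - l * p \<in> I" if x: "x \<in> W" for x
  proof -
    obtain i y where iy: "x = i + y" "i \<in> I" "y \<in> mp.span ((*) l ` homs 1)"
      using x spI unfolding W_def by (auto simp: mp.span_Un)
    have "mp.subspace ((*) l ` homs 1)"
      unfolding mp.subspace_def
    proof (intro conjI ballI allI)
      show "0 \<in> (*) l ` homs 1" by (rule image_eqI[of _ _ 0]) auto
      fix x y assume "x \<in> (*) l ` homs 1" "y \<in> (*) l ` homs 1"
      then obtain p q where "x = l * p" "y = l * q" "homogeneous 1 p" "homogeneous 1 q" by auto
      then show "x + y \<in> (*) l ` homs 1"
        by (intro image_eqI[of _ _ "p + q"]) (auto simp: distrib_left intro: homogeneous_add)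
    next
      fix c x assume "x \<in> (*) l ` homs 1"
      then obtain p where "x = l * p" "homogeneous 1 p" by auto
      then show "Const c * x \<in> (*) l ` homs 1"
        by (intro image_eqI[of _ _ "Const c * p"]) (auto simp: mult.left_commute intro: homogeneous_Const_mult)
    qed
    then have "y \<in> (*) l ` homs 1" using iy(3) mp.span_eq_iff by blast
    then show ?thesis using iy by auto
  qed
  \<comment> \<open>modulo I, the multiples of l contribute at most 4 to the rank 6\<close>
  have codim: "2 \<le> card C" if C: "finite C" "homs 2 \<subseteq> mp.span (W \<union> C)" for C
  proof -
    let ?X = "(\<lambda>j. l * Var j) ` (UNIV :: 4 set)"
    have "W \<subseteq> mp.span (I \<union> ?X)"
      unfolding W_def
    proof (intro mp.span_minimal mp.subspace_span Un_least)
      show "I \<subseteq> mp.span (I \<union> ?X)" using mp.span_superset by blast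
      show "(*) l ` homs 1 \<subseteq> mp.span (I \<union> ?X)"
      proof clarify
        fix p :: "(4, 'k) mpol" assume "homogeneous 1 p"
        then have "l * p = l * (\<Sum>j\<in>UNIV. Const (lookup p (single j 1)) * Var j)"
          by (intro arg_cong[of _ _ "(*) l"] linear_form_expand)
        also have "\<dots> = (\<Sum>j\<in>UNIV. Const (lookup p (single j 1)) * (l * Var j))"
          by (simp add: sum_distrib_left mult.left_commute)
        also have "\<dots> \<in> mp.span (I \<union> ?X)"
          by (rule mp.span_sum, rule mp.span_scale, rule mp.span_base) auto
        finally show "l * p \<in> mp.span (I \<union> ?X)" .
      qed
    qed
    also have "\<dots> \<subseteq> mp.span (I \<union> (?X \<union> C))" by (rule mp.span_mono) auto
    finally have "W \<union> C \<subseteq> mp.span (I \<union> (?X \<union> C))"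
      using mp.span_superset[of "I \<union> (?X \<union> C)"] by blast
    then have "mp.span (W \<union> C) \<subseteq> mp.span (I \<union> (?X \<union> C))" by (intro mp.span_minimal mp.subspace_span)
    with C have "homs 2 \<subseteq> mp.span (I \<union> (?X \<union> C))" by blast
    then have "6 \<le> card (?X \<union> C)" using C(1) by (intro mp.rank_mod_spanning_card[OF rank(1)]) auto
    moreover have "card ?X \<le> 4" using card_image_le[of "UNIV :: 4 set" "\<lambda>j. l * Var j"] by simp
    ultimately show ?thesis using card_Un_le[of ?X C] by linarith
  qed
  obtain a b where ab: "homogeneous 1 a" "homogeneous 1 b"
    "\<And>\<alpha> \<beta>. Const \<alpha> * (a * a) + Const \<beta> * (a * b) \<in> W \<Longrightarrow> \<alpha> = 0 \<and> \<beta> = 0"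
    using exists_square_and_product_independent[of W, OF W] codim by blast
  have ab_mod: "\<alpha> = 0 \<and> \<beta> = 0 \<and> p = 0"
    if "homogeneous 1 p" "Const \<alpha> * (a * a) + Const \<beta> * (a * b) + l * p \<in> I" for \<alpha> \<beta> p
  proof -
    have "(Const \<alpha> * (a * a) + Const \<beta> * (a * b) + l * p) - l * p \<in> W"
      using that unfolding W_def by (intro mp.span_diff mp.span_base) auto
    then have "\<alpha> = 0 \<and> \<beta> = 0" using ab(3)[of \<alpha> \<beta>] by simp
    then show ?thesis using that inj1 by simp
  qed
  \<comment> \<open>multiplying a relation between a, b, l by a moves its last term into W\<close>
  have abl: "\<alpha> = 0 \<and> \<beta> = 0 \<and> \<gamma> = 0" if 0: "Const \<alpha> * a + Const \<beta> * b + Const \<gamma> * l = 0" for \<alpha> \<beta> \<gamma>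
  proof -
    have "a * (Const \<alpha> * a + Const \<beta> * b + Const \<gamma> * l)
        = Const \<alpha> * (a * a) + Const \<beta> * (a * b) + l * (Const \<gamma> * a)" by (simp add: algebra_simps)
    then have "Const \<alpha> * (a * a) + Const \<beta> * (a * b) + l * (Const \<gamma> * a) \<in> I" using 0 by (simp add: I_def)
    from ab_mod[OF homogeneous_Const_mult[OF ab(1)] this] have "\<alpha> = 0" "\<beta> = 0" by auto
    with 0 have "Const \<gamma> * l = 0" by simp
    then show ?thesis using l0 \<open>\<alpha> = 0\<close> \<open>\<beta> = 0\<close> by (simp add: Const_eq_0_iff)
  qed
  have "\<exists>j. Var j \<notin> mp.span {a, b, l}"
  proof (rule ccontr)
    assume "\<nexists>j. Var j \<notin> mp.span {a, b, l}"
    then have "Var ` UNIV \<subseteq> mp.span ({} \<union> set [a, b, l])" by auto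
    moreover have eq: "Var ` UNIV = (mon ` range (\<lambda>j :: 4. single j 1) :: (4, 'k) mpol set)"
      by (auto simp: Var_def)
    have "mp.indep_mod {} (Var ` UNIV :: (4, 'k) mpol set)" unfolding eq by (rule indep_mon) simp
    ultimately have "card (Var ` UNIV :: (4, 'k) mpol set) \<le> card (set [a, b, l])"
      using mp.indep_mod_card_le[of "set [a, b, l]" _ "{}"] by blast
    also have "\<dots> \<le> 3" using card_length[of "[a, b, l]"] by simp
    finally have "card (Var ` UNIV :: (4, 'k) mpol set) \<le> 3" .
    moreover have "inj (\<lambda>j :: 4. (Var j :: (4, 'k) mpol))"
      by (rule injI) (metis Var_def keys_single insert_iff empty_iff one_neq_zero zero_neq_one)
    then have "card (Var ` UNIV :: (4, 'k) mpol set) = 4" by (simp add: card_image)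
    ultimately show False by simp
  qed
  then obtain j where j: "Var j \<notin> mp.span {a, b, l}" by blast
  define r where "r i = (if i = 0 then Var j else if i = 1 then b else if i = 2 then a else l)" for i :: 4
  have r: "r 0 = Var j" "r 1 = b" "r 2 = a" "r 3 = l" by (simp_all add: r_def)
  have hr: "homogeneous 1 (r i)" for i using ab l homogeneous_Var by (auto simp: r_def)
  have ind: "c i = 0" if 0: "(\<Sum>i\<in>UNIV. Const (c i) * r i) = 0" for c i
  proof -
    have s: "Const (c 0) * Var j + (Const (c 2) * a + Const (c 1) * b + Const (c 3) * l) = 0"
      using 0 by (simp add: sum_four r algebra_simps)
    have "c 0 = 0"
    proof (rule ccontr)
      assume c0: "c 0 \<noteq> 0"
      have "- (Const (c 2) * a + Const (c 1) * b + Const (c 3) * l) \<in> mp.span {a, b, l}"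
        by (intro mp.span_neg mp.span_add mp.span_scale mp.span_base) auto
      then have "Const (c 0) * Var j \<in> mp.span {a, b, l}"
        using s by (simp add: eq_neg_iff_add_eq_0[symmetric])
      then have "Const (inverse (c 0)) * (Const (c 0) * Var j) \<in> mp.span {a, b, l}" by (rule mp.span_scale)
      then show False using j c0 by (simp add: mult.assoc[symmetric] Const_mult[symmetric])
    qed
    moreover have "c 2 = 0 \<and> c 1 = 0 \<and> c 3 = 0" using abl s \<open>c 0 = 0\<close> by simp
    ultimately have "\<forall>i. c i = 0" by (simp add: all_four)
    then show ?thesis ..
  qed
  have "\<exists>h. invertible h \<and> (\<forall>i. change_coords h (Var i) = r i)"
    by (rule independent_linear_forms_substitution) (rule hr, erule ind)
  then obtain h where h: "invertible h" "\<And>i. change_coords h (Var i) = r i" by blast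
  have hm: "change_coords h (mon (monom4 e0 e1 e2 e3)) = r 0 ^ e0 * r 1 ^ e1 * r 2 ^ e2 * r 3 ^ e3" for e0 e1 e2 e3
    by (simp add: mon_monom4 change_coords_mult change_coords_power h(2))
  have key: "homs t \<subseteq> mp.span (I \<union> change_coords h ` standard_of_degree t)" if t: "t \<in> {2..5}" for t
  proof -
    let ?A = "{m. standard m \<and> mdeg m = t}"
    let ?v = "\<lambda>m. change_coords h (mon m)"
    have finA: "finite ?A" by (rule finite_subset[OF _ finite_mdeg, of _ t]) auto
    have sub: "?v ` ?A \<subseteq> homs t" by (auto intro!: homogeneous_change_coords)
    have img: "?v ` ?A = change_coords h ` standard_of_degree t" by (simp add: image_image)
    have spans: "homs t \<subseteq> mp.span (I \<union> change_coords h ` standard_of_degree t)"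
      if "mp.rank_mod I (homs t) n" "n \<le> card ?A"
        "\<And>c m. (\<Sum>m\<in>?A. Const (c m) * ?v m) \<in> I \<Longrightarrow> m \<in> ?A \<Longrightarrow> c m = 0" for n
      unfolding img[symmetric]
      by (rule mp.rank_mod_indep_family_spans[OF that(1) finA that(2) sub]) (use that(3) in \<open>simp only: spI\<close>)
    consider "t = 2" | "t = 3" | "t = 4" | "t = 5" using t by fastforce
    then show ?thesis
    proof cases
      case 1
      show ?thesis
      proof (rule spans)
        show "mp.rank_mod I (homs t) 6" "6 \<le> card ?A" using rank 1 card_standard by auto
        fix c m assume s: "(\<Sum>m\<in>?A. Const (c m) * ?v m) \<in> I" and m: "m \<in> ?A"
        define p where "p = (\<Sum>i\<in>UNIV. Const (if i = 0 then c (monom4 1 0 0 1) else if i = 1 then c (monom4 0 1 0 1)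
            else if i = 2 then c (monom4 0 0 1 1) else c (monom4 0 0 0 2)) * r i)"
        have hp: "homogeneous 1 p" unfolding p_def by (intro homogeneous_sum homogeneous_Const_mult hr)
        have "(\<Sum>m\<in>?A. Const (c m) * ?v m) = Const (c (monom4 0 0 2 0)) * (a * a) + Const (c (monom4 0 1 1 0)) * (a * b) + l * p"
          unfolding 1 standard_degree_2 p_def
          by (simp add: monom4_inject hm r sum_four power2_eq_square algebra_simps)
        from ab_mod[OF hp s[unfolded this]]
        have z: "c (monom4 0 0 2 0) = 0" "c (monom4 0 1 1 0) = 0" "p = 0" by auto
        have i: "(if i = 0 then c (monom4 1 0 0 1) else if i = 1 then c (monom4 0 1 0 1)
            else if i = 2 then c (monom4 0 0 1 1) else c (monom4 0 0 0 2)) = 0" for i :: 4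
          using z(3) unfolding p_def by (rule ind)
        show "c m = 0" using m z(1,2) i[of 0] i[of 1] i[of 2] i[of 3] unfolding 1 standard_degree_2 by auto
      qed
    next
      case 2
      show ?thesis
      proof (rule spans)
        show "mp.rank_mod I (homs t) 4" "4 \<le> card ?A" using rank 2 card_standard by auto
        fix c m assume s: "(\<Sum>m\<in>?A. Const (c m) * ?v m) \<in> I" and m: "m \<in> ?A"
        define p where "p = (\<Sum>i\<in>UNIV. Const (if i = 0 then c (monom4 1 0 0 2) else if i = 1 then c (monom4 0 1 0 2)
            else if i = 2 then c (monom4 0 0 1 2) else c (monom4 0 0 0 3)) * r i)"
        have hp: "homogeneous 1 p" unfolding p_def by (intro homogeneous_sum homogeneous_Const_mult hr)
        have "(\<Sum>m\<in>?A. Const (c m) * ?v m) = l ^ 2 * p"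
          unfolding 2 standard_degree_3 p_def
          by (simp add: monom4_inject hm r sum_four power2_eq_square power3_eq_cube algebra_simps)
        then have "p = 0" using s inj[OF hp] by simp
        then have i: "(if i = 0 then c (monom4 1 0 0 2) else if i = 1 then c (monom4 0 1 0 2)
            else if i = 2 then c (monom4 0 0 1 2) else c (monom4 0 0 0 3)) = 0" for i :: 4
          unfolding p_def by (rule ind)
        show "c m = 0" using m i[of 0] i[of 1] i[of 2] i[of 3] unfolding 2 standard_degree_3 by auto
      qed
    next
      case 3
      show ?thesis
      proof (rule spans)
        show "mp.rank_mod I (homs t) 1" "1 \<le> card ?A" using rank 3 card_standard by auto
        fix c m assume s: "(\<Sum>m\<in>?A. Const (c m) * ?v m) \<in> I" and m: "m \<in> ?A"
        have s4: "Const (c (monom4 0 0 0 4)) * l ^ 4 \<in> I"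
          using s unfolding 3 standard_degree_4 by (simp add: hm r)
        have "c (monom4 0 0 0 4) = 0"
        proof (rule ccontr)
          assume n: "c (monom4 0 0 0 4) \<noteq> 0"
          have "Const (inverse (c (monom4 0 0 0 4))) * (Const (c (monom4 0 0 0 4)) * l ^ 4) \<in> I"
            using s4 by (rule I_mult)
          then show False using l4 n by (simp add: mult.assoc[symmetric] Const_mult[symmetric])
        qed
        then show "c m = 0" using m unfolding 3 standard_degree_4 by simp
      qed
    next
      case 4
      show ?thesis
      proof (rule spans)
        show "mp.rank_mod I (homs t) 0" "0 \<le> card ?A" using rank 4 by auto
      qed (use 4 in \<open>auto simp: standard_def\<close>)
    qed
  qed
  obtain g where g: "h ** g = mat 1" "g ** h = mat 1" using h(1) by (auto simp: invertible_def)
  have "segment_spans (change_coords g ` I)"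
    unfolding segment_spans_def
  proof (intro ballI subsetI)
    fix t and p :: "(4, 'k) mpol" assume t: "t \<in> {2..5}" and p: "p \<in> homs t"
    have "change_coords h p \<in> homs t" using p homogeneous_change_coords by auto
    then have "change_coords h p \<in> mp.span (I \<union> change_coords h ` standard_of_degree t)" using key[OF t] by blast
    then have "change_coords g (change_coords h p)
        \<in> mp.span (change_coords g ` (I \<union> change_coords h ` standard_of_degree t))"
      by (rule change_coords_span)
    then show "p \<in> mp.span (change_coords g ` I \<union> standard_of_degree t)"
      by (simp add: image_Un image_image change_coords_inverse[OF g(1)])
  qed
  moreover have "invertible g" using g by (auto simp: invertible_def)
  ultimately show thesis using that by blast
qed

section \<open>Four quadrics with the strong Lefschetz property\<close>

text \<open>
  The Hilbert function in degrees 0 to 5 of the quotient by the ideal generated by \<open>B\<close>.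
\<close>

definition hilbert_values :: "(4, 'k::field) mpol set \<Rightarrow> nat \<Rightarrow> nat \<Rightarrow> nat \<Rightarrow> nat \<Rightarrow> nat \<Rightarrow> nat \<Rightarrow> bool" where
  "hilbert_values B h0 h1 h2 h3 h4 h5 \<longleftrightarrow>
     mp.rank_mod (ideal_gen B) (homs 0) h0 \<and> mp.rank_mod (ideal_gen B) (homs 1) h1 \<and>
     mp.rank_mod (ideal_gen B) (homs 2) h2 \<and> mp.rank_mod (ideal_gen B) (homs 3) h3 \<and>
     mp.rank_mod (ideal_gen B) (homs 4) h4 \<and> mp.rank_mod (ideal_gen B) (homs 5) h5"

lemma hilbert_values_empty: "hilbert_values ({} :: (4, 'k::field) mpol set) 1 4 10 20 35 56"
proof -
  have "mp.rank_mod (ideal_gen {}) (homs t :: (4, 'k) mpol set) (card {m :: 4 monom. mdeg m = t})" for t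
    by (rule rank_mod_below_generators[of _ "Suc t"]) (auto intro: rank_mod_homs)
  from this[of 0] this[of 1] this[of 2] this[of 3] this[of 4] this[of 5]
  show ?thesis unfolding hilbert_values_def card_monomials_values by (intro conjI)
qed

lemma hilbert_values_regular_quadric:
  fixes B :: "(4, 'k::field) mpol set"
  assumes hom: "\<And>b. b \<in> insert f B \<Longrightarrow> homogeneous 2 b"
    and reg: "\<And>h. f * h \<in> ideal_gen B \<Longrightarrow> h \<in> ideal_gen B"
    and hv: "hilbert_values B 1 4 c d e k"
  shows "hilbert_values (insert f B) 1 4 (c - 1) (d - 4) (e - c) (k - d)"
proof -
  let ?R = "\<lambda>B t n. mp.rank_mod (ideal_gen B) (homs t :: (4, 'k) mpol set) n"
  have B: "?R B 0 1" "?R B 1 4" "?R B 2 c" "?R B 3 d" "?R B 4 e" "?R B 5 k"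
    using hv unfolding hilbert_values_def by blast+
  have step: "?R (insert f B) t' (n - m)" if "?R B t' n" "?R B t m" "t' = 2 + t" for n m t t'
    unfolding that(3) by (rule rank_mod_regular_step[OF _ _ reg that(1)[unfolded that(3)] that(2)]) (use hom in auto)
  have low: "?R (insert f B) t (card {m :: 4 monom. mdeg m = t})" if "t < 2" for t
    by (rule rank_mod_below_generators[OF hom that]) (auto intro: rank_mod_homs)
  have "?R (insert f B) 0 1" "?R (insert f B) 1 4"
    using low[of 0] low[of 1] unfolding card_monomials_values by simp_all
  moreover have "?R (insert f B) 2 (c - 1)" "?R (insert f B) 3 (d - 4)" "?R (insert f B) 4 (e - c)"
      "?R (insert f B) 5 (k - d)"
    by (rule step[OF B(3,1)] step[OF B(4,2)] step[OF B(5,3)] step[OF B(6,4)], simp)+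
  ultimately show ?thesis unfolding hilbert_values_def by blast
qed

text \<open>
  Each quadric of the sequence replaces the Hilbert function \<open>H(t)\<close> by \<open>H(t) - H(t - 2)\<close>, starting from
  1, 4, 10, 20, 35, 56.
\<close>

lemma complete_intersection_hilbert_values:
  fixes f1 f2 f3 f4 :: "(4, 'k::field) mpol"
  assumes hom: "\<And>b. b \<in> {f1, f2, f3, f4} \<Longrightarrow> homogeneous 2 b"
    and reg: "regular_sequence [f1, f2, f3, f4]"
  shows "hilbert_values {f1, f2, f3, f4} 1 4 6 4 1 0"
proof -
  have r: "\<forall>i<4. \<forall>h. [f1, f2, f3, f4] ! i * h \<in> ideal_gen (set (take i [f1, f2, f3, f4])) \<longrightarrow>
      h \<in> ideal_gen (set (take i [f1, f2, f3, f4]))" using reg by (simp add: regular_sequence_def)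
  have reg1: "f1 * h \<in> ideal_gen {} \<Longrightarrow> h \<in> ideal_gen {}" for h using r[rule_format, of 0 h] by simp
  have reg2: "f2 * h \<in> ideal_gen {f1} \<Longrightarrow> h \<in> ideal_gen {f1}" for h using r[rule_format, of 1 h] by simp
  have reg3: "f3 * h \<in> ideal_gen {f2, f1} \<Longrightarrow> h \<in> ideal_gen {f2, f1}" for h
    using r[rule_format, of 2 h] by (simp add: insert_commute)
  have reg4: "f4 * h \<in> ideal_gen {f3, f2, f1} \<Longrightarrow> h \<in> ideal_gen {f3, f2, f1}" for h
    using r[rule_format, of 3 h] by (simp add: insert_commute)
  have "hilbert_values {f1} 1 4 (10 - 1) (20 - 4) (35 - 10) (56 - 20)"
    by (rule hilbert_values_regular_quadric[OF _ reg1 hilbert_values_empty]) (use hom in auto)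
  then have h1: "hilbert_values {f1} 1 4 9 16 25 36" by simp
  have "hilbert_values {f2, f1} 1 4 (9 - 1) (16 - 4) (25 - 9) (36 - 16)"
    by (rule hilbert_values_regular_quadric[OF _ reg2 h1]) (use hom in auto)
  then have h2: "hilbert_values {f2, f1} 1 4 8 12 16 20" by simp
  have "hilbert_values {f3, f2, f1} 1 4 (8 - 1) (12 - 4) (16 - 8) (20 - 12)"
    by (rule hilbert_values_regular_quadric[OF _ reg3 h2]) (use hom in auto)
  then have h3: "hilbert_values {f3, f2, f1} 1 4 7 8 8 8" by simp
  have "hilbert_values {f4, f3, f2, f1} 1 4 (7 - 1) (8 - 4) (8 - 7) (8 - 8)"
    by (rule hilbert_values_regular_quadric[OF _ reg4 h3]) (use hom in auto)
  then have "hilbert_values {f4, f3, f2, f1} 1 4 6 4 1 0" by simp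
  moreover have "{f4, f3, f2, f1} = {f1, f2, f3, f4}" by auto
  ultimately show ?thesis by simp
qed

lemma complete_intersection_ranks:
  fixes f1 f2 f3 f4 :: "(4, 'k::field) mpol"
  defines "I \<equiv> ideal_gen {f1, f2, f3, f4}"
  assumes hom: "\<And>b. b \<in> {f1, f2, f3, f4} \<Longrightarrow> homogeneous 2 b"
    and reg: "regular_sequence [f1, f2, f3, f4]"
  shows "mp.rank_mod I (homs 2) 6" "mp.rank_mod I (homs 3) 4" "mp.rank_mod I (homs 4) 1"
    "mp.rank_mod I (homs 5) 0"
  using complete_intersection_hilbert_values[OF hom reg] unfolding hilbert_values_def I_def by blast+

lemma residue_class_eq_iff: "residue_class (ideal_gen B) p = residue_class (ideal_gen B) q \<longleftrightarrow> p - q \<in> ideal_gen B"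
proof
  assume "residue_class (ideal_gen B) p = residue_class (ideal_gen B) q"
  moreover have "p \<in> residue_class (ideal_gen B) p" by (simp add: residue_class_def)
  ultimately show "p - q \<in> ideal_gen B" by (auto simp: residue_class_def)
next
  assume pq: "p - q \<in> ideal_gen B"
  have "x - p \<in> ideal_gen B \<longleftrightarrow> x - q \<in> ideal_gen B" for x
    using ideal_gen_add[OF _ pq, of "x - p"] ideal_gen_diff[OF _ pq, of "x - q"] by (auto simp: algebra_simps)
  then show "residue_class (ideal_gen B) p = residue_class (ideal_gen B) q" by (simp add: residue_class_def)
qed

lemma mult_class_residue_class:
  "mult_class (ideal_gen B) f (residue_class (ideal_gen B) p) = residue_class (ideal_gen B) (f * p)"
proof -
  have "residue_class (ideal_gen B) (f * q) = residue_class (ideal_gen B) (f * p)"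
    if "q \<in> residue_class (ideal_gen B) p" for q
    using that ideal_gen_mult[of "q - p" B f] unfolding residue_class_eq_iff
    by (simp add: residue_class_def right_diff_distrib)
  moreover have "p \<in> residue_class (ideal_gen B) p" by (simp add: residue_class_def)
  ultimately show ?thesis unfolding mult_class_def by blast
qed

text \<open>
  Injectivity and surjectivity on residue classes, in terms of representatives.
\<close>

lemma semiregular_cases:
  assumes "semiregular (ideal_gen B) s f"
  obtains "\<And>p. homogeneous t p \<Longrightarrow> f * p \<in> ideal_gen B \<Longrightarrow> p \<in> ideal_gen B"
  | "\<And>q. homogeneous (t + s) q \<Longrightarrow> \<exists>p. homogeneous t p \<and> q - f * p \<in> ideal_gen B"
proof -
  let ?I = "ideal_gen B"
  consider "inj_on (mult_class ?I f) (graded_piece ?I t)"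
    | "mult_class ?I f ` graded_piece ?I t = graded_piece ?I (t + s)"
    using assms unfolding semiregular_def by blast
  then show thesis
  proof cases
    case 1
    have "p \<in> ?I" if p: "homogeneous t p" "f * p \<in> ?I" for p
    proof -
      have "mult_class ?I f (residue_class ?I p) = mult_class ?I f (residue_class ?I 0)"
        using p by (simp add: mult_class_residue_class residue_class_eq_iff)
      then have "residue_class ?I p = residue_class ?I 0"
        by (rule inj_onD[OF 1]) (use p in \<open>auto simp: graded_piece_def\<close>)
      then show ?thesis by (simp add: residue_class_eq_iff)
    qed
    then show ?thesis by (rule that(1))
  next
    case 2
    have "\<exists>p. homogeneous t p \<and> q - f * p \<in> ?I" if q: "homogeneous (t + s) q" for q
    proof -
      have "residue_class ?I q \<in> mult_class ?I f ` graded_piece ?I t"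
        unfolding 2 using q by (auto simp: graded_piece_def)
      then obtain p where "homogeneous t p" "residue_class ?I q = residue_class ?I (f * p)"
        by (auto simp: graded_piece_def mult_class_residue_class)
      then show ?thesis by (auto simp: residue_class_eq_iff)
    qed
    then show ?thesis by (rule that(2))
  qed
qed

text \<open>
  The graded pieces of degrees 1 and 3 have the same dimension 4, and those of degrees 0 and 4 the same
  dimension 1. So \<open>l\<^sup>2\<close> and \<open>l\<^sup>4\<close> act injectively there, whichever alternative semiregularity provides.
\<close>

lemma strong_Lefschetz_segment_coordinates:
  fixes f1 f2 f3 f4 :: "(4, 'k::field_char_0) mpol"
  defines "B \<equiv> {f1, f2, f3, f4}"
  assumes hom: "\<And>b. b \<in> B \<Longrightarrow> homogeneous 2 b"
    and reg: "regular_sequence [f1, f2, f3, f4]"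
    and slp: "strong_Lefschetz (ideal_gen B)"
  shows "\<exists>g. invertible g \<and> segment_spans (change_coords g ` ideal_gen B)"
proof -
  let ?I = "ideal_gen B"
  have "b \<in> {f1, f2, f3, f4} \<Longrightarrow> homogeneous 2 b" for b using hom by (simp add: B_def)
  note rank = complete_intersection_ranks[OF this reg, folded B_def]
  obtain l where l: "homogeneous 1 l" "\<And>b. b \<ge> 1 \<Longrightarrow> semiregular ?I b (l ^ b)"
    using slp unfolding strong_Lefschetz_def by blast
  have low: "p = 0" if "p \<in> ?I" "homogeneous t p" "t < 2" for p t
    using hcomp_ideal_gen(2)[OF hom that(1,3)] hcomp_homogeneous[OF that(2), of t] by simp
  have inj: "p = 0" if p: "homogeneous 1 p" "l ^ 2 * p \<in> ?I" for p
  proof -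
    have "semiregular ?I 2 (l ^ 2)" using l(2)[of 2] by simp
    then show ?thesis
    proof (cases rule: semiregular_cases[where t = 1])
      case 1
      then show ?thesis using p low[of p 1] by auto
    next
      case 2
      let ?v = "\<lambda>j :: 4. l ^ 2 * Var j"
      have expand: "l ^ 2 * q = (\<Sum>j\<in>UNIV. Const (lookup q (single j 1)) * ?v j)"
        if "homogeneous 1 q" for q
      proof -
        have "l ^ 2 * q = l ^ 2 * (\<Sum>j\<in>UNIV. Const (lookup q (single j 1)) * Var j)"
          by (intro arg_cong[of _ _ "(*) (l ^ 2)"] linear_form_expand that)
        then show ?thesis by (simp only: sum_distrib_left mult.left_commute)
      qed
      have sp: "homs 3 \<subseteq> mp.span (?I \<union> range ?v)"
      proof
        fix q :: "(4, 'k) mpol" assume "q \<in> homs 3"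
        then have "homogeneous (1 + 2) q" by (simp add: numeral_3_eq_3)
        from 2[OF this] obtain p where p: "homogeneous 1 p" "q - l ^ 2 * p \<in> ?I" by blast
        have "l ^ 2 * p \<in> mp.span (?I \<union> range ?v)"
          unfolding expand[OF p(1)] by (rule mp.span_sum, rule mp.span_scale, rule mp.span_base) blast
        moreover have "q - l ^ 2 * p \<in> mp.span (?I \<union> range ?v)" using p(2) by (intro mp.span_base) simp
        ultimately have "(q - l ^ 2 * p) + l ^ 2 * p \<in> mp.span (?I \<union> range ?v)" by (intro mp.span_add)
        then show "q \<in> mp.span (?I \<union> range ?v)" by simp
      qed
      have "lookup p (single j 1) = 0" for j
      proof (rule mp.rank_mod_spanning_family_sum_zero[OF rank(2) finite_class.finite_UNIV _ sp])
        show "(\<Sum>j\<in>UNIV. Const (lookup p (single j 1)) * ?v j) \<in> mp.span ?I"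
          using p(2) unfolding expand[OF p(1)] span_ideal_gen .
      qed simp_all
      then show ?thesis using linear_form_expand[OF p(1)] by simp
    qed
  qed
  have l4: "l ^ 4 \<notin> ?I"
  proof
    assume l4: "l ^ 4 \<in> ?I"
    have "semiregular ?I 4 (l ^ 4)" using l(2)[of 4] by simp
    then show False
    proof (cases rule: semiregular_cases[where t = 0])
      case 1
      then have "1 \<in> ?I" using l4 homogeneous_one by force
      then show False using low[of 1 0] homogeneous_one by force
    next
      case 2
      have "homs 4 \<subseteq> mp.span (?I \<union> {})"
      proof
        fix q :: "(4, 'k) mpol" assume "q \<in> homs 4"
        then have "homogeneous (0 + 4) q" by simp
        from 2[OF this] obtain p where p: "q - l ^ 4 * p \<in> ?I" by blast
        have "(q - l ^ 4 * p) + p * l ^ 4 \<in> ?I" using p l4 by (intro ideal_gen_add ideal_gen_mult)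
        then have "q \<in> ?I" by (simp add: mult.commute)
        then show "q \<in> mp.span (?I \<union> {})" using mp.span_base by simp
      qed
      then have "1 \<le> card ({} :: (4, 'k) mpol set)"
        by (intro mp.rank_mod_spanning_card[OF rank(3)]) auto
      then show False by simp
    qed
  qed
  show ?thesis
    using lefschetz_element_segment_coordinates[OF rank l(1) inj l4] by blast
qed

section \<open>Openness of the segment property\<close>

text \<open>
  In degree \<open>t\<close>, the products of the \<open>h i w\<close> with monomials and the standard monomials are
  families to which \<open>spanning_open\<close> applies.
\<close>

lemma segment_spans_open:
  fixes h :: "'j \<Rightarrow> 'w \<Rightarrow> (4, 'k::field) mpol"
  assumes A: "finite A" and pf: "\<And>i. i \<in> A \<Longrightarrow> poly_family c (h i)"
    and hom: "\<And>i w. i \<in> A \<Longrightarrow> w \<in> W \<Longrightarrow> homogeneous 2 (h i w)"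
    and w0: "w0 \<in> W" "segment_spans (ideal_gen ((\<lambda>i. h i w0) ` A))"
  shows "\<exists>F. poly_fun c F \<and> F w0 \<noteq> 0 \<and>
    (\<forall>w\<in>W. F w \<noteq> 0 \<longrightarrow> segment_spans (ideal_gen ((\<lambda>i. h i w) ` A)))"
proof -
  let ?I = "\<lambda>w. ideal_gen ((\<lambda>i. h i w) ` A)"
  let ?P = "\<lambda>t F. poly_fun c F \<and> F w0 \<noteq> 0 \<and>
    (\<forall>w\<in>W. F w \<noteq> 0 \<longrightarrow> homs t \<subseteq> mp.span (?I w \<union> standard_of_degree t))"
  have ex: "\<exists>F. ?P t F" if t: "t \<in> {2..5}" for t
  proof -
    define s where "s = t - 2"
    let ?t = "2 + s"
    have ts: "t = ?t" and s: "?t \<in> {2..5}" using t by (auto simp: s_def)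
    let ?S = "{m. standard m \<and> mdeg m = ?t}"
    define K where "K = Inl ` (A \<times> {m :: 4 monom. mdeg m = s}) \<union> Inr ` ?S"
    define v where "v k w = (case k of Inl (i, m) \<Rightarrow> h i w * mon m | Inr m \<Rightarrow> mon m)" for k :: "'j \<times> 4 monom + 4 monom" and w
    have img: "(\<lambda>k. v k w) ` K = (\<lambda>(b, m). b * mon m) ` (((\<lambda>i. h i w) ` A) \<times> {m. mdeg m = s})
        \<union> standard_of_degree ?t" for w
      unfolding K_def v_def by (auto simp: image_Un image_image)
    have finS: "finite ?S" by (rule finite_subset[OF _ finite_mdeg, of _ ?t]) auto
    have "\<exists>F. poly_fun c F \<and> F w0 \<noteq> 0 \<and>
      (\<forall>w\<in>W. F w \<noteq> 0 \<longrightarrow> homs ?t \<subseteq> mp.span ((\<lambda>k. v k w) ` K))"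
    proof (rule spanning_open)
      show "finite K" unfolding K_def using A finS finite_mdeg by blast
      fix k assume k: "k \<in> K"
      show "poly_family c (v k)"
        using k pf unfolding K_def v_def by (auto intro!: poly_family_mult poly_family_const)
      fix w assume w: "w \<in> W"
      show "homogeneous ?t (v k w)"
        using k homogeneous_mult[OF hom[OF _ w], of _ s "mon _"] unfolding K_def v_def by auto
    next
      show "homs ?t \<subseteq> mp.span ((\<lambda>k. v k w0) ` K)"
        unfolding img
      proof (rule homs_subset_span_graded[OF subspace_ideal_gen])
        show "homs ?t \<subseteq> mp.span (?I w0 \<union> standard_of_degree ?t)"
          using w0(2) s unfolding segment_spans_def by blast
        show "?I w0 \<inter> homs ?t \<subseteq> mp.span ((\<lambda>(b, m). b * mon m) ` (((\<lambda>i. h i w0) ` A) \<times> {m. mdeg m = s}))"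
          by (rule ideal_gen_homs_subset) (use hom w0(1) in auto)
      qed auto
    qed
    then obtain F where F: "poly_fun c F" "F w0 \<noteq> 0"
      "\<And>w. w \<in> W \<Longrightarrow> F w \<noteq> 0 \<Longrightarrow> homs ?t \<subseteq> mp.span ((\<lambda>k. v k w) ` K)" by blast
    have "homs ?t \<subseteq> mp.span (?I w \<union> standard_of_degree ?t)" if w: "w \<in> W" "F w \<noteq> 0" for w
    proof -
      have "h i w * mon m \<in> ?I w" if "i \<in> A" for i m
        unfolding mult.commute[of _ "mon m"] using that by (intro ideal_gen_mult ideal_gen_base imageI)
      then have "(\<lambda>k. v k w) ` K \<subseteq> ?I w \<union> standard_of_degree ?t"
        unfolding img by auto
      then have "mp.span ((\<lambda>k. v k w) ` K) \<subseteq> mp.span (?I w \<union> standard_of_degree ?t)" by (rule mp.span_mono)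
      with F(3)[OF w] show ?thesis by (rule order_trans)
    qed
    then show ?thesis unfolding ts using F(1,2) by blast
  qed
  define F where "F t = (SOME F. ?P t F)" for t
  have "?P t (F t)" if "t \<in> {2..5}" for t
    unfolding F_def using ex[OF that] by (rule someI_ex)
  then have F: "poly_fun c (F t)" "F t w0 \<noteq> 0"
    "\<And>w. w \<in> W \<Longrightarrow> F t w \<noteq> 0 \<Longrightarrow> homs t \<subseteq> mp.span (?I w \<union> standard_of_degree t)"
    if "t \<in> {2..5}" for t using that by blast+
  let ?F = "\<lambda>w. F 2 w * F 3 w * (F 4 w * F 5 w)"
  have "poly_fun c ?F" by (intro poly_fun_mult F) auto
  moreover have "?F w0 \<noteq> 0" using F(2)[of 2] F(2)[of 3] F(2)[of 4] F(2)[of 5] by simp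
  moreover have "segment_spans (?I w)" if w: "w \<in> W" "?F w \<noteq> 0" for w
    unfolding segment_spans_def
  proof
    fix t :: nat assume t: "t \<in> {2..5}"
    then have "t = 2 \<or> t = 3 \<or> t = 4 \<or> t = 5" by auto
    then have "F t w \<noteq> 0" using w(2) by auto
    then show "homs t \<subseteq> mp.span (?I w \<union> standard_of_degree t)" by (rule F(3)[OF t w(1)])
  qed
  ultimately show ?thesis by blast
qed

lemma Gin_eq_segment_ideal:
  fixes f1 f2 f3 f4 :: "(4, 'k::field_char_0) mpol"
  defines "B \<equiv> {f1, f2, f3, f4}"
  assumes hom: "\<And>b. b \<in> B \<Longrightarrow> homogeneous 2 b"
    and g0: "invertible g0" "segment_spans (change_coords g0 ` ideal_gen B)"
  shows "Gin (ideal_gen B) = segment_ideal"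
proof -
  have "\<exists>F. poly_fun matrix_coords F \<and> F g0 \<noteq> 0 \<and>
      (\<forall>g\<in>UNIV. F g \<noteq> 0 \<longrightarrow> segment_spans (ideal_gen ((\<lambda>b. change_coords g b) ` B)))"
  proof (rule segment_spans_open)
    show "segment_spans (ideal_gen (change_coords g0 ` B))"
      using g0(2) unfolding change_coords_ideal_gen[OF g0(1)] .
    fix b and g :: "'k ^ 4 ^ 4" assume "b \<in> B"
    then show "homogeneous 2 (change_coords g b)" by (rule homogeneous_change_coords[OF hom])
  qed (simp_all add: B_def poly_family_change_coords_matrix)
  then obtain F where F: "poly_fun matrix_coords F" "F g0 \<noteq> 0"
    "\<And>g. F g \<noteq> 0 \<Longrightarrow> segment_spans (ideal_gen (change_coords g ` B))" by blast
  show ?thesis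
  proof (rule Gin_eqI[OF F(1,2) g0(1)])
    fix g :: "'k ^ 4 ^ 4" assume g: "invertible g" "F g \<noteq> 0"
    have img: "change_coords g ` B = {change_coords g f1, change_coords g f2, change_coords g f3, change_coords g f4}"
      by (simp add: B_def)
    show "initial_ideal (change_coords g ` ideal_gen B) = segment_ideal"
      unfolding change_coords_ideal_gen[OF g(1)] img
    proof (rule initial_ideal_eq_segment_ideal)
      show "segment_spans (ideal_gen {change_coords g f1, change_coords g f2, change_coords g f3, change_coords g f4})"
        using F(3)[OF g(2)] unfolding img .
    qed (use hom in \<open>auto simp: B_def intro!: homogeneous_change_coords\<close>)
  qed
qed

lemma forms_quadrics: "fs \<in> forms [2, 2, 2, 2] \<longleftrightarrow> length fs = 4 \<and> (\<forall>i<4. homogeneous 2 (fs ! i))"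
proof -
  have "[2, 2, 2, 2] ! i = (2::nat)" if "i < 4" for i :: nat
    using that by (auto simp: less_Suc_eq numeral_nat)
  then show ?thesis by (auto simp: forms_def)
qed

lemma segment_coordinates_open_in_forms:
  fixes fs0 :: "(4, 'k::field) mpol list"
  assumes g0: "invertible g0"
    and fs0: "fs0 \<in> forms [2, 2, 2, 2]" "segment_spans (change_coords g0 ` ideal_gen (set fs0))"
  shows "\<exists>F. poly_fun forms_coords F \<and> F fs0 \<noteq> 0 \<and>
    (\<forall>fs\<in>forms [2, 2, 2, 2]. F fs \<noteq> 0 \<longrightarrow> segment_spans (change_coords g0 ` ideal_gen (set fs)))"
proof -
  \<comment> \<open>written in terms of the coordinates, because fs ! i is unspecified for lists that are too short\<close>
  define h where "h i fs = (\<Sum>m | mdeg m = 2. Const (forms_coords fs (i, m)) * change_coords g0 (mon m))"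
    for i and fs :: "(4, 'k) mpol list"
  have h: "h i fs = change_coords g0 (fs ! i)" if "fs \<in> forms [2, 2, 2, 2]" "i < 4" for i fs
  proof -
    have fi: "length fs = 4" "homogeneous 2 (fs ! i)" using that by (auto simp: forms_quadrics)
    have "fs ! i = (\<Sum>m | mdeg m = 2. Const (lookup (fs ! i) m) * mon m)"
      by (rule mpol_expand_superset[OF finite_mdeg]) (use fi(2) in \<open>auto simp: homogeneous_def\<close>)
    then have "change_coords g0 (fs ! i)
        = change_coords g0 (\<Sum>m | mdeg m = 2. Const (lookup (fs ! i) m) * mon m)" by simp
    also have "\<dots> = h i fs"
      using fi(1) that(2) by (simp add: h_def change_coords_sum change_coords_mult forms_coords_def)
    finally show ?thesis by simp
  qed
  have img: "(\<lambda>i. h i fs) ` {..<4} = change_coords g0 ` set fs" if "fs \<in> forms [2, 2, 2, 2]" for fs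
  proof -
    have "set fs = (!) fs ` {..<4}" using that by (auto simp: forms_quadrics set_conv_nth)
    then show ?thesis using h[OF that] by (auto simp: image_image)
  qed
  have "\<exists>F. poly_fun forms_coords F \<and> F fs0 \<noteq> 0 \<and>
    (\<forall>fs\<in>forms [2, 2, 2, 2]. F fs \<noteq> 0 \<longrightarrow> segment_spans (ideal_gen ((\<lambda>i. h i fs) ` {..<4})))"
  proof (rule segment_spans_open)
    show "poly_family forms_coords (h i)" for i
      unfolding h_def by (intro poly_family_sum poly_family_Const_mult poly_family_const poly_fun_coord)
    show "segment_spans (ideal_gen ((\<lambda>i. h i fs0) ` {..<4}))"
      using fs0(2) unfolding img[OF fs0(1)] change_coords_ideal_gen[OF g0] .
    fix i and fs :: "(4, 'k) mpol list" assume "i \<in> {..<4::nat}" "fs \<in> forms [2, 2, 2, 2]"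
    then show "homogeneous 2 (h i fs)"
      using h[of fs i] by (auto simp: forms_quadrics intro!: homogeneous_change_coords)
  qed (use fs0 in auto)
  then show ?thesis using img by (auto simp: change_coords_ideal_gen[OF g0])
qed

section \<open>The monomial complete intersection\<close>

text \<open>
  A monomial ideal is spanned by the monomials it contains.
\<close>

lemma mem_ideal_squares_iff:
  fixes p :: "('n::finite, 'k::field) mpol"
  shows "p \<in> ideal_gen ((\<lambda>i. Var i ^ 2) ` A) \<longleftrightarrow> (\<forall>m\<in>keys p. \<exists>i\<in>A. lookup m i \<ge> 2)"
proof -
  let ?M = "{m :: 'n monom. \<exists>i\<in>A. lookup m i \<ge> 2}"
  have "{b * mon m | b m. b \<in> (\<lambda>i. Var i ^ 2) ` A} \<subseteq> mp.span (mon ` ?M :: ('n, 'k) mpol set)"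
  proof clarify
    fix i and m :: "'n monom" assume "i \<in> A"
    then have "single i 2 + m \<in> ?M" by (auto simp: lookup_add intro!: bexI[of _ i])
    then show "Var i ^ 2 * mon m \<in> mp.span (mon ` ?M :: ('n, 'k) mpol set)"
      unfolding Var_power mon_add[symmetric] by (intro mp.span_base imageI)
  qed
  then have 1: "ideal_gen ((\<lambda>i. Var i ^ 2) ` A) \<subseteq> mp.span (mon ` ?M :: ('n, 'k) mpol set)"
    unfolding ideal_gen_eq_span by (intro mp.span_minimal mp.subspace_span)
  have "mon m \<in> ideal_gen ((\<lambda>i. Var i ^ 2 :: ('n, 'k) mpol) ` A)" if m: "m \<in> ?M" for m
  proof -
    obtain i where i: "i \<in> A" "lookup m i \<ge> 2" using m by auto
    have "m = (m - single i 2) + single i 2"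
      by (rule poly_mapping_eqI) (use i in \<open>auto simp: lookup_add lookup_minus lookup_single when_def\<close>)
    then have "mon m = (mon (m - single i 2) * Var i ^ 2 :: ('n, 'k) mpol)"
      unfolding Var_power mon_add[symmetric] by simp
    then show ?thesis using i by (auto intro: ideal_gen_mult ideal_gen_base)
  qed
  then have 2: "mp.span (mon ` ?M :: ('n, 'k) mpol set) \<subseteq> ideal_gen ((\<lambda>i. Var i ^ 2) ` A)"
    by (intro mp.span_minimal subspace_ideal_gen) auto
  show ?thesis
  proof
    assume "p \<in> ideal_gen ((\<lambda>i. Var i ^ 2) ` A)"
    then have "p \<in> mp.span (mon ` ?M)" using 1 by blast
    from keys_of_span_mon[OF this] show "\<forall>m\<in>keys p. \<exists>i\<in>A. lookup m i \<ge> 2" by auto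
  next
    assume "\<forall>m\<in>keys p. \<exists>i\<in>A. lookup m i \<ge> 2"
    then have "p \<in> mp.span (mon ` ?M)" by (intro in_span_mon) auto
    then show "p \<in> ideal_gen ((\<lambda>i. Var i ^ 2) ` A)" using 2 by blast
  qed
qed

lemma square_regular_modulo_squares:
  fixes h :: "('n::finite, 'k::field) mpol"
  assumes "i \<notin> A" "Var i ^ 2 * h \<in> ideal_gen ((\<lambda>i. Var i ^ 2) ` A)"
  shows "h \<in> ideal_gen ((\<lambda>i. Var i ^ 2) ` A)"
  unfolding mem_ideal_squares_iff
proof
  fix m assume m: "m \<in> keys h"
  have "single i 2 + m \<in> keys (Var i ^ 2 * h)"
    using m unfolding Var_power in_keys_iff lookup_single_mult by simp
  then obtain j where "j \<in> A" "lookup (single i 2 + m) j \<ge> 2"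
    using assms(2) unfolding mem_ideal_squares_iff by blast
  then show "\<exists>j\<in>A. lookup m j \<ge> 2"
    using assms(1) by (intro bexI[of _ j]) (auto simp: lookup_add lookup_single when_def split: if_splits)
qed

lemma regular_sequence_squares: "regular_sequence [x1 ^ 2, x2 ^ 2, x3 ^ 2, x4 ^ 2 :: (4, 'k::field) mpol]"
proof -
  let ?fs = "[x1 ^ 2, x2 ^ 2, x3 ^ 2, x4 ^ 2 :: (4, 'k) mpol]"
  have reg: "h \<in> ideal_gen S" if "S = (\<lambda>i. Var i ^ 2) ` A" "i \<notin> A" "Var i ^ 2 * h \<in> ideal_gen S"
    for S A i and h :: "(4, 'k) mpol"
    using square_regular_modulo_squares[of i A h] that by simp
  have "\<forall>i<4. \<forall>h. ?fs ! i * h \<in> ideal_gen (set (take i ?fs)) \<longrightarrow> h \<in> ideal_gen (set (take i ?fs))"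
  proof (intro allI impI)
    fix i :: nat and h assume i: "i < 4" and h: "?fs ! i * h \<in> ideal_gen (set (take i ?fs))"
    consider "i = 0" | "i = 1" | "i = 2" | "i = 3" using i by linarith
    then show "h \<in> ideal_gen (set (take i ?fs))"
    proof cases
      case 1 show ?thesis by (rule reg[of _ "{}" 0]) (use h 1 in auto)
    next
      case 2 show ?thesis by (rule reg[of _ "{0}" 1]) (use h 2 in auto)
    next
      case 3 show ?thesis by (rule reg[of _ "{0, 1}" 2]) (use h 3 in auto)
    next
      case 4 show ?thesis by (rule reg[of _ "{0, 1, 2}" 3]) (use h 4 in \<open>auto simp: numeral_nat insert_commute\<close>)
    qed
  qed
  moreover have "1 \<notin> ideal_gen ((\<lambda>i. Var i ^ 2 :: (4, 'k) mpol) ` {0, 1, 2, 3})"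
    unfolding mem_ideal_squares_iff by simp
  ultimately show ?thesis by (simp add: regular_sequence_def)
qed

text \<open>
  The sum \<open>l\<close> of the variables is a Lefschetz element. With \<open>e\<close> the second elementary symmetric polynomial,
  \<open>l\<^sup>2 \<equiv> 2e\<close> modulo the squares. Hence \<open>l\<^sup>4 \<equiv> 24 x\<^sub>1x\<^sub>2x\<^sub>3x\<^sub>4\<close>, and for \<open>p = \<Sum>\<^sub>i v\<^sub>i x\<^sub>i\<close> the coefficient of
  \<open>x\<^sub>ax\<^sub>bx\<^sub>c\<close> in \<open>l\<^sup>2p\<close> is \<open>2(v\<^sub>a + v\<^sub>b + v\<^sub>c)\<close>. If these four sums vanish, all \<open>v\<^sub>i\<close> are equal, and then
  zero.
\<close>

lemma squares_segment_coordinates: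
  "\<exists>g. invertible g \<and>
    segment_spans (change_coords g ` ideal_gen {x1 ^ 2, x2 ^ 2, x3 ^ 2, x4 ^ 2 :: (4, 'k::field_char_0) mpol})"
proof -
  let ?B = "{x1 ^ 2, x2 ^ 2, x3 ^ 2, x4 ^ 2 :: (4, 'k) mpol}"
  let ?I = "ideal_gen ?B"
  have hom: "homogeneous 2 b" if "b \<in> ?B" for b
    using that homogeneous_power[OF homogeneous_Var, of 2] by auto
  have B: "?B = (\<lambda>i. Var i ^ 2) ` UNIV" by (simp add: UNIV_four)
  define l where "l = (x1 + x2 + x3 + x4 :: (4, 'k) mpol)"
  have l: "homogeneous 1 l" unfolding l_def by (intro homogeneous_add homogeneous_Var)
  have sqfree: "m \<notin> keys p" if "p \<in> ?I" "\<forall>i. lookup m i < 2" for m p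
    using that unfolding B mem_ideal_squares_iff by (metis not_le)
  have in_I: "x1 ^ 2 * a + x2 ^ 2 * b + x3 ^ 2 * c + x4 ^ 2 * d \<in> ?I" for a b c d
    using ideal_gen_mult[OF ideal_gen_base, of "x1 ^ 2" ?B a] ideal_gen_mult[OF ideal_gen_base, of "x2 ^ 2" ?B b]
      ideal_gen_mult[OF ideal_gen_base, of "x3 ^ 2" ?B c] ideal_gen_mult[OF ideal_gen_base, of "x4 ^ 2" ?B d]
    by (auto intro!: ideal_gen_add simp: mult.commute)
  have inj: "p = 0" if p: "homogeneous 1 p" "l ^ 2 * p \<in> ?I" for p
  proof -
    define v where "v i = lookup p (single i 1)" for i
    have pe: "p = Const (v 0) * x1 + Const (v 1) * x2 + Const (v 2) * x3 + Const (v 3) * x4"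
      using linear_form_expand[OF p(1)] by (simp add: sum_four v_def)
    define R where "R = Const (2 * (v 0 + v 1 + v 2)) * mon (monom4 1 1 1 0) + Const (2 * (v 0 + v 1 + v 3)) * mon (monom4 1 1 0 1)
      + Const (2 * (v 0 + v 2 + v 3)) * mon (monom4 1 0 1 1) + Const (2 * (v 1 + v 2 + v 3)) * mon (monom4 0 1 1 1)"
    have two: "Const (2 * c) = (2 * Const c :: (4, 'k) mpol)" for c
      unfolding mult_2 Const_add ..
    have "l ^ 2 * p - R = x1 ^ 2 * (p + 2 * Const (v 0) * (x2 + x3 + x4)) + x2 ^ 2 * (p + 2 * Const (v 1) * (x1 + x3 + x4))
        + x3 ^ 2 * (p + 2 * Const (v 2) * (x1 + x2 + x4)) + x4 ^ 2 * (p + 2 * Const (v 3) * (x1 + x2 + x3))"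
      unfolding R_def two Const_add mon_monom4 pe l_def by (simp add: algebra_simps power2_eq_square)
    then have "l ^ 2 * p - R \<in> ?I" using in_I by simp
    with p(2) have "l ^ 2 * p - (l ^ 2 * p - R) \<in> ?I" by (rule ideal_gen_diff)
    then have R: "R \<in> ?I" by simp
    have z: "lookup R m = 0" if "\<forall>i. lookup m i < 2" for m
      using sqfree[OF R that] by (simp add: in_keys_iff)
    have "2 * (v 0 + v 1 + v 2) = 0" "2 * (v 0 + v 1 + v 3) = 0" "2 * (v 0 + v 2 + v 3) = 0" "2 * (v 1 + v 2 + v 3) = 0"
      using z[of "monom4 1 1 1 0"] z[of "monom4 1 1 0 1"] z[of "monom4 1 0 1 1"] z[of "monom4 0 1 1 1"]
      by (simp_all add: all_four R_def lookup_add lookup_single when_def monom4_inject)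
    then have s: "v 0 + v 1 + v 2 = 0" "v 0 + v 1 + v 3 = 0" "v 0 + v 2 + v 3 = 0" "v 1 + v 2 + v 3 = 0"
      unfolding mult_eq_0_iff by simp_all
    have e: "v 3 = v 2" "v 2 = v 1" "v 1 = v 0"
      using s by (metis add.commute add.left_commute add_left_cancel)+
    have "3 * v 0 = 0" using s(1) e by simp
    then have "v 0 = 0" by simp
    then show ?thesis using pe e by simp
  qed
  have l4: "l ^ 4 \<notin> ?I"
  proof
    assume l4: "l ^ 4 \<in> ?I"
    define s where "s = (x1 ^ 2 + x2 ^ 2 + x3 ^ 2 + x4 ^ 2 :: (4, 'k) mpol)"
    define e where "e = (x1 * x2 + x1 * x3 + x1 * x4 + x2 * x3 + x2 * x4 + x3 * x4 :: (4, 'k) mpol)"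
    have l2: "l ^ 2 = s + 2 * e" unfolding l_def s_def e_def by (simp add: algebra_simps power2_eq_square)
    have e2: "e ^ 2 - 6 * (x1 * x2 * x3 * x4) = x1 ^ 2 * (x2 ^ 2 + x3 ^ 2 + x4 ^ 2 + 2 * (x2 * x3 + x2 * x4 + x3 * x4))
      + x2 ^ 2 * (x3 ^ 2 + x4 ^ 2 + 2 * (x1 * x3 + x1 * x4 + x3 * x4))
      + x3 ^ 2 * (x4 ^ 2 + 2 * (x1 * x2 + x1 * x4 + x2 * x4))
      + x4 ^ 2 * (2 * (x1 * x2 + x1 * x3 + x2 * x3))"
      unfolding e_def by (simp add: algebra_simps power2_eq_square)
    have s: "s * y = x1 ^ 2 * y + x2 ^ 2 * y + x3 ^ 2 * y + x4 ^ 2 * y" for y :: "(4, 'k) mpol"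
      by (simp add: s_def distrib_right)
    have "4 * (e ^ 2 - 6 * (x1 * x2 * x3 * x4)) + s * (s + 4 * e) \<in> ?I"
      unfolding e2 s by (intro ideal_gen_add ideal_gen_mult in_I)
    with l4 have "l ^ 4 - (4 * (e ^ 2 - 6 * (x1 * x2 * x3 * x4)) + s * (s + 4 * e)) \<in> ?I" by (rule ideal_gen_diff)
    moreover have "l ^ 4 = (s + 2 * e) ^ 2" unfolding l2[symmetric] by (simp flip: power_mult)
    moreover have "(s + 2 * e) ^ 2 - (4 * (e ^ 2 - 6 * (x1 * x2 * x3 * x4)) + s * (s + 4 * e)) = 24 * (x1 * x2 * x3 * x4)"
      by (simp add: algebra_simps power2_eq_square)
    ultimately have "24 * (x1 * x2 * x3 * x4) \<in> ?I" by (simp only:)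
    moreover have "24 * (x1 * x2 * x3 * x4) = (single (monom4 1 1 1 1) 24 :: (4, 'k) mpol)"
    proof -
      have "(24 :: (4, 'k) mpol) = Const 24" by (simp add: Const_def)
      then show ?thesis
        unfolding Const_mult_mon[of 24 "monom4 1 1 1 1", symmetric] mon_monom4 by simp
    qed
    ultimately have "single (monom4 1 1 1 1) 24 \<in> ?I" by (simp only:)
    from sqfree[OF this, of "monom4 1 1 1 1"] show False by (simp add: all_four)
  qed
  show ?thesis
    using lefschetz_element_segment_coordinates[OF complete_intersection_ranks[OF hom regular_sequence_squares] l inj l4]
    by blast
qed

section \<open>Triangular complete intersections\<close>

abbreviation value_at :: "('i \<Rightarrow> 'k::comm_ring_1) \<Rightarrow> ('i, 'k) mpol \<Rightarrow> 'k" where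
  "value_at \<equiv> eval_with (\<lambda>c. c)"

lemma value_at_ideal_gen:
  assumes "x \<in> ideal_gen B" "\<And>b. b \<in> B \<Longrightarrow> value_at a b = 0"
  shows "value_at a x = 0"
  using assms(1)
proof (induction rule: ideal_gen_induct)
  case zero
  then show ?case by (simp add: eval_with_def)
next
  case (step c b y)
  then show ?case using assms(2)
    by (simp add: eval_with_add[OF coeff_hom_id] eval_with_mult[OF coeff_hom_id])
qed

lemma value_at_unit_vector:
  fixes f :: "('n::finite, 'k::comm_ring_1) mpol"
  assumes "homogeneous 2 f"
  shows "value_at (\<lambda>j. if j = k then 1 else 0) f = lookup f (single k 2)"
proof -
  have "monom_value (\<lambda>j. if j = k then 1 else 0 :: 'k) m = (if m = single k 2 then 1 else 0)"
    if "mdeg m = 2" for m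
  proof (cases "\<exists>j. j \<noteq> k \<and> lookup m j \<noteq> 0")
    case True
    then obtain j where j: "j \<noteq> k" "lookup m j \<noteq> 0" by blast
    have "monom_value (\<lambda>j. if j = k then 1 else 0 :: 'k) m = 0"
      unfolding monom_value_superset[OF finite_class.finite_UNIV subset_UNIV]
    proof (rule prod_zero)
      show "\<exists>j\<in>UNIV. (if j = k then 1 else 0 :: 'k) ^ lookup m j = 0"
        by (rule bexI[of _ j]) (use j in \<open>simp_all add: zero_power\<close>)
    qed simp
    moreover have "m \<noteq> single k 2" using j by (auto simp: lookup_single when_def)
    ultimately show ?thesis by simp
  next
    case False
    have "mdeg m = lookup m k"
      unfolding mdeg_sum by (subst sum.remove[of _ k]) (use False in auto)
    then have "m = single k 2"
      using False that by (intro poly_mapping_eqI) (auto simp: lookup_single when_def)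
    then show ?thesis by (simp add: monom_value_def)
  qed
  then have "value_at (\<lambda>j. if j = k then 1 else 0) f
      = (\<Sum>m\<in>keys f. if m = single k 2 then lookup f m else 0)"
    unfolding eval_with_superset[OF coeff_hom_id finite_keys order_refl]
    by (intro sum.cong) (use assms in \<open>auto simp: homogeneous_def\<close>)
  also have "\<dots> = lookup f (single k 2)" by (auto simp: in_keys_iff)
  finally show ?thesis .
qed

text \<open>
  A quadratic form restricted to a line parallel to the \<open>i\<close>th axis; \<open>x\<^sub>i\<^sup>2\<close> is the only monomial that
  contributes to the square of the parameter.
\<close>

lemma value_at_coordinate_line:
  fixes f :: "('n::finite, 'k::comm_ring_1) mpol"
  assumes "homogeneous 2 f"
  shows "\<exists>q. (\<forall>s. value_at (a(i := s)) f = poly q s) \<and>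
    coeff q 2 = lookup f (single i 2)"
proof (intro exI conjI allI)
  let ?r = "\<lambda>m. lookup f m * (\<Prod>j\<in>UNIV - {i}. a j ^ lookup m j)"
  let ?q = "\<Sum>m\<in>keys f. Polynomial.monom (?r m) (lookup m i)"
  have "monom_value (a(i := s)) m = s ^ lookup m i * (\<Prod>j\<in>UNIV - {i}. a j ^ lookup m j)"
    for s m
    unfolding monom_value_superset[OF finite_class.finite_UNIV subset_UNIV]
    by (subst prod.remove[of _ i]) auto
  then show "value_at (a(i := s)) f = poly ?q s" for s
    unfolding eval_with_superset[OF coeff_hom_id finite_keys order_refl]
    by (simp add: poly_sum poly_monom mult_ac)
  have "coeff (Polynomial.monom (?r m) (lookup m i)) 2
      = (if m = single i 2 then lookup f m else 0)" if "m \<in> keys f" for m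
  proof (cases "lookup m i = 2")
    case True
    have "mdeg m = 2" using that assms by (simp add: homogeneous_def)
    then have "(\<Sum>j\<in>UNIV - {i}. lookup m j) = 0"
      using True unfolding mdeg_sum by (simp add: sum.remove[of UNIV i])
    then have 0: "lookup m j = 0" if "j \<noteq> i" for j using that by simp
    then have "m = single i 2"
      using True by (intro poly_mapping_eqI) (auto simp: lookup_single when_def)
    then show ?thesis using 0 True by simp
  next
    case False
    then show ?thesis by (auto simp: coeff_monom)
  qed
  then have "coeff ?q 2 = (\<Sum>m\<in>keys f. if m = single i 2 then lookup f m else 0)"
    unfolding coeff_sum by (intro sum.cong) auto
  also have "\<dots> = lookup f (single i 2)" by (auto simp: in_keys_iff)
  finally show "coeff ?q 2 = lookup f (single i 2)" .
qed

definition triangular :: "('n::linorder \<Rightarrow> ('n, 'k::zero) mpol) \<Rightarrow> bool" where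
  "triangular f \<longleftrightarrow> (\<forall>i. homogeneous 2 (f i) \<and> (\<forall>m\<in>keys (f i). \<forall>j<i. lookup m j = 0))"

lemma triangular_value_at_cong:
  assumes "triangular f" "\<And>j. j \<ge> i \<Longrightarrow> a j = b j"
  shows "value_at a (f i) = value_at b (f i)"
  unfolding eval_with_def
proof (intro sum.cong refl arg_cong2[of _ _ _ _ "(*)"] prod.cong)
  fix m j assume m: "m \<in> keys (f i)" and j: "j \<in> keys m"
  have "\<not> j < i" using assms(1) m j by (auto simp: triangular_def in_keys_iff)
  then show "a j ^ lookup m j = b j ^ lookup m j" using assms(2)[of j] by simp
qed

text \<open>
  Changing \<open>a\<close> in position \<open>i\<close> does not affect the later forms, and the value of \<open>f\<^sub>i\<close> is a polynomial of
  positive degree in the new entry, so it has a root.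
\<close>

lemma triangular_extend_zero:
  fixes f :: "'n::{finite, linorder} \<Rightarrow> ('n, 'k::alg_closed_field) mpol"
  assumes tri: "triangular f" and c: "lookup (f i) (single i 2) \<noteq> 0"
    and z: "\<forall>l>i. value_at a (f l) = 0"
  shows "\<exists>s. \<forall>l\<ge>i. value_at (a(i := s)) (f l) = 0"
proof -
  have "homogeneous 2 (f i)" using tri by (simp add: triangular_def)
  from value_at_coordinate_line[OF this, of a i] obtain q where
    q: "\<And>s. value_at (a(i := s)) (f i) = poly q s" "coeff q 2 \<noteq> 0" using c by auto
  have "degree q > 0" using le_degree[OF q(2)] by simp
  then obtain s where s: "poly q s = 0" using alg_closed_imp_poly_has_root by blast
  have "value_at (a(i := s)) (f l) = 0" if "l > i" for l
  proof -
    have "value_at (a(i := s)) (f l) = value_at a (f l)"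
      by (rule triangular_value_at_cong[OF tri]) (use that in auto)
    then show ?thesis using z that by simp
  qed
  moreover have "value_at (a(i := s)) (f i) = 0" using q(1) s by simp
  ultimately show ?thesis by (metis order_le_less)
qed

text \<open>
  Suppose that the coefficient of \<open>x\<^sub>k\<^sup>2\<close> in \<open>f\<^sub>k\<close> is zero, with \<open>k\<close> minimal. The \<open>k\<close>th unit vector is a zero
  of \<open>f\<^sub>k\<close> and of all later forms. Adjusting the earlier entries one after the other, from \<open>k - 1\<close>
  down to the first, yields a common zero of all \<open>f\<^sub>i\<close> with \<open>k\<close>th entry 1. But the ideal
  contains a power of every variable.
\<close>

lemma triangular_leading_coefficients:
  fixes f :: "4 \<Rightarrow> (4, 'k::alg_closed_field) mpol"
  assumes tri: "triangular f" and fin: "homs 5 \<subseteq> ideal_gen (range f)"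
  shows "lookup (f i) (single i 2) \<noteq> 0"
proof -
  have nozero: False if "\<forall>l. value_at a (f l) = 0" "a k \<noteq> 0" for a k
  proof -
    have "Var k ^ 5 \<in> ideal_gen (range f)"
      using fin homogeneous_power[OF homogeneous_Var, of 5 k] by auto
    then have "value_at a (Var k ^ 5) = 0" by (rule value_at_ideal_gen) (use that in auto)
    moreover have "value_at a (Var k ^ n) = a k ^ n" for n
      using eval_with_Const[OF coeff_hom_id, of a 1]
      by (induction n) (simp_all add: eval_with_mult[OF coeff_hom_id] eval_with_Var[OF coeff_hom_id])
    ultimately show False using that by simp
  qed
  let ?c = "\<lambda>k. lookup (f k) (single k 2)"
  let ?e = "\<lambda>k j. if j = k then 1 else 0 :: 'k"
  have e: "\<forall>l\<ge>k. value_at (?e k) (f l) = 0" if "?c k = 0" for k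
  proof (intro allI impI)
    fix l assume l: "l \<ge> k"
    have "value_at (?e k) (f l) = lookup (f l) (single k 2)"
      using tri by (intro value_at_unit_vector) (simp add: triangular_def)
    also have "\<dots> = 0"
    proof (cases "l = k")
      case False
      then have "k < l" using l by simp
      have "single k 2 \<notin> keys (f l)"
      proof
        assume "single k 2 \<in> keys (f l)"
        then have "lookup (single k (2 :: nat)) k = 0"
          using tri \<open>k < l\<close> unfolding triangular_def by blast
        then show False unfolding lookup_single_eq by simp
      qed
      then show ?thesis by (simp only: in_keys_iff not_not)
    qed (use that in simp)
    finally show "value_at (?e k) (f l) = 0" .
  qed
  have c0: "?c 0 \<noteq> 0"
  proof
    assume "?c 0 = 0"
    from e[OF this] have "\<forall>l. value_at (?e 0) (f l) = 0" by (simp add: all_four order_less_imp_le)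
    then show False using nozero[of "?e 0" 0] by simp
  qed
  have from0: False if "\<forall>l>0. value_at a (f l) = 0" "a k \<noteq> 0" "k \<noteq> 0" for a k
  proof -
    from triangular_extend_zero[OF tri c0 that(1)]
    obtain s where "\<forall>l\<ge>0. value_at (a(0 := s)) (f l) = 0" by blast
    then have "\<forall>l. value_at (a(0 := s)) (f l) = 0" by (simp add: all_four order_less_imp_le)
    then show False using nozero[of "a(0 := s)" k] that by simp
  qed
  have c1: "?c 1 \<noteq> 0"
  proof
    assume "?c 1 = 0"
    from e[OF this] have "\<forall>l>0. value_at (?e 1) (f l) = 0" by (simp add: all_four order_less_imp_le)
    then show False using from0[of "?e 1" 1] by simp
  qed
  have from1: False if "\<forall>l>1. value_at a (f l) = 0" "a k \<noteq> 0" "k \<noteq> 0" "k \<noteq> 1" for a k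
  proof -
    from triangular_extend_zero[OF tri c1 that(1)]
    obtain s where "\<forall>l\<ge>1. value_at (a(1 := s)) (f l) = 0" by blast
    then have "\<forall>l>0. value_at (a(1 := s)) (f l) = 0" by (simp add: all_four order_less_imp_le)
    then show False using from0[of "a(1 := s)" k] that by simp
  qed
  have c2: "?c 2 \<noteq> 0"
  proof
    assume "?c 2 = 0"
    from e[OF this] have "\<forall>l>1. value_at (?e 2) (f l) = 0" by (simp add: all_four order_less_imp_le)
    then show False using from1[of "?e 2" 2] by simp
  qed
  have c3: "?c 3 \<noteq> 0"
  proof
    assume "?c 3 = 0"
    from e[OF this] have "\<forall>l>2. value_at (?e 3) (f l) = 0" by (simp add: all_four order_less_imp_le)
    from triangular_extend_zero[OF tri c2 this]
    obtain s where "\<forall>l\<ge>2. value_at ((?e 3)(2 := s)) (f l) = 0" by blast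
    then have "\<forall>l>1. value_at ((?e 3)(2 := s)) (f l) = 0" by (simp add: all_four order_less_imp_le)
    then show False using from1[of "(?e 3)(2 := s)" 3] by simp
  qed
  have "\<forall>i. ?c i \<noteq> 0" using c0 c1 c2 c3 by (simp add: all_four)
  then show ?thesis ..
qed

definition var_weight :: "4 \<Rightarrow> nat" where
  "var_weight i = (if i = 0 then 0 else if i = 1 then 1 else if i = 2 then 2 else 3)"

text \<open>
  With the weights 0, 1, 2, 3 of the variables, \<open>x\<^sub>i\<^sup>2\<close> is the only monomial of lowest weight among the quadratic
  monomials in \<open>x\<^sub>i\<close> and the later variables.
\<close>

definition weight :: "4 monom \<Rightarrow> nat" where
  "weight m = lookup m 1 + 2 * lookup m 2 + 3 * lookup m 3"

lemma triangular_weight: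
  assumes "mdeg m = 2" "\<forall>j<i. lookup m j = 0"
  shows "2 * var_weight i \<le> weight m" "weight m = 2 * var_weight i \<Longrightarrow> m = single i 2"
proof -
  obtain a b c d where m: "m = monom4 a b c d" by (rule monom4_cases)
  have "(\<forall>j<i. lookup m j = 0) \<longrightarrow> 2 * var_weight i \<le> weight m \<and>
      (weight m = 2 * var_weight i \<longrightarrow> m = single i 2)" for i
  proof -
    have "\<forall>i. (\<forall>j<i. lookup m j = 0) \<longrightarrow> 2 * var_weight i \<le> weight m \<and>
      (weight m = 2 * var_weight i \<longrightarrow> m = single i 2)"
      using assms(1) unfolding m
      by (simp only: all_four monom4_eq_iff lookup_single) (simp add: var_weight_def weight_def when_def)
    then show ?thesis ..
  qed
  then show "2 * var_weight i \<le> weight m" "weight m = 2 * var_weight i \<Longrightarrow> m = single i 2"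
    using assms(2) by blast+
qed

text \<open>
  This is \<open>f\<close> after rescaling the variables by powers of \<open>t\<close> according to their weights, divided by \<open>t\<^sup>e\<close>.
  It is used when no monomial of \<open>f\<close> has weight below \<open>e\<close>, so that the truncated subtraction is exact; the
  value at \<open>t = 0\<close> then consists of the terms of weight \<open>e\<close>.
\<close>

definition degeneration :: "nat \<Rightarrow> 'k::comm_ring_1 \<Rightarrow> (4, 'k) mpol \<Rightarrow> (4, 'k) mpol" where
  "degeneration e t f = Poly_Mapping.mapp (\<lambda>m c. c * t ^ (weight m - e)) f"

lemma lookup_degeneration:
  "lookup (degeneration e t f) m = lookup f m * t ^ (weight m - e)"
  by (auto simp: degeneration_def lookup_mapp when_def in_keys_iff)

lemma homogeneous_degeneration: "homogeneous d f \<Longrightarrow> homogeneous d (degeneration e t f)"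
  by (auto simp: homogeneous_def in_keys_iff lookup_degeneration)

lemma degeneration_at_zero:
  fixes f :: "4 \<Rightarrow> (4, 'k::comm_ring_1) mpol"
  assumes "triangular f"
  shows "degeneration (2 * var_weight i) 0 (f i) = Const (lookup (f i) (single i 2)) * Var i ^ 2"
proof (rule poly_mapping_eqI)
  fix m
  show "lookup (degeneration (2 * var_weight i) 0 (f i)) m
      = lookup (Const (lookup (f i) (single i 2)) * Var i ^ 2) m"
  proof (cases "m \<in> keys (f i)")
    case True
    then have m: "mdeg m = 2" "\<forall>j<i. lookup m j = 0"
      using assms by (auto simp: triangular_def homogeneous_def)
    have "weight (single i 2) = 2 * var_weight i"
      using exhaust_4[of i] by (auto simp: weight_def var_weight_def lookup_single when_def)
    then show ?thesis
      using triangular_weight[OF m] by (auto simp: lookup_degeneration Var_power lookup_single when_def power_0_left)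
  qed (auto simp: lookup_degeneration in_keys_iff Var_power lookup_single when_def)
qed

definition torus :: "'k::field \<Rightarrow> 'k ^ 4 ^ 4" where
  "torus t = (\<chi> i j. if i = j then t ^ var_weight i else 0)"

lemma invertible_torus:
  assumes "t \<noteq> 0"
  shows "invertible (torus t)"
proof -
  have "torus s ** torus t = mat 1" if st: "s * t = 1" for s t :: 'a
  proof -
    have "(\<Sum>k\<in>UNIV. (if i = k then s ^ var_weight i else 0) * (if k = j then t ^ var_weight k else 0))
        = (if i = j then 1 else 0)" for i j
    proof -
      have "(\<Sum>k\<in>UNIV. (if i = k then s ^ var_weight i else 0) * (if k = j then t ^ var_weight k else 0))
          = (\<Sum>k\<in>UNIV. if k = i then (if i = j then (s * t) ^ var_weight i else 0) else 0)"
        by (intro sum.cong) (auto simp: power_mult_distrib)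
      then show ?thesis using st by simp
    qed
    then show ?thesis by (simp add: torus_def matrix_matrix_mult_def mat_def vec_eq_iff)
  qed
  then show ?thesis unfolding invertible_def using assms by (metis left_inverse right_inverse)
qed

lemma change_coords_torus_mon: "change_coords (torus t) (mon m) = Const (t ^ weight m) * mon m"
proof -
  have Cp: "Const (t ^ n) = (Const t ^ n :: (4, 'a) mpol)" for n
    by (induction n) (simp_all add: Const_mult)
  have "change_coords (torus t) (Var i) = (Const t ^ var_weight i * Var i :: (4, 'a) mpol)" for i
    by (simp add: change_coords_Var torus_def if_distrib Cp cong: if_cong) (simp add: if_distribR cong: if_cong)
  moreover obtain a b c d where m: "m = monom4 a b c d" by (rule monom4_cases)
  ultimately show ?thesis
    unfolding m mon_monom4 change_coords_mult change_coords_power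
    by (simp add: Cp Const_mult weight_def var_weight_def power_mult_distrib power_add power_mult[symmetric] mult_ac)
qed

lemma lookup_change_coords_torus:
  "lookup (change_coords (torus t) f) m = t ^ weight m * lookup f m"
proof (induction f rule: mpol_linear_induct)
  case (Const_mon c n)
  then show ?case
    by (simp add: change_coords_mult change_coords_torus_mon lookup_single when_def)
qed (simp add: change_coords_add lookup_add distrib_left)

lemma change_coords_torus_eq_degeneration:
  fixes f :: "4 \<Rightarrow> (4, 'k::field) mpol"
  assumes "triangular f"
  shows "change_coords (torus t) (f i) = Const (t ^ (2 * var_weight i)) * degeneration (2 * var_weight i) t (f i)"
proof (rule poly_mapping_eqI)
  fix m
  show "lookup (change_coords (torus t) (f i)) m
      = lookup (Const (t ^ (2 * var_weight i)) * degeneration (2 * var_weight i) t (f i)) m"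
  proof (cases "m \<in> keys (f i)")
    case True
    then have "2 * var_weight i \<le> weight m"
      using assms triangular_weight(1) by (auto simp: triangular_def homogeneous_def)
    then have "t ^ weight m = t ^ (2 * var_weight i) * t ^ (weight m - 2 * var_weight i)"
      by (simp flip: power_add)
    then show ?thesis by (simp add: lookup_change_coords_torus lookup_degeneration)
  qed (simp add: lookup_change_coords_torus lookup_degeneration in_keys_iff)
qed

lemma ideal_gen_scaled:
  fixes h :: "'j \<Rightarrow> ('n, 'k::field) mpol"
  assumes "\<And>i. i \<in> A \<Longrightarrow> c i \<noteq> 0"
  shows "ideal_gen ((\<lambda>i. Const (c i) * h i) ` A) = ideal_gen (h ` A)"
proof
  show "ideal_gen ((\<lambda>i. Const (c i) * h i) ` A) \<subseteq> ideal_gen (h ` A)"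
    by (rule ideal_gen_minimal, clarify) (intro ideal_gen_mult ideal_gen_base imageI)
  show "ideal_gen (h ` A) \<subseteq> ideal_gen ((\<lambda>i. Const (c i) * h i) ` A)"
  proof (rule ideal_gen_minimal, clarify)
    fix i assume i: "i \<in> A"
    then have "Const (inverse (c i)) * (Const (c i) * h i) \<in> ideal_gen ((\<lambda>i. Const (c i) * h i) ` A)"
      by (intro ideal_gen_mult ideal_gen_base imageI)
    then show "h i \<in> ideal_gen ((\<lambda>i. Const (c i) * h i) ` A)"
      using assms[OF i] by (simp add: mult.assoc[symmetric] Const_mult[symmetric])
  qed
qed

lemma quadric_list_in_forms:
  "[a, b, c, d] \<in> forms [2, 2, 2, 2] \<longleftrightarrow>
    homogeneous 2 a \<and> homogeneous 2 b \<and> homogeneous 2 c \<and> homogeneous 2 d"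
proof -
  have "(\<forall>i<4. P i) \<longleftrightarrow> P 0 \<and> P 1 \<and> P 2 \<and> P 3" for P :: "nat \<Rightarrow> bool"
    by (auto simp: All_less_Suc numeral_nat)
  then show ?thesis by (simp add: forms_quadrics)
qed

text \<open>
  The degenerations of the \<open>f\<^sub>i\<close> form a curve in the space of quadruples of quadrics. It passes through multiples of
  the squares at \<open>t = 0\<close>, where a coordinate change \<open>g0\<close> with the segment property is known; so \<open>g0\<close> works
  for some \<open>t \<noteq> 0\<close> as well, and there the ideal is the image of the given one under the torus.
\<close>

lemma triangular_segment_coordinates:
  fixes f :: "4 \<Rightarrow> (4, 'k::field_char_0) mpol"
  assumes tri: "triangular f" and c: "\<And>i. lookup (f i) (single i 2) \<noteq> 0"
  shows "\<exists>g. invertible g \<and> segment_spans (change_coords g ` ideal_gen (range f))"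
proof -
  let ?d = "\<lambda>t i. degeneration (2 * var_weight i) t (f i)"
  define \<gamma> where "\<gamma> t = map (?d t) [0, 1, 2, 3]" for t
  have set\<gamma>: "set (\<gamma> t) = ?d t ` UNIV" for t by (simp add: \<gamma>_def UNIV_four)
  have forms: "\<gamma> t \<in> forms [2, 2, 2, 2]" for t
    using tri by (simp add: quadric_list_in_forms \<gamma>_def triangular_def homogeneous_degeneration)
  obtain g0 where g0: "invertible g0"
    "segment_spans (change_coords g0 ` ideal_gen {x1 ^ 2, x2 ^ 2, x3 ^ 2, x4 ^ 2 :: (4, 'k) mpol})"
    using squares_segment_coordinates by blast
  have "ideal_gen (set (\<gamma> 0)) = ideal_gen ((\<lambda>i. Var i ^ 2) ` UNIV)"
    unfolding set\<gamma> degeneration_at_zero[OF tri] by (rule ideal_gen_scaled) (rule c)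
  also have "\<dots> = ideal_gen {x1 ^ 2, x2 ^ 2, x3 ^ 2, x4 ^ 2}" by (simp add: UNIV_four)
  finally have "segment_spans (change_coords g0 ` ideal_gen (set (\<gamma> 0)))" using g0(2) by simp
  from segment_coordinates_open_in_forms[OF g0(1) forms this] obtain F where
    F: "poly_fun forms_coords F" "F (\<gamma> 0) \<noteq> 0"
      "\<And>fs. fs \<in> forms [2, 2, 2, 2] \<Longrightarrow> F fs \<noteq> 0 \<Longrightarrow> segment_spans (change_coords g0 ` ideal_gen (set fs))"
    by blast
  have curve: "\<exists>q. \<forall>t. forms_coords (\<gamma> t) im = poly q t" for im
  proof (cases im)
    case (Pair i m)
    let ?j = "[0, 1, 2, 3 :: 4] ! i"
    show ?thesis
    proof (cases "i < 4")
      case True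
      then have "forms_coords (\<gamma> t) im
          = poly (Polynomial.monom (lookup (f ?j) m) (weight m - 2 * var_weight ?j)) t" for t
        unfolding Pair by (simp add: forms_coords_def \<gamma>_def lookup_degeneration poly_monom del: list.map)
      then show ?thesis by blast
    next
      case False
      then have "forms_coords (\<gamma> t) im = poly 0 t" for t unfolding Pair by (simp add: forms_coords_def \<gamma>_def)
      then show ?thesis by blast
    qed
  qed
  obtain q where q: "\<And>t. F (\<gamma> t) = poly q t" using poly_fun_on_curve[OF F(1), of \<gamma>] curve by blast
  have "q \<noteq> 0" "[:0, 1:] \<noteq> (0 :: 'k poly)" "[:1:] \<noteq> (0 :: 'k poly)" using F(2) q[of 0] by auto
  then obtain t where t: "poly q t \<noteq> 0" "poly [:0, 1:] t \<noteq> 0" by (rule nonzero_poly_product_nonroot)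
  have inv: "invertible (torus t)" using t by (intro invertible_torus) simp
  have "change_coords (torus t) ` ideal_gen (range f) = ideal_gen ((\<lambda>i. change_coords (torus t) (f i)) ` UNIV)"
    unfolding change_coords_ideal_gen[OF inv] by (simp add: image_image)
  also have "\<dots> = ideal_gen (set (\<gamma> t))"
    unfolding set\<gamma> change_coords_torus_eq_degeneration[OF tri] by (rule ideal_gen_scaled) (use t in simp)
  finally have "segment_spans (change_coords g0 ` change_coords (torus t) ` ideal_gen (range f))"
    using F(3)[OF forms] t q by simp
  then have "segment_spans (change_coords (torus t ** g0) ` ideal_gen (range f))"
    by (simp add: image_image change_coords_compose)
  then show ?thesis using invertible_mult[OF inv g0(1)] by blast
qed

section \<open>The generic initial ideal\<close>

theorem proposition2p1:
  shows "let J = (ideal_gen {x1^2, x1*x2, x2^2, x1*x3, x2*x3^2, x3^3, x2*x3*x4, x3^2*x4,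
                    x1*x4^3, x2*x4^3, x3*x4^3, x4^5}
                  :: (4, 'k::{alg_closed_field, field_char_0}) mpol set)
    in (\<forall>f1 f2 f3 f4.
          homogeneous 2 f1 \<and> homogeneous 2 f2 \<and> homogeneous 2 f3 \<and> homogeneous 2 f4 \<and>
          regular_sequence [f1, f2, f3, f4] \<and> strong_Lefschetz (ideal_gen {f1, f2, f3, f4})
          \<longrightarrow> Gin (ideal_gen {f1, f2, f3, f4}) = J) \<and>
       generic_sequence [2, 2, 2, 2] (\<lambda>fs. Gin (ideal_gen (set fs)) = J) \<and>
       (\<forall>f1 f2 f3 f4.
          homogeneous 2 f1 \<and> homogeneous 2 f2 \<and> homogeneous 2 f3 \<and> homogeneous 2 f4 \<and>
          f1 \<in> polys_in {0, 1, 2, 3} \<and> f2 \<in> polys_in {1, 2, 3} \<and>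
          f3 \<in> polys_in {2, 3} \<and> f4 \<in> polys_in {3} \<and>
          regular_sequence [f1, f2, f3, f4]
          \<longrightarrow> Gin (ideal_gen {f1, f2, f3, f4}) = J)"
  unfolding Let_def
proof (intro conjI allI impI, goal_cases)
  case (1 f1 f2 f3 f4)
  have hom: "homogeneous 2 b" if "b \<in> {f1, f2, f3, f4}" for b using that 1 by auto
  from 1 have reg: "regular_sequence [f1, f2, f3, f4]"
    and slp: "strong_Lefschetz (ideal_gen {f1, f2, f3, f4})" by blast+
  obtain g where "invertible g" "segment_spans (change_coords g ` ideal_gen {f1, f2, f3, f4})"
    using strong_Lefschetz_segment_coordinates[OF hom reg slp] by blast
  with hom show ?case by (rule Gin_eq_segment_ideal)
next
  case 2
  obtain g0 where g0: "invertible g0"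
    "segment_spans (change_coords g0 ` ideal_gen {x1 ^ 2, x2 ^ 2, x3 ^ 2, x4 ^ 2 :: (4, 'k) mpol})"
    using squares_segment_coordinates by blast
  let ?fs0 = "[x1 ^ 2, x2 ^ 2, x3 ^ 2, x4 ^ 2 :: (4, 'k) mpol]"
  have "homogeneous 2 (Var i ^ 2 :: (4, 'k) mpol)" for i
    using homogeneous_power[OF homogeneous_Var, of 2 i] by simp
  then have fs0: "?fs0 \<in> forms [2, 2, 2, 2]" by (simp add: quadric_list_in_forms)
  have "segment_spans (change_coords g0 ` ideal_gen (set ?fs0))" using g0(2) by simp
  from segment_coordinates_open_in_forms[OF g0(1) fs0 this] obtain F where
    F: "poly_fun forms_coords F" "F ?fs0 \<noteq> 0"
      "\<And>fs. fs \<in> forms [2, 2, 2, 2] \<Longrightarrow> F fs \<noteq> 0 \<Longrightarrow> segment_spans (change_coords g0 ` ideal_gen (set fs))"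
    by blast
  obtain p where p: "\<And>fs. F fs = eval_with (\<lambda>a. a) (forms_coords fs) p" using F(1) by (auto simp: poly_fun_def)
  let ?U = "{fs \<in> forms [2, 2, 2, 2]. F fs \<noteq> 0}"
  have "zariski_open_in forms_coords (forms [2, 2, 2, 2]) ?U"
    unfolding zariski_open_in_def by (rule exI[of _ "{p}"]) (simp add: p)
  moreover have "?U \<noteq> {}" using F(2) fs0 by blast
  moreover have "Gin (ideal_gen (set fs)) = segment_ideal" if fs: "fs \<in> ?U" for fs
  proof -
    have "length fs = 4" using fs by (simp add: forms_quadrics)
    then obtain f1 f2 f3 f4 where fs_eq: "fs = [f1, f2, f3, f4]"
      by (auto simp: length_Suc_conv numeral_nat)
    have hom: "homogeneous 2 b" if "b \<in> {f1, f2, f3, f4}" for b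
    proof -
      have "b \<in> set fs" using that by (simp add: fs_eq)
      then show ?thesis using fs by (auto simp: forms_quadrics in_set_conv_nth)
    qed
    have "segment_spans (change_coords g0 ` ideal_gen {f1, f2, f3, f4})" using F(3)[of fs] fs by (simp add: fs_eq)
    with hom g0(1) have "Gin (ideal_gen {f1, f2, f3, f4}) = segment_ideal" by (rule Gin_eq_segment_ideal)
    then show ?thesis by (simp add: fs_eq)
  qed
  ultimately show ?case unfolding generic_sequence_def by blast
next
  case (3 f1 f2 f3 f4)
  define f where "f i = (if i = 0 then f1 else if i = 1 then f2 else if i = 2 then f3 else f4)" for i :: 4
  have range_f: "range f = {f1, f2, f3, f4}" unfolding UNIV_four image_insert image_empty f_def by simp
  have hom: "homogeneous 2 b" if "b \<in> {f1, f2, f3, f4}" for b using that 3 by auto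
  have reg: "regular_sequence [f1, f2, f3, f4]" using 3 by blast
  have low: "lookup m j = 0" if "g \<in> polys_in V" "m \<in> keys g" "j \<notin> V" for g V m and j :: 4
  proof -
    have "keys m \<subseteq> V" using that(1,2) by (simp add: polys_in_def)
    then have "j \<notin> keys m" using that(3) by blast
    then show ?thesis by (simp add: in_keys_iff)
  qed
  have V: "f2 \<in> polys_in {1, 2, 3}" "f3 \<in> polys_in {2, 3}" "f4 \<in> polys_in {3}" using 3 by blast+
  have four: "i = 0 \<or> i = 1 \<or> i = 2 \<or> i = 3" for i :: 4 using UNIV_four by blast
  have tri: "triangular f"
    unfolding triangular_def
  proof (intro allI conjI ballI impI)
    show "homogeneous 2 (f i)" for i using hom by (simp add: f_def)
    fix i j m assume m: "m \<in> keys (f i)" and j: "j < i"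
    from four[of i] four[of j] show "lookup m j = 0"
      using m j low[OF V(1), of m j] low[OF V(2), of m j] low[OF V(3), of m j]
      by (elim disjE) (simp_all add: f_def)
  qed
  have "homs 5 \<subseteq> ideal_gen {f1, f2, f3, f4}"
  proof -
    obtain C :: "(4, 'k) mpol set" where "finite C" "card C = 0" "homs 5 \<subseteq> mp.span (ideal_gen {f1, f2, f3, f4} \<union> C)"
      by (rule mp.rank_modE[OF complete_intersection_ranks(4)[OF hom reg]])
    then show ?thesis by simp
  qed
  then have "lookup (f i) (single i 2) \<noteq> 0" for i
    unfolding range_f[symmetric] by (rule triangular_leading_coefficients[OF tri])
  from triangular_segment_coordinates[OF tri this] obtain g where
    "invertible g" "segment_spans (change_coords g ` ideal_gen {f1, f2, f3, f4})" unfolding range_f by blast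
  with hom show ?case by (rule Gin_eq_segment_ideal)
qed

end
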